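(* Let $A$ be a maximal indecomposable cyclotomic $\mathbb{Z}[i]$-matrix that has only zeros on the diagonal and at least one entry of which has norm greater than $1$ (the norm of $z\in\mathbb{Z}[i]$ being $|z|^2$). Then $A$ is equivalent to an adjacency matrix of one of the graphs $C_{2k}$ ($k\geqslant 2$), $S_2$, $S_8^{\dagger\dagger}$, $S_8^{\ddagger}$.
   Context: **Matrices.** Let $R=\mathbb{Z}[i]$. A cyclotomic matrix over $R$ is a (finite, square) Hermitian matrix with entries in $R$ all of whose eigenvalues lie in $[-2,2]$. A Hermitian $R$-matrix is the adjacency matrix $(w(u,v))_{u,v}$ of a weighted directed graph ($R$-graph) with weight function $w$ satisfying $w(v,u)=\overline{w(u,v)}$; $w(v,v)$ is the charge of $v$. A matrix is indecomposable if its underlying graph (distinct $u,v$ adjacent iff $w(u,v)\neq 0$) is connected. An indecomposable cyclotomic $R$-matrix is maximal if it is not a (proper) principal submatrix of any other indecomposable cyclotomic $R$-matrix. Two $n\times n$ matrices $A,B$ over $R$ are equivalent if $A=\pm\sigma(QBQ^* )$ for some unitary matrix $Q$ with entries in $R$ ($QQ^*=Q^*Q=I$), some choice of sign, and $\sigma$ either the identity or complex conjugation applied entrywise. **Graphs.** Weights not determined by the listed ones via $w(v,u)=\overline{w(u,v)}$ are $0$. $C_{2k}$ ($k\ge2$): vertices $p,q$ and $t_j,b_j$ for $1\le j\le k-1$; for $1\le j\le k-2$: $w(t_j,t_{j+1})=w(t_j,b_{j+1})=1$, $w(b_j,t_{j+1})=w(b_j,b_{j+1})=-1$; $w(t_1,p)=w(b_1,p)=1+i$;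 $w(t_{k-1},q)=1+i$, $w(b_{k-1},q)=-1-i$. $S_2$: two uncharged vertices joined by an edge of weight $2$. $S_8^{\dagger\dagger}$: vertices $a,\dots,h$; weight $1$: $ab, cd, bf, ef, gh, dh, de, bg$; weight $-1$: $ae, cg$; $w(a,c)=1+i$, $w(h,f)=-1-i$, $w(d,b)=i$, $w(e,g)=-i$. $S_8^{\ddagger}$: vertices $a,\dots,h$; weight $1$: $ab, ae, cd, bf, gh, dh$; weight $-1$: $cg, ef$; $w(a,c)=w(e,g)=w(f,h)=1+i$, $w(b,d)=-1-i$. *)

theory Defs
  imports
    Jordan_Normal_Form.Schur_Decomposition
    Jordan_Normal_Form.DL_Submatrix
begin

section \<open>Cyclotomic matrices over the Gaussian integers\<close>

definition gauss_ints :: "complex set" where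
  "gauss_ints = {z. Re z \<in> \<int> \<and> Im z \<in> \<int>}"

definition gauss_mat :: "complex mat \<Rightarrow> bool" where
  "gauss_mat A \<longleftrightarrow> square_mat A \<and> elements_mat A \<subseteq> gauss_ints"

definition hermitian_mat :: "complex mat \<Rightarrow> bool" where
  "hermitian_mat A \<longleftrightarrow> square_mat A \<and> mat_adjoint A = A"

definition cyclotomic_mat :: "complex mat \<Rightarrow> bool" where
  "cyclotomic_mat A \<longleftrightarrow> gauss_mat A \<and> hermitian_mat A \<and>
     (\<forall>x. eigenvalue A x \<longrightarrow> x \<in> complex_of_real ` {-2..2})"

definition adjacent_in :: "complex mat \<Rightarrow> (nat \<times> nat) set" where
  "adjacent_in A = {(u, v). u < dim_row A \<and> v < dim_row A \<and> u \<noteq> v \<and> A $$ (u, v) \<noteq> 0}"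

text \<open>For a Hermitian matrix the relation \<open>adjacent_in A\<close> is symmetric, so that reachability
  is connectedness of the underlying graph. The graph without vertices does not count as connected.\<close>

definition indecomposable_mat :: "complex mat \<Rightarrow> bool" where
  "indecomposable_mat A \<longleftrightarrow> dim_row A > 0 \<and>
     (\<forall>u < dim_row A. \<forall>v < dim_row A. (u, v) \<in> (adjacent_in A)\<^sup>*)"

definition proper_principal_submatrix :: "complex mat \<Rightarrow> complex mat \<Rightarrow> bool" where
  "proper_principal_submatrix A B \<longleftrightarrow> (\<exists>I. I \<subset> {..<dim_row B} \<and> A = submatrix B I I)"

definition maximal_indecomposable_cyclotomic :: "complex mat \<Rightarrow> bool" where
  "maximal_indecomposable_cyclotomic A \<longleftrightarrow> cyclotomic_mat A \<and> indecomposable_mat A \<and>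
     \<not> (\<exists>B. cyclotomic_mat B \<and> indecomposable_mat B \<and> proper_principal_submatrix A B)"

definition gauss_unitary :: "complex mat \<Rightarrow> bool" where
  "gauss_unitary Q \<longleftrightarrow> gauss_mat Q \<and>
     Q * mat_adjoint Q = 1\<^sub>m (dim_row Q) \<and> mat_adjoint Q * Q = 1\<^sub>m (dim_row Q)"

definition equivalent_mat :: "complex mat \<Rightarrow> complex mat \<Rightarrow> bool" where
  "equivalent_mat A B \<longleftrightarrow> gauss_mat A \<and> gauss_mat B \<and> dim_row A = dim_row B \<and>
     (\<exists>Q \<epsilon> \<sigma>. gauss_unitary Q \<and> dim_row Q = dim_row B \<and> \<epsilon> \<in> {1, -1} \<and> \<sigma> \<in> {id, cnj} \<and>
        A = \<epsilon> \<cdot>\<^sub>m map_mat \<sigma> (Q * B * mat_adjoint Q))"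

section \<open>Weighted graphs and their adjacency matrices\<close>

text \<open>A graph is given by its vertex set and its weight function. An adjacency matrix depends on an
  enumeration of the vertices, so a graph has one for each such enumeration.\<close>

type_synonym 'v wgraph = "'v set \<times> ('v \<Rightarrow> 'v \<Rightarrow> complex)"

definition adjacency_matrix_of :: "'v wgraph \<Rightarrow> complex mat \<Rightarrow> bool" where
  "adjacency_matrix_of G B \<longleftrightarrow> (case G of (V, w) \<Rightarrow>
     finite V \<and> (\<exists>f. bij_betw f {..<card V} V \<and>
       B = mat (card V) (card V) (\<lambda>(i, j). w (f i) (f j))))"

definition equivalent_to_graph :: "complex mat \<Rightarrow> 'v wgraph \<Rightarrow> bool" where
  "equivalent_to_graph A G \<longleftrightarrow> (\<exists>B. adjacency_matrix_of G B \<and> equivalent_mat A B)"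

text \<open>The graphs below list each edge in one orientation only, with value 0 for a pair that is not
  listed; the weight of the opposite orientation is the complex conjugate.\<close>

definition hermitian_weight :: "('v \<Rightarrow> 'v \<Rightarrow> complex) \<Rightarrow> 'v \<Rightarrow> 'v \<Rightarrow> complex" where
  "hermitian_weight d u v = (if d u v \<noteq> 0 then d u v else cnj (d v u))"

definition listed :: "(('v \<times> 'v) \<times> complex) list \<Rightarrow> 'v \<Rightarrow> 'v \<Rightarrow> complex" where
  "listed es u v = (case map_of es (u, v) of None \<Rightarrow> 0 | Some z \<Rightarrow> z)"

datatype c_vertex = VP | VQ | VT nat | VB nat

fun c_listed :: "nat \<Rightarrow> c_vertex \<Rightarrow> c_vertex \<Rightarrow> complex" where
  "c_listed k (VT j) (VT l) = (if l = j + 1 then 1 else 0)"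
| "c_listed k (VT j) (VB l) = (if l = j + 1 then 1 else 0)"
| "c_listed k (VB j) (VT l) = (if l = j + 1 then -1 else 0)"
| "c_listed k (VB j) (VB l) = (if l = j + 1 then -1 else 0)"
| "c_listed k (VT j) VP = (if j = 1 then 1 + \<i> else 0)"
| "c_listed k (VB j) VP = (if j = 1 then 1 + \<i> else 0)"
| "c_listed k (VT j) VQ = (if j = k - 1 then 1 + \<i> else 0)"
| "c_listed k (VB j) VQ = (if j = k - 1 then - 1 - \<i> else 0)"
| "c_listed k VP _ = 0"
| "c_listed k VQ _ = 0"

text \<open>\<open>C_graph k\<close> is the graph $C_{2k}$, which has $2k$ vertices; it is meant for \<open>k \<ge> 2\<close>.\<close>

definition C_graph :: "nat \<Rightarrow> c_vertex wgraph" where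
  "C_graph k = ({VP, VQ} \<union> VT ` {1..k - 1} \<union> VB ` {1..k - 1}, hermitian_weight (c_listed k))"

datatype s2_vertex = V1 | V2

definition S2_graph :: "s2_vertex wgraph" where
  "S2_graph = ({V1, V2}, hermitian_weight (listed [((V1, V2), 2)]))"

datatype s8_vertex = Va | Vb | Vc | Vd | Ve | Vf | Vg | Vh

definition S8_dagger_dagger_graph :: "s8_vertex wgraph" where
  "S8_dagger_dagger_graph = (UNIV, hermitian_weight (listed
     [((Va, Vb), 1), ((Vc, Vd), 1), ((Vb, Vf), 1), ((Ve, Vf), 1),
      ((Vg, Vh), 1), ((Vd, Vh), 1), ((Vd, Ve), 1), ((Vb, Vg), 1),
      ((Va, Ve), -1), ((Vc, Vg), -1),
      ((Va, Vc), 1 + \<i>), ((Vh, Vf), - 1 - \<i>), ((Vd, Vb), \<i>), ((Ve, Vg), - \<i>)]))"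

text \<open>\<open>S8_dagger_dagger_graph\<close> is $S_8^{\dagger\dagger}$, and \<open>S8_ddagger_graph\<close> is
  $S_8^{\ddagger}$ (one double dagger).\<close>

definition S8_ddagger_graph :: "s8_vertex wgraph" where
  "S8_ddagger_graph = (UNIV, hermitian_weight (listed
     [((Va, Vb), 1), ((Va, Ve), 1), ((Vc, Vd), 1), ((Vb, Vf), 1),
      ((Vg, Vh), 1), ((Vd, Vh), 1),
      ((Vc, Vg), -1), ((Ve, Vf), -1),
      ((Va, Vc), 1 + \<i>), ((Ve, Vg), 1 + \<i>), ((Vf, Vh), 1 + \<i>), ((Vb, Vd), - 1 - \<i>)]))"

end

theory Submission
  imports Defs Jordan_Normal_Form.Spectral_Radius
begin

text \<open>Since \<open>A\<close> is Hermitian with spectrum in \<open>[-2, 2]\<close>, both \<open>2 + A\<close> and \<open>2 - A\<close> are positive semidefinite, and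
  maximality says that no vertex can be added without destroying this. Rows of \<open>A\<close> have norm at most \<open>4\<close>, so an
  entry of norm \<open>4\<close> splits off \<open>S\<^sub>2\<close>, and otherwise there are fat edges, of norm \<open>2\<close>.

  If all edges at some vertex \<open>p\<close> are fat, then \<open>p\<close>, divided by \<open>1 + \<i>\<close>, is a norm one vector that pairs integrally
  with the vectors whose Gram matrix is \<open>2 + A\<close>. It splits off, and peeling off one coordinate after the other
  writes the vertices as vectors \<open>e\<^sub>j \<plusminus> e\<^sub>j\<^sub>+\<^sub>1\<close> of norm \<open>2\<close>. The bound \<open>2 - A \<ge> 0\<close> leaves at most two edges from
  one coordinate to the next, maximality forces both, and the chain can only end in a second norm one
  vector. The result is \<open>C\<^sub>2\<^sub>k\<close>.

  Otherwise there is a fat edge whose ends both have a light neighbour. On these four vertices \<open>4 - A\<^sup>2\<close> restricts to a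
  unimodular Hermitian form, so by Bessel's inequality there is room for just four more vertices, which
  are determined by the weight between the two light neighbours. The two resulting graphs are
  \<open>S\<^sub>8\<^sup>\<dagger>\<^sup>\<dagger>\<close> and \<open>S\<^sub>8\<^sup>\<ddagger>\<close>.\<close>

section \<open>Positive semidefinite kernels on finite sets\<close>

text \<open>The sporadic case rests on g^2 = 4 for the target weight g. Let P be its block on the
  four chosen vertices and M the block between these and the rest: then 4 - P^2 = M M*, and M is
  invertible over the Gaussian integers. A cyclotomic w with the same block P and with rows X
  towards its other vertices satisfies X X* <= 4 - P^2 = M M*. In the coordinates of M this says X'
  X'* <= 1 with Gaussian entries, so X' has at most one nonzero entry in each row and column, a
  unit. A coordinate that is taken makes the bound tight, and the kernel of 4 - w^2 then fixes the
  remaining weights. So w embeds into the target before maximality is invoked; maximality makes the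
  embedding onto.

  Maximality enters only through one additional uncharged vertex with row x, which is admissible as
  soon as 2 + w and 2 - w both dominate x x*/2.

  A chain needs no bound on its length in advance: every coordinate costs a vertex.

  The eigenvalue condition is turned into a bound on the form by the growth of powers, not by
  diagonalization.\<close>

definition mv :: "'v set \<Rightarrow> ('v \<Rightarrow> 'v \<Rightarrow> complex) \<Rightarrow> ('v \<Rightarrow> complex) \<Rightarrow> 'v \<Rightarrow> complex" where
  "mv V h z u = (\<Sum>v\<in>V. h u v * z v)"

definition ip :: "'v set \<Rightarrow> ('v \<Rightarrow> complex) \<Rightarrow> ('v \<Rightarrow> complex) \<Rightarrow> complex" where
  "ip V y z = (\<Sum>u\<in>V. cnj (y u) * z u)"

definition nsq :: "'v set \<Rightarrow> ('v \<Rightarrow> complex) \<Rightarrow> real" where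
  "nsq V z = (\<Sum>u\<in>V. (cmod (z u))\<^sup>2)"

definition herm :: "'v set \<Rightarrow> ('v \<Rightarrow> 'v \<Rightarrow> complex) \<Rightarrow> bool" where
  "herm V h \<longleftrightarrow> (\<forall>u\<in>V. \<forall>v\<in>V. cnj (h u v) = h v u)"

definition psd :: "'v set \<Rightarrow> ('v \<Rightarrow> 'v \<Rightarrow> complex) \<Rightarrow> bool" where
  "psd V h \<longleftrightarrow> finite V \<and> herm V h \<and> (\<forall>z. 0 \<le> Re (ip V z (mv V h z)))"

abbreviation scalar_plus :: "complex \<Rightarrow> ('v \<Rightarrow> 'v \<Rightarrow> complex) \<Rightarrow> 'v \<Rightarrow> 'v \<Rightarrow> complex" where
  "scalar_plus c h \<equiv> \<lambda>u v. (if u = v then c else 0) + h u v"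

lemma hermD: "herm V h \<Longrightarrow> u \<in> V \<Longrightarrow> v \<in> V \<Longrightarrow> cnj (h u v) = h v u"
  by (simp add: herm_def)

abbreviation scalar_minus :: "complex \<Rightarrow> ('v \<Rightarrow> 'v \<Rightarrow> complex) \<Rightarrow> 'v \<Rightarrow> 'v \<Rightarrow> complex" where
  "scalar_minus c h \<equiv> \<lambda>u v. (if u = v then c else 0) - h u v"

lemma mv_diff: "mv V h (\<lambda>u. y u - z u) u = mv V h y u - mv V h z u"
  by (simp add: mv_def algebra_simps sum_subtractf)

lemma mv_scale: "mv V h (\<lambda>u. c * z u) u = c * mv V h z u"
  by (simp add: mv_def algebra_simps sum_distrib_left)

lemma mv_kernel_diff: "mv V (\<lambda>u v. g u v - h u v) z u = mv V g z u - mv V h z u"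
  by (simp add: mv_def algebra_simps sum_subtractf)

lemma mv_scalar_plus:
  assumes "finite V" "u \<in> V"
  shows "mv V (scalar_plus c h) z u = c * z u + mv V h z u"
proof -
  have "(\<Sum>v\<in>V. (if u = v then c else 0) * z v) = (\<Sum>v\<in>V. if u = v then c * z v else 0)"
    by (rule sum.cong) auto
  also have "\<dots> = c * z u" using assms by simp
  finally show ?thesis by (simp add: mv_def distrib_right sum.distrib)
qed

lemma mv_scalar_minus:
  assumes "finite V" "u \<in> V"
  shows "mv V (scalar_minus c h) z u = c * z u - mv V h z u"
  using mv_scalar_plus[OF assms, of c "\<lambda>u v. - h u v" z] by (simp add: mv_def sum_negf)

lemma mv_outer: "mv V (\<lambda>u v. x u * cnj (x v)) z u = x u * ip V x z"
  by (simp add: mv_def ip_def sum_distrib_left mult_ac)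

lemma mv_cong: "(\<And>v. v \<in> V \<Longrightarrow> z v = z' v) \<Longrightarrow> mv V h z u = mv V h z' u"
  by (simp add: mv_def)

lemma mv_single:
  assumes "finite V" "v \<in> V"
  shows "mv V h (\<lambda>t. if t = v then c else 0) u = h u v * c"
  using assms by (simp add: mv_def if_distrib cong: if_cong)

lemma ip_add: "ip V x (\<lambda>u. y u + z u) = ip V x y + ip V x z"
  by (simp add: ip_def algebra_simps sum.distrib)

lemma ip_diff: "ip V x (\<lambda>u. y u - z u) = ip V x y - ip V x z"
  by (simp add: ip_def algebra_simps sum_subtractf)

lemma ip_scale: "ip V x (\<lambda>u. c * z u) = c * ip V x z"
  by (simp add: ip_def algebra_simps sum_distrib_left)

lemma ip_cong: "(\<And>v. v \<in> V \<Longrightarrow> x v = x' v) \<Longrightarrow> (\<And>v. v \<in> V \<Longrightarrow> z v = z' v) \<Longrightarrow> ip V x z = ip V x' z'"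
  by (simp add: ip_def)

lemma cnj_ip: "cnj (ip V x y) = ip V y x"
  by (simp add: ip_def mult.commute)

lemma ip_add_left: "ip V (\<lambda>u. y u + z u) x = ip V y x + ip V z x"
  by (simp add: ip_def algebra_simps sum.distrib)

lemma ip_diff_left: "ip V (\<lambda>u. y u - z u) x = ip V y x - ip V z x"
  by (simp add: ip_def algebra_simps sum_subtractf)

lemma ip_scale_left: "ip V (\<lambda>u. c * z u) x = cnj c * ip V z x"
  by (simp add: ip_def algebra_simps sum_distrib_left)

lemma ip_self: "ip V z z = of_real (nsq V z)"
  by (simp add: ip_def nsq_def complex_norm_square mult.commute del: of_real_power)

lemma ip_single:
  assumes "finite V" "v \<in> V"
  shows "ip V (\<lambda>t. if t = v then c else 0) z = cnj c * z v"
  using assms by (simp add: ip_def if_distrib if_distribR cong: if_cong)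

lemma nsq_nonneg: "0 \<le> nsq V z"
  by (simp add: nsq_def sum_nonneg)

lemma nsq_ge_entry: "finite V \<Longrightarrow> u \<in> V \<Longrightarrow> (cmod (z u))\<^sup>2 \<le> nsq V z"
  unfolding nsq_def by (rule member_le_sum) auto

lemma nsq_single:
  assumes "finite V" "v \<in> V"
  shows "nsq V (\<lambda>t. if t = v then c else 0) = (cmod c)\<^sup>2"
proof -
  have "nsq V (\<lambda>t. if t = v then c else 0) = (\<Sum>t\<in>V. if t = v then (cmod c)\<^sup>2 else 0)"
    unfolding nsq_def by (rule sum.cong) auto
  then show ?thesis using assms by simp
qed

lemma herm_ip_mv:
  assumes "herm V h"
  shows "ip V y (mv V h z) = cnj (ip V z (mv V h y))"
proof -
  have "ip V y (mv V h z) = (\<Sum>u\<in>V. \<Sum>v\<in>V. cnj (y u) * h u v * z v)"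
    by (simp add: ip_def mv_def sum_distrib_left mult.assoc)
  also have "\<dots> = (\<Sum>v\<in>V. \<Sum>u\<in>V. cnj (y u) * h u v * z v)"
    by (rule sum.swap)
  also have "\<dots> = (\<Sum>v\<in>V. \<Sum>u\<in>V. cnj (cnj (z v) * (h v u * y u)))"
    by (intro sum.cong refl) (simp add: hermD[OF assms] mult_ac)
  also have "\<dots> = cnj (ip V z (mv V h y))"
    by (simp add: ip_def mv_def sum_distrib_left)
  finally show ?thesis .
qed

lemma herm_ip_real: "herm V h \<Longrightarrow> ip V z (mv V h z) = of_real (Re (ip V z (mv V h z)))"
  using herm_ip_mv[of V h z z] by (simp add: complex_eq_iff)

lemma herm_expand:
  assumes "herm V h"
  shows "Re (ip V (\<lambda>u. y u - t * z u) (mv V h (\<lambda>u. y u - t * z u)))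
    = Re (ip V y (mv V h y)) - 2 * Re (t * ip V y (mv V h z)) + (cmod t)\<^sup>2 * Re (ip V z (mv V h z))"
proof -
  have mv: "mv V h (\<lambda>u. y u - t * z u) = (\<lambda>u. mv V h y u - t * mv V h z u)"
    by (simp add: fun_eq_iff mv_diff mv_scale)
  have e: "ip V (\<lambda>u. y u - t * z u) (\<lambda>u. mv V h y u - t * mv V h z u)
     = ip V y (mv V h y) - t * ip V y (mv V h z) - cnj t * ip V z (mv V h y)
       + cnj t * t * ip V z (mv V h z)"
    by (simp add: ip_diff_left ip_diff ip_scale ip_scale_left algebra_simps)
  have 1: "cnj t * ip V z (mv V h y) = cnj (t * ip V y (mv V h z))"
    using herm_ip_mv[OF assms, of z y] by simp
  have 2: "cnj t * t = of_real ((cmod t)\<^sup>2)"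
    by (simp add: complex_norm_square mult.commute del: of_real_power)
  show ?thesis unfolding mv e 1 2 by (simp del: of_real_power)
qed

lemma psd_cauchy_schwarz:
  assumes "psd V h"
  shows "(cmod (ip V y (mv V h z)))\<^sup>2 \<le> Re (ip V y (mv V h y)) * Re (ip V z (mv V h z))"
proof -
  have H: "herm V h" and P: "\<And>z. 0 \<le> Re (ip V z (mv V h z))"
    using assms by (auto simp: psd_def)
  define a where "a = Re (ip V z (mv V h z))"
  define c where "c = Re (ip V y (mv V h y))"
  define b where "b = ip V y (mv V h z)"
  have ineq: "0 \<le> c - 2 * Re (t * b) + (cmod t)\<^sup>2 * a" for t
    using P[of "\<lambda>u. y u - t * z u"] herm_expand[OF H, of y t z] by (simp add: a_def b_def c_def)
  have bb: "Re (cnj b * b) = (cmod b)\<^sup>2"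
    unfolding cmod_power2 by (simp add: power2_eq_square)
  show ?thesis
  proof (cases "a = 0")
    case True
    have "b = 0"
    proof (rule ccontr)
      assume "b \<noteq> 0"
      then have pos: "(cmod b)\<^sup>2 > 0" by simp
      \<comment> \<open>With \<open>a = 0\<close> the expression in \<open>ineq\<close> is affine in
        the multiple of \<open>cnj b\<close>; this multiple makes it -1.\<close>
      define r where "r = (c + 1) / (2 * (cmod b)\<^sup>2)"
      have "0 \<le> c - 2 * (r * (cmod b)\<^sup>2)"
        using ineq[of "of_real r * cnj b"] True bb by (simp add: mult.assoc)
      then show False using pos by (simp add: r_def)
    qed
    then show ?thesis using True by (simp add: a_def b_def)
  next
    case False
    then have a: "a > 0" using P[of z] by (simp add: a_def)
    have "Re (cnj b / of_real a * b) = (cmod b)\<^sup>2 / a" using bb by (simp add: Re_divide_of_real)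
    then have "0 \<le> c - 2 * ((cmod b)\<^sup>2 / a) + (cmod b / a)\<^sup>2 * a"
      using ineq[of "cnj b / of_real a"] a by (simp add: norm_divide)
    also have "\<dots> = c - (cmod b)\<^sup>2 / a" using a by (simp add: power2_eq_square field_simps)
    finally show ?thesis using a by (simp add: field_simps a_def b_def c_def)
  qed
qed

text \<open>Cauchy-Schwarz against the unit vector at \<open>u\<close>: the mixed term is
  \<open>mv V h z u\<close>, and the bound is zero.\<close>

lemma psd_kernel:
  assumes "psd V h" "Re (ip V z (mv V h z)) = 0" "u \<in> V"
  shows "mv V h z u = 0"
proof -
  have "finite V" using assms by (simp add: psd_def)
  then have "ip V (\<lambda>t. if t = u then 1 else 0) (mv V h z) = mv V h z u"
    using ip_single[of V u 1 "mv V h z"] assms by simp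
  then show ?thesis using psd_cauchy_schwarz[OF assms(1), of "\<lambda>t. if t = u then 1 else 0" z] assms(2) by simp
qed

lemma psd_diag:
  assumes "psd V h" "u \<in> V"
  shows "0 \<le> Re (h u u)"
proof -
  have f: "finite V" and "0 \<le> Re (ip V (\<lambda>t. if t = u then 1 else 0) (mv V h (\<lambda>t. if t = u then 1 else 0)))"
    using assms by (auto simp: psd_def)
  then show ?thesis using assms by (simp add: ip_single mv_single)
qed

lemma psd_diag_zero:
  assumes "psd V h" "u \<in> V" "v \<in> V" "h u u = 0"
  shows "h v u = 0" "h u v = 0"
proof -
  have f: "finite V" and H: "herm V h" using assms by (auto simp: psd_def)
  show "h v u = 0"
    using psd_kernel[OF assms(1), of "\<lambda>t. if t = u then 1 else 0" v] assms f
    by (simp add: ip_single mv_single)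
  then show "h u v = 0" using hermD[OF H assms(3,2)] by simp
qed

lemma psd_minus_outer:
  assumes "psd V h" "\<And>z. (cmod (ip V x z))\<^sup>2 \<le> Re (ip V z (mv V h z))"
  shows "psd V (\<lambda>u v. h u v - x u * cnj (x v))"
proof -
  have "Re (ip V z (mv V (\<lambda>u v. h u v - x u * cnj (x v)) z))
     = Re (ip V z (mv V h z)) - (cmod (ip V x z))\<^sup>2" for z
  proof -
    have "mv V (\<lambda>u v. h u v - x u * cnj (x v)) z = (\<lambda>u. mv V h z u - ip V x z * x u)"
      by (intro ext) (simp only: mv_kernel_diff mv_outer mult.commute)
    then have "ip V z (mv V (\<lambda>u v. h u v - x u * cnj (x v)) z)
       = ip V z (mv V h z) - ip V x z * cnj (ip V x z)"
      by (simp only: ip_diff ip_scale cnj_ip)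
    moreover have "ip V x z * cnj (ip V x z) = of_real ((cmod (ip V x z))\<^sup>2)"
      by (rule complex_norm_square[symmetric])
    ultimately show ?thesis by (simp only: minus_complex.sel Re_complex_of_real)
  qed
  moreover have "herm V (\<lambda>u v. h u v - x u * cnj (x v))"
    using assms(1) by (simp add: psd_def herm_def mult.commute)
  ultimately show ?thesis using assms unfolding psd_def by simp
qed

text \<open>The subtracted rank one kernel is column \<open>u\<close> times its adjoint, divided by
  \<open>c\<close>, whatever the phase of \<open>s\<close>. The phase is left free to make
  \<open>x\<close> integral or to give it a prescribed entry at \<open>u\<close>.\<close>

lemma psd_schur_complement:
  assumes h: "psd V h" and u: "u \<in> V" "h u u = of_real c" and x: "\<And>v. v \<in> V \<Longrightarrow> x v = s * h v u"
    and s: "(cmod s)\<^sup>2 * c = 1"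
  shows "psd V (\<lambda>v v'. h v v' - x v * cnj (x v'))"
proof (rule psd_minus_outer[OF h, of x])
  fix z
  have f: "finite V" using h by (simp add: psd_def)
  define d :: "'a \<Rightarrow> complex" where "d = (\<lambda>t. if t = u then 1 else 0)"
  have md: "mv V h d v = h v u" for v
    unfolding d_def by (simp add: mv_single[OF f u(1)])
  have dd: "Re (ip V d (mv V h d)) = c"
    using ip_single[OF f u(1), of 1 "mv V h d"] u(2) by (simp add: md d_def[symmetric])
  have x': "ip V x z = ip V (\<lambda>v. s * mv V h d v) z"
    by (rule ip_cong) (simp_all add: x md)
  have "(cmod (ip V x z))\<^sup>2 = (cmod s)\<^sup>2 * (cmod (ip V z (mv V h d)))\<^sup>2"
    unfolding x' ip_scale_left cnj_ip[of V z "mv V h d", symmetric]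
    by (simp only: norm_mult power_mult_distrib complex_mod_cnj)
  also have "\<dots> \<le> (cmod s)\<^sup>2 * (Re (ip V z (mv V h z)) * c)"
    by (rule mult_left_mono) (use psd_cauchy_schwarz[OF h, of z d] dd in simp_all)
  also have "\<dots> = (cmod s)\<^sup>2 * c * Re (ip V z (mv V h z))"
    by (simp only: mult_ac)
  finally show "(cmod (ip V x z))\<^sup>2 \<le> Re (ip V z (mv V h z))"
    using s by simp
qed

section \<open>Gaussian integers of small norm\<close>

lemma gauss_intsE:
  assumes "z \<in> gauss_ints"
  obtains a b where "z = Complex (of_int a) (of_int b)"
  using assms that unfolding gauss_ints_def by (auto elim!: Ints_cases simp: complex_eq_iff)

lemma gauss_ints_simps [simp]:
  "0 \<in> gauss_ints" "1 \<in> gauss_ints" "\<i> \<in> gauss_ints" "numeral k \<in> gauss_ints"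
  by (simp_all add: gauss_ints_def)

lemma gauss_ints_add: "x \<in> gauss_ints \<Longrightarrow> y \<in> gauss_ints \<Longrightarrow> x + y \<in> gauss_ints"
  and gauss_ints_diff: "x \<in> gauss_ints \<Longrightarrow> y \<in> gauss_ints \<Longrightarrow> x - y \<in> gauss_ints"
  and gauss_ints_mult: "x \<in> gauss_ints \<Longrightarrow> y \<in> gauss_ints \<Longrightarrow> x * y \<in> gauss_ints"
  and gauss_ints_cnj: "x \<in> gauss_ints \<Longrightarrow> cnj x \<in> gauss_ints"
  and gauss_ints_minus: "x \<in> gauss_ints \<Longrightarrow> - x \<in> gauss_ints"
  by (auto simp: gauss_ints_def)

lemma gauss_ints_sum: "(\<And>i. i \<in> I \<Longrightarrow> f i \<in> gauss_ints) \<Longrightarrow> sum f I \<in> gauss_ints"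
  by (induction I rule: infinite_finite_induct) (auto intro: gauss_ints_add)

lemma gauss_norm_nat:
  assumes "z \<in> gauss_ints"
  obtains k :: nat where "(cmod z)\<^sup>2 = real k"
proof -
  obtain a b where z: "z = Complex (of_int a) (of_int b)" by (rule gauss_intsE[OF assms])
  have "(cmod z)\<^sup>2 = real (nat (a\<^sup>2 + b\<^sup>2))"
    unfolding z cmod_power2 by simp
  then show ?thesis by (rule that)
qed

lemma gauss_norm_ge_1:
  assumes "z \<in> gauss_ints" "z \<noteq> 0"
  shows "1 \<le> (cmod z)\<^sup>2"
proof -
  obtain k :: nat where k: "(cmod z)\<^sup>2 = real k" by (rule gauss_norm_nat[OF assms(1)])
  then have "k \<noteq> 0" using assms(2) by (cases "k = 0") auto
  then show ?thesis unfolding k by simp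
qed

lemma gauss_small_square:
  fixes a :: int
  assumes "a\<^sup>2 \<le> 3"
  shows "a \<in> {-1, 0, 1}"
proof (rule ccontr)
  assume "a \<notin> {-1, 0, 1}"
  then have "\<bar>a\<bar> \<ge> 2" by auto
  then have "\<bar>a\<bar>\<^sup>2 \<ge> 2\<^sup>2" by (intro power_mono) auto
  then show False using assms by simp
qed

text \<open>3 is not a sum of two squares, so below norm 4 only 0, the units and the associates of
  \<open>1 + \<i>\<close> remain.\<close>

lemma gauss_norm_less_4:
  assumes "z \<in> gauss_ints" "(cmod z)\<^sup>2 < 4"
  shows "z = 0 \<or> z \<in> {1, -1, \<i>, -\<i>} \<or> z \<in> {1 + \<i>, 1 - \<i>, -1 + \<i>, -1 - \<i>}"
proof -
  obtain a b where z: "z = Complex (of_int a) (of_int b)" by (rule gauss_intsE[OF assms(1)])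
  have "real_of_int (a\<^sup>2 + b\<^sup>2) < 4" using assms(2) unfolding z cmod_power2 by simp
  then have ab: "a\<^sup>2 + b\<^sup>2 < 4" by linarith
  have "a \<in> {-1, 0, 1}" "b \<in> {-1, 0, 1}"
    by (rule gauss_small_square, use ab zero_le_power2[of b] zero_le_power2[of a] in linarith)+
  then show ?thesis unfolding z by (elim insertE emptyE) (simp_all add: complex_eq_iff)
qed

lemma gauss_norm_cases:
  assumes "z \<in> gauss_ints" "(cmod z)\<^sup>2 < 4"
  obtains "z = 0" | "(cmod z)\<^sup>2 = 1" | "(cmod z)\<^sup>2 = 2"
proof -
  have "z = 0 \<or> (cmod z)\<^sup>2 = 1 \<or> (cmod z)\<^sup>2 = 2"
    using gauss_norm_less_4[OF assms] by (elim disjE insertE) (simp_all add: cmod_power2)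
  then show ?thesis using that by blast
qed

lemma gauss_norm_1:
  assumes "z \<in> gauss_ints" "(cmod z)\<^sup>2 = 1"
  shows "z \<in> {1, -1, \<i>, -\<i>}"
  using gauss_norm_less_4[OF assms(1)] assms(2) by (auto simp: cmod_power2)

definition gunit :: "complex \<Rightarrow> bool" where
  "gunit s \<longleftrightarrow> s \<in> gauss_ints \<and> cmod s = 1"

lemma gunit_cnj_mult: "gunit s \<Longrightarrow> s * cnj s = 1" "gunit s \<Longrightarrow> cnj s * s = 1"
  using complex_norm_square[of s] by (simp_all add: gunit_def mult.commute)

lemma gunit_1 [simp]: "gunit 1" by (simp add: gunit_def)

lemma gunit_mult: "gunit s \<Longrightarrow> gunit t \<Longrightarrow> gunit (s * t)"
  by (simp add: gunit_def gauss_ints_mult norm_mult)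

lemma gunit_cnj: "gunit s \<Longrightarrow> gunit (cnj s)"
  by (simp add: gunit_def gauss_ints_cnj)

lemma gunitI: "s \<in> gauss_ints \<Longrightarrow> (cmod s)\<^sup>2 = 1 \<Longrightarrow> gunit s"
  using norm_ge_zero[of s] by (auto simp: gunit_def power2_eq_1_iff)

text \<open>2 is ramified: all its prime divisors are associates of \<open>1 + \<i>\<close>. Hence a
  unit factor at one end normalizes every fat edge.\<close>

lemma gauss_norm_2:
  assumes "z \<in> gauss_ints" "(cmod z)\<^sup>2 = 2"
  obtains s where "gunit s" "z = (1 + \<i>) * s"
proof -
  have "z \<in> {1 + \<i>, 1 - \<i>, -1 + \<i>, -1 - \<i>}"
    using gauss_norm_less_4[OF assms(1)] assms(2) by (auto simp: cmod_power2)
  then have "z = (1 + \<i>) * 1 \<or> z = (1 + \<i>) * - \<i> \<or> z = (1 + \<i>) * \<i> \<or> z = (1 + \<i>) * (-1)"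
    by (auto simp: complex_eq_iff)
  moreover have "gunit 1" "gunit (- \<i>)" "gunit \<i>" "gunit (-1)"
    by (simp_all add: gunit_def gauss_ints_def)
  ultimately show ?thesis using that by blast
qed

section \<open>Cyclotomic weights\<close>

text \<open>The spectral condition as a bound on the quadratic form. In this shape it passes at once
  to subsets, to rescalings by units and to bordered matrices.\<close>

definition cyc :: "'v set \<Rightarrow> ('v \<Rightarrow> 'v \<Rightarrow> complex) \<Rightarrow> bool" where
  "cyc V w \<longleftrightarrow> finite V \<and> (\<forall>u\<in>V. \<forall>v\<in>V. w u v \<in> gauss_ints) \<and> herm V w \<and>
     (\<forall>z. \<bar>Re (ip V z (mv V w z))\<bar> \<le> 2 * nsq V z)"

text \<open>Connectedness by cuts instead of paths, because its uses confront a constructed vertex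
  set with the set of all vertices.\<close>

definition conn :: "'v set \<Rightarrow> ('v \<Rightarrow> 'v \<Rightarrow> complex) \<Rightarrow> bool" where
  "conn V w \<longleftrightarrow> (\<forall>S. S \<subset> V \<and> S \<noteq> {} \<longrightarrow> (\<exists>u\<in>S. \<exists>v\<in>V - S. w u v \<noteq> 0))"

text \<open>The weight \<open>w\<close> has no cyclotomic extension by an uncharged vertex with adjacency vector \<open>x\<close>:
  the form below is that of the bordered matrix at the vector \<open>(z, \<zeta>)\<close>.\<close>

definition no_ext :: "'v set \<Rightarrow> ('v \<Rightarrow> 'v \<Rightarrow> complex) \<Rightarrow> bool" where
  "no_ext V w \<longleftrightarrow> (\<forall>x. (\<forall>u\<in>V. x u \<in> gauss_ints) \<and> (\<exists>u\<in>V. x u \<noteq> 0) \<longrightarrow>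
     \<not> (\<forall>z \<zeta>. \<bar>Re (ip V z (mv V w z)) + 2 * Re (\<zeta> * ip V z x)\<bar> \<le> 2 * (nsq V z + (cmod \<zeta>)\<^sup>2)))"

lemma cycD:
  assumes "cyc V w"
  shows "finite V" "herm V w" "\<And>u v. u \<in> V \<Longrightarrow> v \<in> V \<Longrightarrow> w u v \<in> gauss_ints"
  using assms by (auto simp: cyc_def)

lemma ip_mv_scalar_plus:
  assumes "finite V"
  shows "ip V z (mv V (scalar_plus c h) z) = c * of_real (nsq V z) + ip V z (mv V h z)"
proof -
  have "ip V z (mv V (scalar_plus c h) z) = ip V z (\<lambda>u. c * z u + mv V h z u)"
    by (rule ip_cong) (simp_all add: mv_scalar_plus[OF assms])
  then show ?thesis by (simp add: ip_add ip_scale ip_self)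
qed

lemma ip_mv_scalar_minus:
  assumes "finite V"
  shows "ip V z (mv V (scalar_minus c h) z) = c * of_real (nsq V z) - ip V z (mv V h z)"
proof -
  have "ip V z (mv V (scalar_minus c h) z) = ip V z (\<lambda>u. c * z u - mv V h z u)"
    by (rule ip_cong) (simp_all add: mv_scalar_minus[OF assms])
  then show ?thesis by (simp add: ip_diff ip_scale ip_self)
qed

lemma cyc_psd:
  assumes c: "cyc V w"
  shows "psd V (scalar_plus 2 w)" "psd V (scalar_minus 2 w)"
proof -
  have b: "\<bar>Re (ip V z (mv V w z))\<bar> \<le> 2 * nsq V z" for z using c by (simp add: cyc_def)
  have h: "herm V (scalar_plus 2 w)" "herm V (scalar_minus 2 w)"
    using cycD(2)[OF c] by (auto simp: herm_def)
  have "0 \<le> Re (ip V z (mv V (scalar_plus 2 w) z))" for z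
    using b[of z] by (simp add: ip_mv_scalar_plus[OF cycD(1)[OF c]])
  then show "psd V (scalar_plus 2 w)"
    using h cycD(1)[OF c] by (simp add: psd_def)
  have "0 \<le> Re (ip V z (mv V (scalar_minus 2 w) z))" for z
    using b[of z] by (simp add: ip_mv_scalar_minus[OF cycD(1)[OF c]])
  then show "psd V (scalar_minus 2 w)"
    using h cycD(1)[OF c] by (simp add: psd_def)
qed

lemma nsq_add: "nsq V (\<lambda>u. y u + z u) = nsq V y + nsq V z + 2 * Re (ip V y z)"
proof -
  have "of_real (nsq V (\<lambda>u. y u + z u)) = ip V y y + ip V z z + (ip V y z + cnj (ip V y z))"
    unfolding ip_self[symmetric] cnj_ip by (simp add: ip_add ip_add_left)
  also have "\<dots> = of_real (nsq V y + nsq V z + 2 * Re (ip V y z))"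
    by (simp add: ip_self complex_eq_iff)
  finally show ?thesis using of_real_eq_iff by blast
qed

lemma nsq_scale: "nsq V (\<lambda>u. c * z u) = (cmod c)\<^sup>2 * nsq V z"
  by (simp add: nsq_def norm_mult power_mult_distrib sum_distrib_left)

text \<open>Polarize the form at \<open>z \<plusminus> y\<close> with \<open>2 y\<close> the image of \<open>z\<close>.\<close>

lemma cyc_nsq_mv:
  assumes c: "cyc V w"
  shows "nsq V (mv V w z) \<le> 4 * nsq V z"
proof -
  define y where "y = (\<lambda>u. (1/2) * mv V w z u)"
  have h: "herm V w" by (rule cycD(2)[OF c])
  have b: "\<bar>Re (ip V x (mv V w x))\<bar> \<le> 2 * nsq V x" for x using c by (simp add: cyc_def)
  have e1: "Re (ip V (\<lambda>u. y u - (-1) * z u) (mv V w (\<lambda>u. y u - (-1) * z u)))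
    = Re (ip V y (mv V w y)) + 2 * Re (ip V y (mv V w z)) + Re (ip V z (mv V w z))"
    using herm_expand[OF h, of y "-1" z] by simp
  have e2: "Re (ip V (\<lambda>u. y u - 1 * z u) (mv V w (\<lambda>u. y u - 1 * z u)))
    = Re (ip V y (mv V w y)) - 2 * Re (ip V y (mv V w z)) + Re (ip V z (mv V w z))"
    using herm_expand[OF h, of y 1 z] by simp
  have n1: "nsq V (\<lambda>u. y u - (-1) * z u) = nsq V y + nsq V z + 2 * Re (ip V y z)"
    using nsq_add[of V y z] by simp
  have "nsq V (\<lambda>u. y u + (-1) * z u) = nsq V y + nsq V z - 2 * Re (ip V y z)"
    unfolding nsq_add nsq_scale ip_scale by simp
  then have n2: "nsq V (\<lambda>u. y u - 1 * z u) = nsq V y + nsq V z - 2 * Re (ip V y z)"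
    by simp
  have "4 * Re (ip V y (mv V w z)) \<le> 4 * (nsq V y + nsq V z)"
    using abs_le_D1[OF b[of "\<lambda>u. y u - (-1) * z u"]] abs_le_D2[OF b[of "\<lambda>u. y u - 1 * z u"]]
    unfolding e1 e2 n1 n2 by argo
  moreover have "Re (ip V y (mv V w z)) = nsq V (mv V w z) / 2"
    unfolding y_def ip_scale_left ip_self by simp
  moreover have "nsq V y = nsq V (mv V w z) / 4"
    unfolding y_def nsq_scale by (simp add: power2_eq_square)
  ultimately show ?thesis by simp
qed

text \<open>By \<open>cyc_nsq_mv\<close> the form 4 - w^2 is semidefinite. Equality makes
  \<open>z\<close> isotropic for it, hence a kernel vector.\<close>

lemma cyc_tight:
  assumes c: "cyc V w" and eq: "nsq V (mv V w z) = 4 * nsq V z" and u: "u \<in> V"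
  shows "mv V w (mv V w z) u = 4 * z u"
proof -
  let ?m = "scalar_minus 4 (\<lambda>u v. \<Sum>t\<in>V. w u t * w t v)"
  have h: "herm V w" and f: "finite V" using cycD[OF c] by auto
  have ww: "mv V (\<lambda>u v. \<Sum>t\<in>V. w u t * w t v) x v = mv V w (mv V w x) v" for x v
  proof -
    have "mv V (\<lambda>u v. \<Sum>t\<in>V. w u t * w t v) x v = (\<Sum>s\<in>V. \<Sum>t\<in>V. w v t * w t s * x s)"
      by (simp add: mv_def sum_distrib_right)
    also have "\<dots> = (\<Sum>t\<in>V. \<Sum>s\<in>V. w v t * w t s * x s)" by (rule sum.swap)
    finally show ?thesis by (simp add: mv_def sum_distrib_left mult.assoc)
  qed
  have mvm: "mv V ?m x v = 4 * x v - mv V w (mv V w x) v" if "v \<in> V" for x v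
    by (simp add: mv_scalar_minus[OF f that] ww)
  have form: "Re (ip V x (mv V ?m x)) = 4 * nsq V x - nsq V (mv V w x)" for x
  proof -
    have "ip V x (mv V ?m x) = ip V x (\<lambda>v. 4 * x v - mv V w (mv V w x) v)"
      by (rule ip_cong) (simp_all add: mvm)
    also have "\<dots> = 4 * of_real (nsq V x) - cnj (ip V (mv V w x) (mv V w x))"
      by (simp add: ip_diff ip_scale ip_self herm_ip_mv[OF h, of x "mv V w x"])
    finally show ?thesis by (simp add: ip_self)
  qed
  have "herm V ?m"
    using h by (auto simp: herm_def mult.commute intro!: sum.cong)
  then have "psd V ?m"
    using f cyc_nsq_mv[OF c] by (simp add: psd_def form)
  from psd_kernel[OF this _ u, of z] show ?thesis using eq mvm[OF u, of z] by (simp add: form)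
qed

lemma cyc_subset:
  assumes c: "cyc V w" and U: "U \<subseteq> V"
  shows "cyc U w"
proof -
  have f: "finite V" by (rule cycD(1)[OF c])
  have "\<bar>Re (ip U z (mv U w z))\<bar> \<le> 2 * nsq U z" for z
  proof -
    let ?z = "\<lambda>u. if u \<in> U then z u else 0"
    have m: "mv V w ?z u = mv U w z u" for u
      unfolding mv_def by (rule sum.mono_neutral_cong_right) (use f U in auto)
    have "ip V ?z (mv V w ?z) = ip U z (mv U w z)"
      unfolding ip_def m by (rule sum.mono_neutral_cong_right) (use f U in auto)
    moreover have "nsq V ?z = nsq U z"
      unfolding nsq_def by (rule sum.mono_neutral_cong_right) (use f U in auto)
    ultimately show ?thesis using c unfolding cyc_def by metis
  qed
  then show ?thesis using c U finite_subset[OF U f] unfolding cyc_def herm_def by blast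
qed

lemma cyc_nsq_col:
  assumes c: "cyc V w" and v: "v \<in> V"
  shows "nsq V (\<lambda>u. w u v) \<le> 4"
proof -
  have "mv V w (\<lambda>t. if t = v then 1 else 0) = (\<lambda>u. w u v)"
    by (simp add: fun_eq_iff mv_single[OF cycD(1)[OF c] v])
  then show ?thesis
    using cyc_nsq_mv[OF c, of "\<lambda>t. if t = v then 1 else 0"] nsq_single[OF cycD(1)[OF c] v, of 1] by simp
qed

lemma nsq_of_square:
  assumes h: "herm V w" and sq: "\<And>z u. u \<in> V \<Longrightarrow> mv V w (mv V w z) u = 4 * z u"
  shows "nsq V (mv V w z) = 4 * nsq V z"
proof -
  have "complex_of_real (nsq V (mv V w z)) = cnj (ip V z (mv V w (mv V w z)))"
    unfolding ip_self[symmetric] by (rule herm_ip_mv[OF h])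
  also have "ip V z (mv V w (mv V w z)) = ip V z (\<lambda>u. 4 * z u)"
    by (rule ip_cong) (simp_all add: sq)
  finally have "complex_of_real (nsq V (mv V w z)) = of_real (4 * nsq V z)"
    by (simp add: ip_scale ip_self)
  then show ?thesis using of_real_eq_iff by blast
qed

text \<open>Converse of \<open>cyc_nsq_mv\<close>: expand the norms of w z + 2 z and w z - 2 z, both
  nonnegative.\<close>

lemma cyc_of_nsq_mv:
  assumes f: "finite V" and g: "\<And>u v. u \<in> V \<Longrightarrow> v \<in> V \<Longrightarrow> w u v \<in> gauss_ints" and h: "herm V w"
    and n: "\<And>z. nsq V (mv V w z) \<le> 4 * nsq V z"
  shows "cyc V w"
proof -
  have "\<bar>Re (ip V z (mv V w z))\<bar> \<le> 2 * nsq V z" for z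
  proof -
    have "0 \<le> nsq V (\<lambda>u. mv V w z u + 2 * z u)" "0 \<le> nsq V (\<lambda>u. mv V w z u + (- 2) * z u)"
      by (rule nsq_nonneg)+
    moreover have "Re (ip V (mv V w z) z) = Re (ip V z (mv V w z))"
      by (metis cnj.sel(1) cnj_ip)
    ultimately show ?thesis using n[of z] unfolding nsq_add nsq_scale ip_scale by simp
  qed
  then show ?thesis using f g h by (simp add: cyc_def)
qed

lemma cyc_of_square:
  assumes "finite V" "\<And>u v. u \<in> V \<Longrightarrow> v \<in> V \<Longrightarrow> w u v \<in> gauss_ints" "herm V w"
    and "\<And>z u. u \<in> V \<Longrightarrow> mv V w (mv V w z) u = 4 * z u"
  shows "cyc V w"
  using assms nsq_of_square[of V w] by (intro cyc_of_nsq_mv) auto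

section \<open>Embedding into a larger weight\<close>

text \<open>Conjugation by the diagonal unitary matrix of the units \<open>s\<close> carries a
  principal submatrix of \<open>g\<close> to \<open>w\<close>. If \<open>f\<close> is also onto,
  this is an equivalence of matrices.\<close>

definition embeds :: "'v set \<Rightarrow> ('v \<Rightarrow> 'v \<Rightarrow> complex) \<Rightarrow> 'x set \<Rightarrow> ('x \<Rightarrow> 'x \<Rightarrow> complex) \<Rightarrow> ('v \<Rightarrow> 'x) \<Rightarrow> ('v \<Rightarrow> complex) \<Rightarrow> bool" where
  "embeds V w G g f s \<longleftrightarrow> inj_on f V \<and> f ` V \<subseteq> G \<and> (\<forall>u\<in>V. gunit (s u)) \<and>
     (\<forall>u\<in>V. \<forall>v\<in>V. w u v = s u * g (f u) (f v) * cnj (s v))"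

text \<open>If the image missed a vertex, connectedness would give a missed neighbour
  \<open>r\<close> of it. The row of \<open>r\<close>, transported by \<open>s\<close>, extends
  \<open>w\<close> to a matrix that is up to units a principal submatrix of \<open>g\<close>, hence
  cyclotomic, contrary to \<open>no_ext\<close>.\<close>

lemma embeds_no_ext_surj:
  assumes e: "embeds V w G g f s" and ne: "no_ext V w" and V: "V \<noteq> {}"
    and cg: "cyc G g" and cn: "conn G g" and diag: "\<And>x. x \<in> G \<Longrightarrow> g x x = 0"
  shows "f ` V = G"
proof (rule ccontr)
  assume "f ` V \<noteq> G"
  have inj: "inj_on f V" and sub: "f ` V \<subseteq> G" and su: "\<And>u. u \<in> V \<Longrightarrow> gunit (s u)"
    and w: "\<And>u v. u \<in> V \<Longrightarrow> v \<in> V \<Longrightarrow> w u v = s u * g (f u) (f v) * cnj (s v)"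
    using e by (auto simp: embeds_def)
  have fG: "finite G" by (rule cycD(1)[OF cg])
  have "f ` V \<subset> G \<and> f ` V \<noteq> {}" using sub \<open>f ` V \<noteq> G\<close> V by auto
  then have "\<exists>a\<in>f ` V. \<exists>r\<in>G - f ` V. g a r \<noteq> 0" using cn unfolding conn_def by blast
  then obtain p r where p: "p \<in> V" and r: "r \<in> G" "r \<notin> f ` V" and pr: "g (f p) r \<noteq> 0"
    by blast
  define x where "x u = s u * g (f u) r" for u
  have x1: "\<forall>u\<in>V. x u \<in> gauss_ints"
    using su cycD(3)[OF cg] r sub by (auto simp: x_def gunit_def intro!: gauss_ints_mult)
  have x2: "\<exists>u\<in>V. x u \<noteq> 0"
    using p pr su[OF p] by (auto simp: x_def gunit_def intro!: bexI[of _ p])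
  have "\<bar>Re (ip V z (mv V w z)) + 2 * Re (\<zeta> * ip V z x)\<bar> \<le> 2 * (nsq V z + (cmod \<zeta>)\<^sup>2)" for z \<zeta>
  proof -
    \<comment> \<open>The vector \<open>(z, \<zeta>)\<close> moved to \<open>G\<close>: the units
      are undone on the image, \<open>\<zeta>\<close> sits at \<open>r\<close>, and the rest is
      0.\<close>
    define y where "y q = (if q = r then \<zeta> else if q \<in> f ` V then cnj (s (inv_into V f q)) * z (inv_into V f q) else 0)" for q
    have yf: "y (f u) = cnj (s u) * z u" if "u \<in> V" for u
      using r that inj by (auto simp: y_def)
    have split: "(\<Sum>q\<in>G. F q) = F r + (\<Sum>u\<in>V. F (f u))" if "\<And>q. y q = 0 \<Longrightarrow> F q = 0" for F :: "'b \<Rightarrow> 'c::comm_monoid_add"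
    proof -
      have "(\<Sum>q\<in>G. F q) = (\<Sum>q\<in>insert r (f ` V). F q)"
        by (rule sum.mono_neutral_right) (use fG r sub that in \<open>auto simp: y_def\<close>)
      also have "\<dots> = F r + (\<Sum>q\<in>f ` V. F q)"
        using r finite_subset[OF sub fG] by simp
      finally show ?thesis using inj by (simp add: sum.reindex)
    qed
    have mvy: "mv G g y q = g q r * \<zeta> + (\<Sum>u\<in>V. g q (f u) * (cnj (s u) * z u))" for q
      unfolding mv_def by (subst split) (auto simp: y_def[of r] yf)
    have nsq: "nsq G y = (cmod \<zeta>)\<^sup>2 + nsq V z"
      unfolding nsq_def by (subst split) (use su in \<open>auto simp: y_def[of r] yf norm_mult gunit_def\<close>)
    have hr: "g r (f u) = cnj (g (f u) r)" if "u \<in> V" for u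
      using hermD[OF cycD(2)[OF cg], of "f u" r] r sub that by auto
    have a1: "mv G g y r = cnj (ip V z x)"
      using r diag by (simp add: mvy cnj_ip) (simp add: ip_def x_def hr mult_ac)
    have a2: "s u * mv G g y (f u) = x u * \<zeta> + mv V w z u" if "u \<in> V" for u
      unfolding mvy mv_def[of V w z u] using that by (simp add: w x_def distrib_left sum_distrib_left mult_ac)
    have "ip G y (mv G g y) = cnj \<zeta> * mv G g y r + (\<Sum>u\<in>V. cnj (z u) * (s u * mv G g y (f u)))"
      unfolding ip_def by (subst split) (auto simp: y_def[of r] yf mult_ac)
    also have "(\<Sum>u\<in>V. cnj (z u) * (s u * mv G g y (f u))) = \<zeta> * ip V z x + ip V z (mv V w z)"
      by (simp add: a2 ip_def distrib_left sum.distrib sum_distrib_left mult_ac)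
    finally have "Re (ip G y (mv G g y)) = Re (ip V z (mv V w z)) + 2 * Re (\<zeta> * ip V z x)"
      by (simp add: a1)
    moreover have "\<bar>Re (ip G y (mv G g y))\<bar> \<le> 2 * nsq G y" using cg by (simp add: cyc_def)
    ultimately show ?thesis by (simp add: nsq add.commute)
  qed
  then show False using ne x1 x2 unfolding no_ext_def by blast
qed

section \<open>Unimodular cores\<close>

text \<open>Let \<open>g\<^sup>2 = 4\<close> and let \<open>T0\<close> be a set of vertices of \<open>g\<close> such that the block of \<open>g\<close> between \<open>T0\<close> and its
  complement is invertible over the Gaussian integers, with inverse \<open>Z\<close>. If a cyclotomic \<open>w\<close> contains
  \<open>T0\<close>, then in the coordinates given by \<open>Z\<close> the rows of \<open>w\<close> between \<open>T0\<close> and the other vertices satisfy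
  Bessel's inequality. Having Gaussian integer entries, they are distinct unit vectors up to units or zero, and the
  weights between the vertices outside \<open>T0\<close> are read off the kernel of \<open>4 - w\<^sup>2\<close>.\<close>

lemma unimodular_core:
  fixes \<psi> :: "'x \<Rightarrow> 'v"
  assumes c: "cyc V w" and cn: "conn V w"
    and fG: "finite G" and hG: "herm G g"
    and sq: "\<And>z x. x \<in> G \<Longrightarrow> mv G g (mv G g z) x = 4 * z x"
    and T0: "T0 \<subseteq> G" "T0 \<noteq> {}" and inj: "inj_on \<psi> T0" and sub: "\<psi> ` T0 \<subseteq> V"
    and wg: "\<And>x y. x \<in> T0 \<Longrightarrow> y \<in> T0 \<Longrightarrow> w (\<psi> x) (\<psi> y) = g x y"
    and Z: "\<And>p x. p \<in> G - T0 \<Longrightarrow> x \<in> T0 \<Longrightarrow> Z p x \<in> gauss_ints"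
    and d1: "\<And>p q. p \<in> G - T0 \<Longrightarrow> q \<in> G - T0 \<Longrightarrow> mv T0 g (Z p) q = (if p = q then 1 else 0)"
    and d2: "\<And>x y. x \<in> T0 \<Longrightarrow> y \<in> T0 \<Longrightarrow> (\<Sum>p\<in>G - T0. Z p x * g p y) = (if x = y then 1 else 0)"
  obtains f s where "embeds V w G g f s"
proof -
  define U where "U = V - \<psi> ` T0"
  define P where "P = G - T0"
  \<comment> \<open>Coordinates of the row of \<open>u\<close> on \<open>T0\<close> with respect to
    the rows of \<open>g\<close> at the vertices of \<open>P\<close>; see \<open>recover\<close>
    below.\<close>
  define C where "C u p = (\<Sum>x\<in>T0. w u (\<psi> x) * Z p x)" for u p
  define lift :: "('x \<Rightarrow> complex) \<Rightarrow> 'v \<Rightarrow> complex"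
    where "lift \<alpha> v = (if v \<in> \<psi> ` T0 then \<alpha> (inv_into T0 \<psi> v) else 0)" for \<alpha> v
  define comb where "comb \<beta> x = (\<Sum>p\<in>P. \<beta> p * Z p x)" for \<beta> x
  have fV: "finite V" and fT: "finite T0" and fP: "finite P" and fU: "finite U"
    using cycD(1)[OF c] fG T0 finite_subset by (auto simp: P_def U_def)
  have splitG: "(\<Sum>q\<in>G. F q) = (\<Sum>x\<in>T0. F x) + (\<Sum>p\<in>P. F p)" for F :: "'x \<Rightarrow> 'c::comm_monoid_add"
    unfolding P_def using sum.subset_diff[OF T0(1) fG, of F] by (simp add: add.commute)
  have splitV: "(\<Sum>v\<in>V. F v) = (\<Sum>x\<in>T0. F (\<psi> x)) + (\<Sum>u\<in>U. F u)" for F :: "'v \<Rightarrow> 'c::comm_monoid_add"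
    unfolding U_def using sum.subset_diff[OF sub fV, of F] inj by (simp add: add.commute sum.reindex)
  have liftT: "lift \<alpha> (\<psi> x) = \<alpha> x" if "x \<in> T0" for \<alpha> x
    using that inj by (simp add: lift_def)
  have liftU: "lift \<alpha> u = 0" if "u \<in> U" for \<alpha> u
    using that by (simp add: lift_def U_def)
  have mv_lift: "mv V w (lift \<alpha>) u = (\<Sum>x\<in>T0. w u (\<psi> x) * \<alpha> x)" for \<alpha> u
    unfolding mv_def splitV by (simp add: liftT liftU)
  have mv_lift_T: "mv V w (lift \<alpha>) (\<psi> x) = mv T0 g \<alpha> x" if "x \<in> T0" for \<alpha> x
    unfolding mv_lift using that by (simp add: wg mv_def)
  have mv_lift_U: "mv V w (lift (comb \<beta>)) u = (\<Sum>p\<in>P. \<beta> p * C u p)" if "u \<in> U" for \<beta> u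
    unfolding mv_lift comb_def C_def sum_distrib_left
    by (subst sum.swap) (simp add: mult_ac)
  have mv_comb: "mv T0 g (comb \<beta>) q = \<beta> q" if "q \<in> P" for \<beta> q
  proof -
    have "mv T0 g (comb \<beta>) q = (\<Sum>p\<in>P. \<beta> p * mv T0 g (Z p) q)"
      unfolding mv_def comb_def sum_distrib_left by (subst sum.swap) (simp add: mult_ac)
    also have "\<dots> = (\<Sum>p\<in>P. if p = q then \<beta> p else 0)"
      by (rule sum.cong) (use that d1 in \<open>auto simp: P_def\<close>)
    finally show ?thesis using that fP by simp
  qed
  define ext :: "('x \<Rightarrow> complex) \<Rightarrow> 'x \<Rightarrow> complex" where "ext \<alpha> x = (if x \<in> T0 then \<alpha> x else 0)" for \<alpha> x
  have mv_ext: "mv G g (ext \<alpha>) q = mv T0 g \<alpha> q" for \<alpha> q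
    unfolding mv_def splitG by (simp add: ext_def P_def)
  have G_sum: "nsq T0 (mv T0 g \<alpha>) + nsq P (mv T0 g \<alpha>) = 4 * nsq T0 \<alpha>" for \<alpha>
  proof -
    have "nsq G (mv G g (ext \<alpha>)) = 4 * nsq G (ext \<alpha>)" by (rule nsq_of_square[OF hG sq])
    then show ?thesis unfolding mv_ext[abs_def] unfolding nsq_def splitG by (simp add: ext_def P_def)
  qed
  have nsq_comb: "nsq P (mv T0 g (comb \<beta>)) = nsq P \<beta>" for \<beta>
    unfolding nsq_def by (simp add: mv_comb)
  have V_sum: "nsq V (mv V w (lift (comb \<beta>)))
    = 4 * nsq V (lift (comb \<beta>)) - nsq P \<beta> + (\<Sum>u\<in>U. (cmod (\<Sum>p\<in>P. \<beta> p * C u p))\<^sup>2)" for \<beta>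
  proof -
    have "nsq V (mv V w (lift (comb \<beta>))) = nsq T0 (mv T0 g (comb \<beta>)) + (\<Sum>u\<in>U. (cmod (\<Sum>p\<in>P. \<beta> p * C u p))\<^sup>2)"
      unfolding nsq_def splitV by (simp add: mv_lift_T mv_lift_U)
    moreover have "nsq V (lift (comb \<beta>)) = nsq T0 (comb \<beta>)"
      unfolding nsq_def splitV by (simp add: liftT liftU)
    ultimately show ?thesis using G_sum[of "comb \<beta>"] nsq_comb[of \<beta>] by simp
  qed
  \<comment> \<open>On \<open>T0\<close> the images under \<open>w\<close> and \<open>g\<close> of a
    vector supported on \<open>T0\<close> agree. Since \<open>g\<close> exactly doubles lengths and
    \<open>w\<close> at most doubles them, what \<open>w\<close> puts outside \<open>T0\<close> is
    bounded by what \<open>g\<close> puts there, namely \<open>nsq P \<beta>\<close>.\<close>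
  have bessel: "(\<Sum>u\<in>U. (cmod (\<Sum>p\<in>P. \<beta> p * C u p))\<^sup>2) \<le> nsq P \<beta>" for \<beta>
    using V_sum[of \<beta>] cyc_nsq_mv[OF c, of "lift (comb \<beta>)"] by simp
  have single: "(\<Sum>q\<in>P. (if q = p then a else 0) * F q) = a * F p" if "p \<in> P" for a p and F :: "'x \<Rightarrow> complex"
  proof -
    have "(\<Sum>q\<in>P. (if q = p then a else 0) * F q) = (\<Sum>q\<in>P. if q = p then a * F q else 0)"
      by (rule sum.cong) auto
    then show ?thesis using that fP by simp
  qed
  have bessel1: "(\<Sum>u\<in>U. (cmod (C u p))\<^sup>2) \<le> 1" if "p \<in> P" for p
    using bessel[of "\<lambda>q. if q = p then 1 else 0"] nsq_single[OF fP that, of 1] single[OF that, of 1 "C _"] by simp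
  have Cg: "C u p \<in> gauss_ints" if "u \<in> V" "p \<in> P" for u p
    unfolding C_def using that sub cycD(3)[OF c] Z by (auto intro!: gauss_ints_sum gauss_ints_mult simp: P_def)
  have C1: "(cmod (C u p))\<^sup>2 = 1" if "u \<in> U" "p \<in> P" "C u p \<noteq> 0" for u p
  proof -
    have "(cmod (C u p))\<^sup>2 \<le> 1"
      using bessel1[OF that(2)] member_le_sum[OF that(1) _ fU, of "\<lambda>u. (cmod (C u p))\<^sup>2"] by simp
    then show ?thesis using gauss_norm_ge_1[OF Cg[of u p]] that by (simp add: U_def)
  qed
  have Cunit: "gunit (C u p)" if "u \<in> U" "p \<in> P" "C u p \<noteq> 0" for u p
    using C1[OF that] Cg[of u p] that by (simp add: gunitI U_def)
  have col: "C u' p = 0" if "u \<in> U" "p \<in> P" "C u p \<noteq> 0" "u' \<in> U" "u' \<noteq> u" for u u' p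
  proof (rule ccontr)
    assume n: "C u' p \<noteq> 0"
    have "(\<Sum>t\<in>{u, u'}. (cmod (C t p))\<^sup>2) \<le> (\<Sum>u\<in>U. (cmod (C u p))\<^sup>2)"
      by (rule sum_mono2) (use that fU in auto)
    then show False using C1[OF that(1,2,3)] C1[OF that(4,2) n] bessel1[OF that(2)] that(5) by simp
  qed
  have row: "C u q = 0" if "u \<in> U" "p \<in> P" "C u p \<noteq> 0" "q \<in> P" "q \<noteq> p" for u p q
  proof (rule ccontr)
    assume n: "C u q \<noteq> 0"
    \<comment> \<open>With conjugate coefficients the two units add up to 2, so a single summand of
      \<open>bessel\<close> would be 4 against \<open>nsq P \<beta> = 2\<close>.\<close>
    define \<beta> where "\<beta> r = (if r = p then cnj (C u p) else 0) + (if r = q then cnj (C u q) else 0)" for r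
    have s: "(\<Sum>r\<in>P. \<beta> r * C u r) = 2"
      unfolding \<beta>_def distrib_right sum.distrib single[OF that(2)] single[OF that(4)]
      using gunit_cnj_mult[OF Cunit[OF that(1,2,3)]] gunit_cnj_mult[OF Cunit[OF that(1,4) n]] by simp
    have "nsq P \<beta> = (\<Sum>r\<in>{p, q}. (cmod (\<beta> r))\<^sup>2)"
      unfolding nsq_def by (rule sum.mono_neutral_right) (use fP that in \<open>auto simp: \<beta>_def\<close>)
    also have "\<dots> = 2" using that(5) C1[OF that(1,2,3)] C1[OF that(1,4) n] by (auto simp: \<beta>_def)
    finally have "nsq P \<beta> = 2" .
    moreover have "(cmod (\<Sum>r\<in>P. \<beta> r * C u r))\<^sup>2 \<le> nsq P \<beta>"
      using bessel[of \<beta>] member_le_sum[OF that(1) _ fU, of "\<lambda>u. (cmod (\<Sum>r\<in>P. \<beta> r * C u r))\<^sup>2"] by simp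
    ultimately show False by (simp add: s)
  qed
  have recover: "w u (\<psi> y) = (\<Sum>p\<in>P. C u p * g p y)" if "y \<in> T0" for u y
  proof -
    have "(\<Sum>p\<in>P. C u p * g p y) = (\<Sum>x\<in>T0. w u (\<psi> x) * (\<Sum>p\<in>P. Z p x * g p y))"
      unfolding C_def sum_distrib_right sum_distrib_left by (subst sum.swap) (simp add: mult_ac)
    also have "\<dots> = (\<Sum>x\<in>T0. if x = y then w u (\<psi> x) else 0)"
      by (rule sum.cong) (use that d2 in \<open>auto simp: P_def\<close>)
    finally show ?thesis using that fT by simp
  qed
  have wT: "w u (\<psi> y) = C u p * g p y" if "u \<in> U" "p \<in> P" "C u p \<noteq> 0" "y \<in> T0" for u p y
  proof -
    have "w u (\<psi> y) = (\<Sum>q\<in>P. if q = p then C u p * g p y else 0)"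
      unfolding recover[OF that(4)] by (rule sum.cong) (use row[OF that(1,2,3)] in auto)
    then show ?thesis using that fP by simp
  qed
  \<comment> \<open>Since \<open>u\<close> takes the coordinate \<open>p\<close>, Bessel is tight
    there and \<open>lift (Z p)\<close> lies in the kernel of 4 - w^2. This is the row of that
    equation at \<open>v\<close>; \<open>kernelG\<close> is its counterpart for
    \<open>g\<close>.\<close>
  have kernel: "(\<Sum>x\<in>T0. w v (\<psi> x) * mv T0 g (Z p) x) + w v u * C u p = 0"
    if "u \<in> U" "p \<in> P" "C u p \<noteq> 0" "v \<in> U" for u v p
  proof -
    define \<beta> :: "'x \<Rightarrow> complex" where "\<beta> = (\<lambda>q. if q = p then 1 else 0)"
    have b: "(\<Sum>q\<in>P. \<beta> q * C t q) = C t p" for t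
      unfolding \<beta>_def using single[OF that(2), of 1 "C t"] by simp
    have "(\<Sum>t\<in>U. (cmod (C t p))\<^sup>2) = (\<Sum>t\<in>U. if t = u then 1 else 0)"
      by (rule sum.cong) (use col[OF that(1,2,3)] C1[OF that(1,2,3)] in auto)
    then have "nsq V (mv V w (lift (comb \<beta>))) = 4 * nsq V (lift (comb \<beta>))"
      unfolding V_sum b using fU that(1) nsq_single[OF fP that(2), of 1] by (simp add: \<beta>_def)
    then have "mv V w (mv V w (lift (comb \<beta>))) v = 4 * lift (comb \<beta>) v"
      by (rule cyc_tight[OF c]) (use that in \<open>simp add: U_def\<close>)
    also have "\<dots> = 0" using liftU[OF that(4)] by simp
    finally have "mv V w (mv V w (lift (comb \<beta>))) v = 0" .
    moreover have "comb \<beta> = Z p"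
      unfolding comb_def \<beta>_def using single[OF that(2), of 1 "\<lambda>q. Z q _"] by (simp add: fun_eq_iff)
    moreover have "mv V w (lift (Z p)) t = C t p" if "t \<in> U" for t
      unfolding mv_lift C_def ..
    moreover have "(\<Sum>t\<in>U. w v t * C t p) = (\<Sum>t\<in>U. if t = u then w v u * C u p else 0)"
      by (rule sum.cong) (use col[OF that(1,2,3)] in auto)
    ultimately show ?thesis
      using fU that(1) unfolding mv_def[of V w "mv V w (lift (comb \<beta>))"] splitV
      by (simp add: mv_lift_T)
  qed
  have kernelG: "(\<Sum>x\<in>T0. g q x * mv T0 g (Z p) x) + g q p = 0" if "p \<in> P" "q \<in> P" for p q
  proof -
    have "0 = mv G g (mv G g (ext (Z p))) q"
      using sq[of q "ext (Z p)"] that by (simp add: ext_def P_def)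
    also have "\<dots> = (\<Sum>x\<in>T0. g q x * mv T0 g (Z p) x) + (\<Sum>r\<in>P. g q r * mv T0 g (Z p) r)"
      unfolding mv_ext[abs_def] mv_def[of G] splitG ..
    also have "(\<Sum>r\<in>P. g q r * mv T0 g (Z p) r) = (\<Sum>r\<in>P. if r = p then g q p else 0)"
      by (rule sum.cong) (use that d1 in \<open>auto simp: P_def\<close>)
    finally show ?thesis using that fP by simp
  qed
  \<comment> \<open>The vertices without an edge to \<open>T0\<close>. By \<open>kernel\<close> they
    have no edge to the other vertices of \<open>U\<close> either, so connectedness leaves
    none.\<close>
  define N where "N = {v \<in> U. \<forall>p\<in>P. C v p = 0}"
  have "N = {}"
  proof (rule ccontr)
    assume "N \<noteq> {}"
    moreover have "N \<subset> V" using T0(2) sub by (auto simp: N_def U_def)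
    ultimately obtain v t where v: "v \<in> N" and t: "t \<in> V - N" and vt: "w v t \<noteq> 0"
      using cn unfolding conn_def by blast
    have vT: "w v (\<psi> x) = 0" if "x \<in> T0" for x
      using v unfolding recover[OF that] N_def by simp
    show False
    proof (cases "t \<in> U")
      case True
      then obtain p where p: "p \<in> P" "C t p \<noteq> 0" using t by (auto simp: N_def)
      then show False using kernel[OF True p, of v] v vt by (simp add: vT N_def)
    next
      case False
      then show False using t vT vt by (auto simp: U_def)
    qed
  qed
  then have "\<forall>u\<in>U. \<exists>p\<in>P. C u p \<noteq> 0" by (auto simp: N_def)
  then obtain h where h: "\<And>u. u \<in> U \<Longrightarrow> h u \<in> P" "\<And>u. u \<in> U \<Longrightarrow> C u (h u) \<noteq> 0" by metis
  define f where "f u = (if u \<in> \<psi> ` T0 then inv_into T0 \<psi> u else h u)" for u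
  define s where "s u = (if u \<in> \<psi> ` T0 then 1 else C u (h u))" for u
  have fTx: "f (\<psi> x) = x" "s (\<psi> x) = 1" if "x \<in> T0" for x
    using that inj by (auto simp: f_def s_def)
  have fUx: "f u = h u" "s u = C u (h u)" if "u \<in> U" for u
    using that by (auto simp: f_def s_def U_def)
  have sU: "gunit (s u)" if "u \<in> U" for u
    using Cunit[OF that h(1)[OF that] h(2)[OF that]] by (simp add: fUx that)
  have Vcases: "(\<exists>x\<in>T0. v = \<psi> x) \<or> v \<in> U" if "v \<in> V" for v
    using that by (auto simp: U_def)
  have TP: "T0 \<inter> P = {}" by (auto simp: P_def)
  have "inj_on f V"
  proof (rule inj_onI)
    fix u v assume u: "u \<in> V" and v: "v \<in> V" and e: "f u = f v"
    show "u = v"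
      using Vcases[OF u] Vcases[OF v]
    proof (elim disjE bexE)
      assume "u \<in> U" "v \<in> U"
      then show ?thesis using e h col[of u "h u" v] by (metis fUx(1))
    qed (use e TP h(1) in \<open>auto simp: fTx fUx\<close>)
  qed
  moreover have "f ` V \<subseteq> G"
    using Vcases T0(1) h(1) by (fastforce simp: fTx fUx P_def)
  moreover have "gunit (s u)" if "u \<in> V" for u
    using Vcases[OF that] sU by (auto simp: fTx)
  moreover have "w u v = s u * g (f u) (f v) * cnj (s v)" if u: "u \<in> V" and v: "v \<in> V" for u v
  proof -
    have hw: "herm V w" by (rule cycD(2)[OF c])
    have UT: "w t (\<psi> y) = s t * g (f t) y" if "t \<in> U" "y \<in> T0" for t y
      using wT[OF that(1) h(1)[OF that(1)] h(2)[OF that(1)] that(2)] by (simp add: fUx that)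
    show ?thesis
      using Vcases[OF u] Vcases[OF v]
    proof (elim disjE bexE)
      fix x y assume "x \<in> T0" "u = \<psi> x" "y \<in> T0" "v = \<psi> y"
      then show ?thesis by (simp add: fTx wg)
    next
      fix y assume "u \<in> U" and y: "y \<in> T0" "v = \<psi> y"
      then show ?thesis by (simp add: fTx UT)
    next
      fix x assume x: "x \<in> T0" "u = \<psi> x" and vU: "v \<in> U"
      have "w u v = cnj (s v * g (f v) x)"
        using hermD[OF hw v u] UT[OF vU x(1)] x by simp
      also have "cnj (s v * g (f v) x) = cnj (s v) * g x (f v)"
        using hermD[OF hG, of "f v" x] x T0(1) h(1)[OF vU] by (auto simp: fUx vU P_def)
      finally show ?thesis using x by (simp add: fTx)
    next
      assume uU: "u \<in> U" and vU: "v \<in> U"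
      \<comment> \<open>\<open>kernel\<close> and \<open>kernelG\<close> have the same shape, and
        their sums differ only by the factor \<open>s u\<close>; so the weights outside
        \<open>T0\<close> agree up to units.\<close>
      have "w u v * s v = - (\<Sum>x\<in>T0. w u (\<psi> x) * mv T0 g (Z (h v)) x)"
        using kernel[OF vU h(1)[OF vU] h(2)[OF vU] uU] by (simp add: fUx vU add_eq_0_iff)
      also have "\<dots> = s u * - (\<Sum>x\<in>T0. g (h u) x * mv T0 g (Z (h v)) x)"
        by (simp add: UT uU fUx sum_distrib_left mult.assoc)
      also have "- (\<Sum>x\<in>T0. g (h u) x * mv T0 g (Z (h v)) x) = g (h u) (h v)"
        using kernelG[OF h(1)[OF vU] h(1)[OF uU]] by (simp add: add_eq_0_iff)
      finally have "w u v * (s v * cnj (s v)) = s u * g (f u) (f v) * cnj (s v)"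
        by (simp add: fUx uU vU mult.assoc[symmetric])
      then show ?thesis by (simp add: gunit_cnj_mult[OF sU[OF vU]])
    qed
  qed
  ultimately have "embeds V w G g f s" by (simp add: embeds_def)
  then show ?thesis by (rule that)
qed

section \<open>The sporadic graphs\<close>

lemma UNIV_s8: "UNIV = {Va, Vb, Vc, Vd, Ve, Vf, Vg, Vh}"
  using s8_vertex.exhaust by auto

lemma finite_s8 [simp]: "finite (UNIV :: s8_vertex set)"
  by (simp add: UNIV_s8)

definition s8dd :: "s8_vertex \<Rightarrow> s8_vertex \<Rightarrow> complex" where
  "s8dd = snd S8_dagger_dagger_graph"

definition s8d :: "s8_vertex \<Rightarrow> s8_vertex \<Rightarrow> complex" where
  "s8d = snd S8_ddagger_graph"

lemma complex_neqs [simp]: "1 + \<i> \<noteq> 0" "\<i> + 1 \<noteq> 0" "- 1 \<noteq> \<i>" "\<i> \<noteq> - 1" "1 - \<i> \<noteq> 0" "1 \<noteq> \<i>" "\<i> \<noteq> 1"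
  by (simp_all add: complex_eq_iff)

lemmas s8_eval = hermitian_weight_def listed_def

lemma mv_s8dd:
  "mv UNIV s8dd z Va = z Vb - z Ve + (1 + \<i>) * z Vc"
  "mv UNIV s8dd z Vb = z Va + z Vf + z Vg - \<i> * z Vd"
  "mv UNIV s8dd z Vc = z Vd - z Vg + (1 - \<i>) * z Va"
  "mv UNIV s8dd z Vd = z Vc + z Vh + z Ve + \<i> * z Vb"
  "mv UNIV s8dd z Ve = z Vf + z Vd - z Va - \<i> * z Vg"
  "mv UNIV s8dd z Vf = z Vb + z Ve - (1 - \<i>) * z Vh"
  "mv UNIV s8dd z Vg = z Vh + z Vb - z Vc + \<i> * z Ve"
  "mv UNIV s8dd z Vh = z Vg + z Vd - (1 + \<i>) * z Vf"
  by (simp add: mv_def UNIV_s8 s8dd_def S8_dagger_dagger_graph_def s8_eval algebra_simps)+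

lemma mv_s8d:
  "mv UNIV s8d z Va = z Vb + z Ve + (1 + \<i>) * z Vc"
  "mv UNIV s8d z Vb = z Va + z Vf - (1 + \<i>) * z Vd"
  "mv UNIV s8d z Vc = z Vd - z Vg + (1 - \<i>) * z Va"
  "mv UNIV s8d z Vd = z Vc + z Vh - (1 - \<i>) * z Vb"
  "mv UNIV s8d z Ve = z Va - z Vf + (1 + \<i>) * z Vg"
  "mv UNIV s8d z Vf = z Vb - z Ve + (1 + \<i>) * z Vh"
  "mv UNIV s8d z Vg = z Vh - z Vc + (1 - \<i>) * z Ve"
  "mv UNIV s8d z Vh = z Vg + z Vd + (1 - \<i>) * z Vf"
  by (simp add: mv_def UNIV_s8 s8d_def S8_ddagger_graph_def s8_eval algebra_simps)+

text \<open>Rows of norm 4 that are pairwise orthogonal. This makes the two graphs cyclotomic and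
  supplies the hypothesis on \<open>g\<close> in \<open>unimodular_core\<close>.\<close>

lemma s8_square:
  "mv UNIV s8dd (mv UNIV s8dd z) x = 4 * z x"
  "mv UNIV s8d (mv UNIV s8d z) x = 4 * z x"
  by (cases x; simp add: mv_s8dd mv_s8d algebra_simps; fail)+

lemma s8_herm: "herm UNIV s8dd" "herm UNIV s8d"
proof -
  have "cnj (s8dd u v) = s8dd v u" for u v
    by (cases u; cases v; simp add: s8dd_def S8_dagger_dagger_graph_def s8_eval)
  then show "herm UNIV s8dd" by (simp add: herm_def)
  have "cnj (s8d u v) = s8d v u" for u v
    by (cases u; cases v; simp add: s8d_def S8_ddagger_graph_def s8_eval)
  then show "herm UNIV s8d" by (simp add: herm_def)
qed

lemma s8_gauss: "s8dd u v \<in> gauss_ints" "s8d u v \<in> gauss_ints"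
  by (cases u; cases v; simp add: s8dd_def S8_dagger_dagger_graph_def s8d_def S8_ddagger_graph_def s8_eval gauss_ints_def; fail)+

lemma s8_diag: "s8dd u u = 0" "s8d u u = 0"
  by (cases u; simp add: s8dd_def S8_dagger_dagger_graph_def s8d_def S8_ddagger_graph_def s8_eval; fail)+

lemma s8_cyc: "cyc UNIV s8dd" "cyc UNIV s8d"
  by (rule cyc_of_square; simp add: s8_gauss s8_herm s8_square)+

text \<open>By Hermitian symmetry, a set without outgoing edges has a complement without outgoing
  edges. So it suffices to examine whichever of the two contains \<open>x\<close>.\<close>

lemma conn_closedI:
  assumes h: "herm V w" and x: "x \<in> V"
    and cl: "\<And>S. S \<subseteq> V \<Longrightarrow> x \<in> S \<Longrightarrow> (\<And>u v. u \<in> S \<Longrightarrow> v \<in> V \<Longrightarrow> w u v \<noteq> 0 \<Longrightarrow> v \<in> S) \<Longrightarrow> S = V"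
  shows "conn V w"
  unfolding conn_def
proof (intro allI impI)
  fix S assume S: "S \<subset> V \<and> S \<noteq> {}"
  show "\<exists>u\<in>S. \<exists>v\<in>V - S. w u v \<noteq> 0"
  proof (rule ccontr)
    assume "\<not> ?thesis"
    then have n: "w u v = 0" if "u \<in> S" "v \<in> V - S" for u v using that by blast
    have n': "w v u = 0" if "u \<in> S" "v \<in> V - S" for u v
      using hermD[OF h, of u v] n[OF that] that S by auto
    show False
    proof (cases "x \<in> S")
      case True
      then show False using cl[of S] n S by blast
    next
      case False
      then show False using cl[of "V - S"] n' S x by blast
    qed
  qed
qed

lemma s8_conn: "conn UNIV s8dd" "conn UNIV s8d"
proof -
  have e: "s8dd Va Vb \<noteq> 0" "s8dd Va Vc \<noteq> 0" "s8dd Va Ve \<noteq> 0" "s8dd Vc Vd \<noteq> 0" "s8dd Vc Vg \<noteq> 0"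
     "s8dd Vb Vf \<noteq> 0" "s8dd Vd Vh \<noteq> 0"
    by (simp_all add: s8dd_def S8_dagger_dagger_graph_def s8_eval complex_eq_iff)
  show "conn UNIV s8dd"
  proof (rule conn_closedI[OF s8_herm(1)])
    fix S assume a: "Va \<in> S" and cl: "\<And>u v. u \<in> S \<Longrightarrow> v \<in> UNIV \<Longrightarrow> s8dd u v \<noteq> 0 \<Longrightarrow> v \<in> S"
    note b = cl[OF a UNIV_I e(1)] and c = cl[OF a UNIV_I e(2)] and e' = cl[OF a UNIV_I e(3)]
    have "{Va, Vb, Vc, Vd, Ve, Vf, Vg, Vh} \<subseteq> S"
      using a b c e' cl[OF c UNIV_I e(4)] cl[OF c UNIV_I e(5)] cl[OF b UNIV_I e(6)]
        cl[OF cl[OF c UNIV_I e(4)] UNIV_I e(7)] by simp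
    then show "S = UNIV" unfolding UNIV_s8[symmetric] by (rule top.extremum_uniqueI)
  qed simp
  have e: "s8d Va Vb \<noteq> 0" "s8d Va Vc \<noteq> 0" "s8d Va Ve \<noteq> 0" "s8d Vc Vd \<noteq> 0" "s8d Vc Vg \<noteq> 0"
     "s8d Vb Vf \<noteq> 0" "s8d Vd Vh \<noteq> 0"
    by (simp_all add: s8d_def S8_ddagger_graph_def s8_eval complex_eq_iff)
  show "conn UNIV s8d"
  proof (rule conn_closedI[OF s8_herm(2)])
    fix S assume a: "Va \<in> S" and cl: "\<And>u v. u \<in> S \<Longrightarrow> v \<in> UNIV \<Longrightarrow> s8d u v \<noteq> 0 \<Longrightarrow> v \<in> S"
    note b = cl[OF a UNIV_I e(1)] and c = cl[OF a UNIV_I e(2)] and e' = cl[OF a UNIV_I e(3)]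
    have "{Va, Vb, Vc, Vd, Ve, Vf, Vg, Vh} \<subseteq> S"
      using a b c e' cl[OF c UNIV_I e(4)] cl[OF c UNIV_I e(5)] cl[OF b UNIV_I e(6)]
        cl[OF cl[OF c UNIV_I e(4)] UNIV_I e(7)] by simp
    then show "S = UNIV" unfolding UNIV_s8[symmetric] by (rule top.extremum_uniqueI)
  qed simp
qed

text \<open>Here and below: transposed inverses of the 4 x 4 block between the core vertices (second
  index) and the other four (first index). There are two for \<open>s8d\<close> because two kinds of
  core occur in it, with weight \<open>- 1 - \<i>\<close> or 0 between the light neighbours.\<close>

definition s8dd_inv :: "s8_vertex \<Rightarrow> s8_vertex \<Rightarrow> complex" where
  "s8dd_inv = listed [((Ve, Va), -1), ((Vf, Vb), 1), ((Vf, Vc), 1), ((Vg, Vc), -1), ((Vh, Va), 1), ((Vh, Vd), 1)]"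

definition s8d_inv :: "s8_vertex \<Rightarrow> s8_vertex \<Rightarrow> complex" where
  "s8d_inv = listed [((Ve, Va), 1), ((Vf, Vb), 1), ((Vg, Vc), -1), ((Vh, Vd), 1)]"

definition s8d_inv' :: "s8_vertex \<Rightarrow> s8_vertex \<Rightarrow> complex" where
  "s8d_inv' = listed [((Vb, Va), 1), ((Vf, Ve), -1), ((Vf, Vc), -1 + \<i>), ((Vg, Vc), -1), ((Vh, Va), 1 + \<i>), ((Vh, Vd), 1)]"

lemma s8_complements:
  "UNIV - {Va, Vb, Vc, Vd} = {Ve, Vf, Vg, Vh}"
  "UNIV - {Va, Ve, Vc, Vd} = {Vb, Vf, Vg, Vh}"
  by (auto simp: UNIV_s8)

lemma core_s8dd:
  assumes c: "cyc V w" and cn: "conn V w" and abcd: "{a, b, c, d} \<subseteq> V" "distinct [a, b, c, d]"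
    and diag: "\<And>u. u \<in> V \<Longrightarrow> w u u = 0"
    and w: "w a b = 1" "w a c = 1 + \<i>" "w a d = 0" "w b c = 0" "w b d = - \<i>" "w c d = 1"
  obtains f s where "embeds V w UNIV s8dd f s"
proof -
  have h: "cnj (w u v) = w v u" if "u \<in> V" "v \<in> V" for u v
    by (rule hermD[OF cycD(2)[OF c] that])
  have w': "w b a = 1" "w c a = 1 - \<i>" "w d a = 0" "w c b = 0" "w d b = \<i>" "w d c = 1"
    "w a a = 0" "w b b = 0" "w c c = 0" "w d d = 0"
    using h[of a b] h[of a c] h[of a d] h[of b c] h[of b d] h[of c d] abcd(1) w diag by simp_all
  \<comment> \<open>Only the values on the core matter; the default \<open>d\<close> is a filler for
    the other four vertices.\<close>
  define \<psi> where "\<psi> x = (case x of Va \<Rightarrow> a | Vb \<Rightarrow> b | Vc \<Rightarrow> c | _ \<Rightarrow> d)" for x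
  have \<psi>: "\<psi> Va = a" "\<psi> Vb = b" "\<psi> Vc = c" "\<psi> Vd = d" by (simp_all add: \<psi>_def)
  show ?thesis
  proof (rule unimodular_core[OF c cn finite_s8 s8_herm(1), of "{Va, Vb, Vc, Vd}" \<psi> s8dd_inv])
    show "mv UNIV s8dd (mv UNIV s8dd z) x = 4 * z x" for z x by (rule s8_square)
    show "inj_on \<psi> {Va, Vb, Vc, Vd}" using abcd(2) by (auto simp: \<psi>)
    show "\<psi> ` {Va, Vb, Vc, Vd} \<subseteq> V" using abcd(1) by (simp add: \<psi>)
    show "w (\<psi> x) (\<psi> y) = s8dd x y" if "x \<in> {Va, Vb, Vc, Vd}" "y \<in> {Va, Vb, Vc, Vd}" for x y
      using that by (elim insertE emptyE; simp add: \<psi> w w' s8dd_def S8_dagger_dagger_graph_def s8_eval)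
    show "s8dd_inv p x \<in> gauss_ints" for p x
      by (cases p; cases x; simp add: s8dd_inv_def listed_def gauss_ints_def)
    show "mv {Va, Vb, Vc, Vd} s8dd (s8dd_inv p) q = (if p = q then 1 else 0)"
      if "p \<in> UNIV - {Va, Vb, Vc, Vd}" "q \<in> UNIV - {Va, Vb, Vc, Vd}" for p q
      using that unfolding s8_complements
      by (elim insertE emptyE; simp add: mv_def s8dd_inv_def s8dd_def S8_dagger_dagger_graph_def s8_eval complex_eq_iff)
    show "(\<Sum>p\<in>UNIV - {Va, Vb, Vc, Vd}. s8dd_inv p x * s8dd p y) = (if x = y then 1 else 0)"
      if "x \<in> {Va, Vb, Vc, Vd}" "y \<in> {Va, Vb, Vc, Vd}" for x y
      using that unfolding s8_complements
      by (elim insertE emptyE; simp add: s8dd_inv_def s8dd_def S8_dagger_dagger_graph_def s8_eval complex_eq_iff)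
  qed (use that in auto)
qed

lemma core_s8d:
  assumes c: "cyc V w" and cn: "conn V w" and abcd: "{a, b, c, d} \<subseteq> V" "distinct [a, b, c, d]"
    and diag: "\<And>u. u \<in> V \<Longrightarrow> w u u = 0"
    and w: "w a b = 1" "w a c = 1 + \<i>" "w a d = 0" "w b c = 0" "w b d = - 1 - \<i>" "w c d = 1"
  obtains f s where "embeds V w UNIV s8d f s"
proof -
  have h: "cnj (w u v) = w v u" if "u \<in> V" "v \<in> V" for u v
    by (rule hermD[OF cycD(2)[OF c] that])
  have w': "w b a = 1" "w c a = 1 - \<i>" "w d a = 0" "w c b = 0" "w d b = - 1 + \<i>" "w d c = 1"
    "w a a = 0" "w b b = 0" "w c c = 0" "w d d = 0"
    using h[of a b] h[of a c] h[of a d] h[of b c] h[of b d] h[of c d] abcd(1) w diag by simp_all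
  define \<psi> where "\<psi> x = (case x of Va \<Rightarrow> a | Vb \<Rightarrow> b | Vc \<Rightarrow> c | _ \<Rightarrow> d)" for x
  have \<psi>: "\<psi> Va = a" "\<psi> Vb = b" "\<psi> Vc = c" "\<psi> Vd = d" by (simp_all add: \<psi>_def)
  show ?thesis
  proof (rule unimodular_core[OF c cn finite_s8 s8_herm(2), of "{Va, Vb, Vc, Vd}" \<psi> s8d_inv])
    show "mv UNIV s8d (mv UNIV s8d z) x = 4 * z x" for z x by (rule s8_square)
    show "inj_on \<psi> {Va, Vb, Vc, Vd}" using abcd(2) by (auto simp: \<psi>)
    show "\<psi> ` {Va, Vb, Vc, Vd} \<subseteq> V" using abcd(1) by (simp add: \<psi>)
    show "w (\<psi> x) (\<psi> y) = s8d x y" if "x \<in> {Va, Vb, Vc, Vd}" "y \<in> {Va, Vb, Vc, Vd}" for x y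
      using that by (elim insertE emptyE; simp add: \<psi> w w' s8d_def S8_ddagger_graph_def s8_eval)
    show "s8d_inv p x \<in> gauss_ints" for p x
      by (cases p; cases x; simp add: s8d_inv_def listed_def gauss_ints_def)
    show "mv {Va, Vb, Vc, Vd} s8d (s8d_inv p) q = (if p = q then 1 else 0)"
      if "p \<in> UNIV - {Va, Vb, Vc, Vd}" "q \<in> UNIV - {Va, Vb, Vc, Vd}" for p q
      using that unfolding s8_complements
      by (elim insertE emptyE; simp add: mv_def s8d_inv_def s8d_def S8_ddagger_graph_def s8_eval complex_eq_iff)
    show "(\<Sum>p\<in>UNIV - {Va, Vb, Vc, Vd}. s8d_inv p x * s8d p y) = (if x = y then 1 else 0)"
      if "x \<in> {Va, Vb, Vc, Vd}" "y \<in> {Va, Vb, Vc, Vd}" for x y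
      using that unfolding s8_complements
      by (elim insertE emptyE; simp add: s8d_inv_def s8d_def S8_ddagger_graph_def s8_eval complex_eq_iff)
  qed (use that in auto)
qed

lemma core_s8d_path:
  assumes c: "cyc V w" and cn: "conn V w" and abcd: "{a, b, c, d} \<subseteq> V" "distinct [a, b, c, d]"
    and diag: "\<And>u. u \<in> V \<Longrightarrow> w u u = 0"
    and w: "w a b = 1" "w a c = 1 + \<i>" "w a d = 0" "w b c = 0" "w b d = 0" "w c d = 1"
  obtains f s where "embeds V w UNIV s8d f s"
proof -
  have h: "cnj (w u v) = w v u" if "u \<in> V" "v \<in> V" for u v
    by (rule hermD[OF cycD(2)[OF c] that])
  have w': "w b a = 1" "w c a = 1 - \<i>" "w d a = 0" "w c b = 0" "w d b = 0" "w d c = 1"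
    "w a a = 0" "w b b = 0" "w c c = 0" "w d d = 0"
    using h[of a b] h[of a c] h[of a d] h[of b c] h[of b d] h[of c d] abcd(1) w diag by simp_all
  define \<psi> where "\<psi> x = (case x of Va \<Rightarrow> a | Ve \<Rightarrow> b | Vc \<Rightarrow> c | _ \<Rightarrow> d)" for x
  have \<psi>: "\<psi> Va = a" "\<psi> Ve = b" "\<psi> Vc = c" "\<psi> Vd = d" by (simp_all add: \<psi>_def)
  show ?thesis
  proof (rule unimodular_core[OF c cn finite_s8 s8_herm(2), of "{Va, Ve, Vc, Vd}" \<psi> s8d_inv'])
    show "mv UNIV s8d (mv UNIV s8d z) x = 4 * z x" for z x by (rule s8_square)
    show "inj_on \<psi> {Va, Ve, Vc, Vd}" using abcd(2) by (auto simp: \<psi>)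
    show "\<psi> ` {Va, Ve, Vc, Vd} \<subseteq> V" using abcd(1) by (simp add: \<psi>)
    show "w (\<psi> x) (\<psi> y) = s8d x y" if "x \<in> {Va, Ve, Vc, Vd}" "y \<in> {Va, Ve, Vc, Vd}" for x y
      using that by (elim insertE emptyE; simp add: \<psi> w w' s8d_def S8_ddagger_graph_def s8_eval)
    show "s8d_inv' p x \<in> gauss_ints" for p x
      by (cases p; cases x; simp add: s8d_inv'_def listed_def gauss_ints_def)
    show "mv {Va, Ve, Vc, Vd} s8d (s8d_inv' p) q = (if p = q then 1 else 0)"
      if "p \<in> UNIV - {Va, Ve, Vc, Vd}" "q \<in> UNIV - {Va, Ve, Vc, Vd}" for p q
      using that unfolding s8_complements
      by (elim insertE emptyE; simp add: mv_def s8d_inv'_def s8d_def S8_ddagger_graph_def s8_eval complex_eq_iff)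
    show "(\<Sum>p\<in>UNIV - {Va, Ve, Vc, Vd}. s8d_inv' p x * s8d p y) = (if x = y then 1 else 0)"
      if "x \<in> {Va, Ve, Vc, Vd}" "y \<in> {Va, Ve, Vc, Vd}" for x y
      using that unfolding s8_complements
      by (elim insertE emptyE; simp add: s8d_inv'_def s8d_def S8_ddagger_graph_def s8_eval complex_eq_iff)
  qed (use that in auto)
qed


section \<open>Fat edges with light neighbours at both ends\<close>

lemma cyc_rescale:
  assumes c: "cyc V w" and s: "\<And>u. u \<in> V \<Longrightarrow> gunit (\<sigma> u)"
  shows "cyc V (\<lambda>u v. cnj (\<sigma> u) * w u v * \<sigma> v)"
proof -
  have "\<bar>Re (ip V z (mv V (\<lambda>u v. cnj (\<sigma> u) * w u v * \<sigma> v) z))\<bar> \<le> 2 * nsq V z" for z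
  proof -
    let ?z = "\<lambda>u. \<sigma> u * z u"
    have "ip V z (mv V (\<lambda>u v. cnj (\<sigma> u) * w u v * \<sigma> v) z) = ip V ?z (mv V w ?z)"
      by (simp add: ip_def mv_def sum_distrib_left mult_ac)
    moreover have "nsq V ?z = nsq V z"
      using s by (simp add: nsq_def norm_mult gunit_def)
    ultimately show ?thesis using c unfolding cyc_def by metis
  qed
  moreover have "cnj (cnj (\<sigma> u) * w u v * \<sigma> v) = cnj (\<sigma> v) * w v u * \<sigma> u" if "u \<in> V" "v \<in> V" for u v
    using hermD[OF cycD(2)[OF c] that] by simp
  ultimately show ?thesis
    using cycD[OF c] s unfolding cyc_def herm_def gunit_def by (simp add: gauss_ints_mult gauss_ints_cnj)
qed

lemma gunit_nonzero: "gunit s \<Longrightarrow> s \<noteq> 0"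
  by (auto simp: gunit_def)

lemma conn_rescale:
  assumes c: "conn V w" and s: "\<And>u. u \<in> V \<Longrightarrow> gunit (\<sigma> u)"
  shows "conn V (\<lambda>u v. cnj (\<sigma> u) * w u v * \<sigma> v)"
  unfolding conn_def
proof (intro allI impI)
  fix S assume S: "S \<subset> V \<and> S \<noteq> {}"
  then obtain u v where "u \<in> S" "v \<in> V - S" "w u v \<noteq> 0" using c unfolding conn_def by blast
  moreover have "\<sigma> u \<noteq> 0" "\<sigma> v \<noteq> 0" using calculation S s by (auto intro!: gunit_nonzero)
  ultimately show "\<exists>u\<in>S. \<exists>v\<in>V - S. cnj (\<sigma> u) * w u v * \<sigma> v \<noteq> 0" by (intro bexI[of _ u] bexI[of _ v]) auto
qed

lemma embeds_rescale:
  assumes e: "embeds V (\<lambda>u v. cnj (\<sigma> u) * w u v * \<sigma> v) G g f s" and s: "\<And>u. u \<in> V \<Longrightarrow> gunit (\<sigma> u)"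
  shows "embeds V w G g f (\<lambda>u. \<sigma> u * s u)"
proof -
  have "w u v = \<sigma> u * s u * g (f u) (f v) * cnj (\<sigma> v * s v)" if u: "u \<in> V" and v: "v \<in> V" for u v
  proof -
    have "\<sigma> u * s u * g (f u) (f v) * cnj (\<sigma> v * s v) = \<sigma> u * (s u * g (f u) (f v) * cnj (s v)) * cnj (\<sigma> v)"
      by simp
    also have "\<dots> = (\<sigma> u * cnj (\<sigma> u)) * w u v * (\<sigma> v * cnj (\<sigma> v))"
      using e u v by (simp add: embeds_def flip: mult.assoc)
    finally show ?thesis using s[OF u] s[OF v] by (simp add: gunit_cnj_mult)
  qed
  then show ?thesis using e s unfolding embeds_def by (auto intro: gunit_mult)
qed

lemma normalized_light_triangle:
  assumes c: "cyc V w" and abc: "{a, b, c} \<subseteq> V" "distinct [a, b, c]"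
    and diag: "\<And>u. u \<in> V \<Longrightarrow> w u u = 0"
    and w: "w a b = 1" "w a c = 1 + \<i>" and bc: "w b c \<in> {1, -1, \<i>, -\<i>}"
  shows False
proof -
  have h: "cnj (w u v) = w v u" if "u \<in> V" "v \<in> V" for u v
    by (rule hermD[OF cycD(2)[OF c] that])
  have w': "w b a = 1" "w c a = 1 - \<i>" "w c b = cnj (w b c)" "w a a = 0" "w b b = 0" "w c c = 0"
    using h[of a b] h[of a c] h[of b c] abc(1) w diag by simp_all
  have n: "nsq {a, b, c} (mv {a, b, c} w z) \<le> 4 * nsq {a, b, c} z" for z
    by (rule cyc_nsq_mv[OF cyc_subset[OF c abc(1)]])
  define z where "z \<beta> \<gamma> u = (if u = a then 1 else if u = b then \<beta> else \<gamma>)" for \<beta> \<gamma> :: complex and u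
  have z: "z \<beta> \<gamma> a = 1" "z \<beta> \<gamma> b = \<beta>" "z \<beta> \<gamma> c = \<gamma>" for \<beta> \<gamma>
    using abc(2) by (auto simp: z_def)
  have "(cmod (\<beta> + (1 + \<i>) * \<gamma>))\<^sup>2 + (cmod (1 + w b c * \<gamma>))\<^sup>2 + (cmod (1 - \<i> + cnj (w b c) * \<beta>))\<^sup>2
    \<le> 4 * (1 + (cmod \<beta>)\<^sup>2 + (cmod \<gamma>)\<^sup>2)" for \<beta> \<gamma>
    using n[of "z \<beta> \<gamma>"] abc(2) by (simp add: nsq_def mv_def z w w')
  \<comment> \<open>The four test vectors refute the values 1, -1, \<open>\<i>\<close> and
    \<open>-\<i>\<close> of \<open>w b c\<close> in this order: each time the left side is 14 and
    the right side 12.\<close>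
  from this[of 1 1] this[of "-1" "-1"] this[of 1 "-\<i>"] this[of "-1" \<i>] bc show False
    by (auto simp: cmod_power2)
qed

lemma no_light_triangle:
  assumes c: "cyc V w" and abc: "{a, b, c} \<subseteq> V" "distinct [a, b, c]"
    and diag: "\<And>u. u \<in> V \<Longrightarrow> w u u = 0"
    and w: "(cmod (w a c))\<^sup>2 = 2" "(cmod (w a b))\<^sup>2 = 1" "(cmod (w b c))\<^sup>2 = 1"
  shows False
proof -
  have g: "w u v \<in> gauss_ints" if "u \<in> V" "v \<in> V" for u v by (rule cycD(3)[OF c that])
  obtain t where t: "gunit t" "w a c = (1 + \<i>) * t" using gauss_norm_2[OF g w(1)] abc by auto
  have b1: "gunit (w a b)" and c1: "gunit (w b c)" using w g abc by (auto intro: gunitI)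
  define \<sigma> where "\<sigma> u = (if u = c then cnj t else if u = b then cnj (w a b) else 1)" for u
  have \<sigma>: "gunit (\<sigma> u)" for u
    using t b1 by (simp add: \<sigma>_def gunit_cnj)
  have \<sigma>v: "\<sigma> a = 1" "\<sigma> c = cnj t" "\<sigma> b = cnj (w a b)" using abc(2) by (auto simp: \<sigma>_def)
  have "gunit (cnj (\<sigma> b) * w b c * \<sigma> c)"
    by (intro gunit_mult gunit_cnj \<sigma> c1)
  then have "cnj (\<sigma> b) * w b c * \<sigma> c \<in> {1, -1, \<i>, -\<i>}"
    unfolding gunit_def by (intro gauss_norm_1) auto
  moreover have "cnj (\<sigma> a) * w a b * \<sigma> b = 1" "cnj (\<sigma> a) * w a c * \<sigma> c = 1 + \<i>"
    using gunit_cnj_mult[OF t(1)] gunit_cnj_mult[OF b1] by (simp_all add: \<sigma>v t(2) mult.assoc)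
  ultimately show ?thesis
    using normalized_light_triangle[OF cyc_rescale[of V w \<sigma>, OF c \<sigma>] abc] diag by simp
qed

text \<open>For a fat edge \<open>a c\<close> with light edges \<open>a b\<close> and \<open>c d\<close>, normalized by units, only four values of the
  weight of \<open>b d\<close> are possible, and each gives a unimodular core. The value \<open>-1\<close> becomes \<open>-\<i>\<close> when the
  path is read backwards.\<close>

lemma normalized_fat_edge:
  assumes c: "cyc V w" and cn: "conn V w" and abcd: "{a, b, c, d} \<subseteq> V" "distinct [a, b, c, d]"
    and diag: "\<And>u. u \<in> V \<Longrightarrow> w u u = 0"
    and w: "w a b = 1" "w a c = 1 + \<i>" "w a d = 0" "w b c = 0" "w c d = 1" and bd: "(cmod (w b d))\<^sup>2 < 4"
  shows "(\<exists>f s. embeds V w UNIV s8dd f s) \<or> (\<exists>f s. embeds V w UNIV s8d f s)"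
proof -
  have h: "cnj (w u v) = w v u" if "u \<in> V" "v \<in> V" for u v
    by (rule hermD[OF cycD(2)[OF c] that])
  have w': "w b a = 1" "w c a = 1 - \<i>" "w d a = 0" "w c b = 0" "w d b = cnj (w b d)" "w d c = 1"
    "w a a = 0" "w b b = 0" "w c c = 0" "w d d = 0"
    using h[of a b] h[of a c] h[of a d] h[of b c] h[of b d] h[of c d] abcd(1) w diag by simp_all
  have bdg: "w b d \<in> gauss_ints" using cycD(3)[OF c] abcd(1) by simp
  have n: "nsq {a, b, c, d} (mv {a, b, c, d} w z) \<le> 4 * nsq {a, b, c, d} z" for z
    by (rule cyc_nsq_mv[OF cyc_subset[OF c abcd(1)]])
  define z where "z \<alpha> u = (if u = a then \<alpha> else if u = d then 1 else 0)" for \<alpha> :: complex and u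
  have z: "z \<alpha> a = \<alpha>" "z \<alpha> b = 0" "z \<alpha> c = 0" "z \<alpha> d = 1" for \<alpha>
    using abcd(2) by (auto simp: z_def)
  have "(cmod (\<alpha> + w b d))\<^sup>2 + (cmod ((1 - \<i>) * \<alpha> + 1))\<^sup>2 \<le> 4 * ((cmod \<alpha>)\<^sup>2 + 1)" for \<alpha>
    using n[of "z \<alpha>"] abcd(2) by (simp add: nsq_def mv_def z w w')
  \<comment> \<open>For both choices the second square is 5, so \<open>1 + w b d\<close> and
    \<open>\<i> + w b d\<close> have norm at most 3. Of the values of norm below 4 this leaves
    four.\<close>
  from this[of 1] this[of \<i>] gauss_norm_less_4[OF bdg bd]
  have "w b d \<in> {0, -1, -\<i>, -1 - \<i>}"
    by (elim disjE insertE emptyE) (simp_all add: cmod_power2)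
  then consider "w b d = 0" | "w b d = -1" | "w b d = -\<i>" | "w b d = -1 - \<i>" by blast
  then show ?thesis
  proof cases
    case 1
    then show ?thesis using core_s8d_path[OF c cn abcd diag w(1-4) _ w(5)] by metis
  next
    case 2
    \<comment> \<open>Read from \<open>c\<close>, the fat weight is \<open>1 - \<i>\<close>. The
      factor \<open>\<i>\<close> at \<open>a\<close> and \<open>b\<close> restores
      \<open>1 + \<i>\<close>, keeps \<open>w a b = 1\<close> and turns \<open>w d b = -1\<close>
      into \<open>- \<i>\<close>.\<close>
    define \<sigma> where "\<sigma> u = (if u = a \<or> u = b then \<i> else 1)" for u
    have \<sigma>: "gunit (\<sigma> u)" for u by (simp add: \<sigma>_def gunit_def)
    have \<sigma>v: "\<sigma> a = \<i>" "\<sigma> b = \<i>" "\<sigma> c = 1" "\<sigma> d = 1" using abcd(2) by (auto simp: \<sigma>_def)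
    obtain f s where "embeds V (\<lambda>u v. cnj (\<sigma> u) * w u v * \<sigma> v) UNIV s8dd f s"
    proof (rule core_s8dd[OF cyc_rescale[of V w \<sigma>, OF c \<sigma>] conn_rescale[of V w \<sigma>, OF cn \<sigma>], of c d a b])
      show "{c, d, a, b} \<subseteq> V" "distinct [c, d, a, b]" using abcd by auto
    qed (simp_all add: 2 w w' \<sigma>v diag algebra_simps)
    then have "embeds V w UNIV s8dd f (\<lambda>u. \<sigma> u * s u)" by (rule embeds_rescale[OF _ \<sigma>])
    then show ?thesis by blast
  next
    case 3
    then show ?thesis using core_s8dd[OF c cn abcd diag w(1-4) _ w(5)] by metis
  next
    case 4
    then show ?thesis using core_s8d[OF c cn abcd diag w(1-4) _ w(5)] by metis
  qed
qed

text \<open>To reduce to \<open>normalized_fat_edge\<close>, the weights of \<open>b c\<close> and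
  \<open>a d\<close> must vanish. Norm 1 would close a triangle with one fat and two light edges;
  norm 2 would give a column of norm at least 2 + 2 + 1 = 5. The path \<open>b a c d\<close> is then
  normalized by units starting from \<open>a\<close>.\<close>

lemma fat_edge_with_light_neighbours:
  assumes c: "cyc V w" and cn: "conn V w"
    and diag: "\<And>u. u \<in> V \<Longrightarrow> w u u = 0" and small: "\<And>u v. u \<in> V \<Longrightarrow> v \<in> V \<Longrightarrow> (cmod (w u v))\<^sup>2 < 4"
    and abcd: "{a, b, c, d} \<subseteq> V" and ac: "(cmod (w a c))\<^sup>2 = 2" and ab: "(cmod (w a b))\<^sup>2 = 1"
    and cd: "(cmod (w c d))\<^sup>2 = 1"
  shows "(\<exists>f s. embeds V w UNIV s8dd f s) \<or> (\<exists>f s. embeds V w UNIV s8d f s)"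
proof -
  have h: "cnj (w u v) = w v u" if "u \<in> V" "v \<in> V" for u v
    by (rule hermD[OF cycD(2)[OF c] that])
  have hn: "cmod (w v u) = cmod (w u v)" if "u \<in> V" "v \<in> V" for u v
    using h[OF that] by (metis complex_mod_cnj)
  have g: "w u v \<in> gauss_ints" if "u \<in> V" "v \<in> V" for u v by (rule cycD(3)[OF c that])
  obtain t where t: "gunit t" "w a c = (1 + \<i>) * t" using gauss_norm_2[OF g ac] abcd by auto
  have neq: "a \<noteq> c" "a \<noteq> b" "c \<noteq> d" "b \<noteq> c" "a \<noteq> d"
    using ac ab cd diag abcd hn[of a c] by auto
  have b1: "gunit (w a b)" and d1: "gunit (w c d)"
    using ab cd g abcd by (auto intro: gunitI)
  define \<sigma> where "\<sigma> u = (if u = c then cnj t else if u = b then cnj (w a b)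
    else if u = d then cnj (t * w c d) else 1)" for u
  have \<sigma>: "gunit (\<sigma> u)" for u
    using t b1 d1 by (simp add: \<sigma>_def gunit_cnj gunit_mult)
  define w' where "w' u v = cnj (\<sigma> u) * w u v * \<sigma> v" for u v
  have c': "cyc V w'" and cn': "conn V w'"
    unfolding w'_def[abs_def] by (rule cyc_rescale[of V w \<sigma>, OF c \<sigma>], rule conn_rescale[of V w \<sigma>, OF cn \<sigma>])
  have n': "cmod (w' u v) = cmod (w u v)" for u v
    using \<sigma> by (simp add: w'_def norm_mult gunit_def)
  have diag': "w' u u = 0" if "u \<in> V" for u using diag[OF that] by (simp add: w'_def)
  have g': "w' u v \<in> gauss_ints" if "u \<in> V" "v \<in> V" for u v by (rule cycD(3)[OF c' that])
  have \<sigma>v: "\<sigma> a = 1" "\<sigma> c = cnj t" "\<sigma> b = cnj (w a b)" using neq by (auto simp: \<sigma>_def)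
  have ac': "w' a c = 1 + \<i>" and ab': "w' a b = 1"
    using gunit_cnj_mult[OF t(1)] gunit_cnj_mult[OF b1] by (simp_all add: w'_def \<sigma>v t(2) mult.assoc)
  have bc: "w b c = 0"
  proof (rule gauss_norm_cases[OF g[of b c] small[of b c]])
    assume "(cmod (w b c))\<^sup>2 = 1"
    then show ?thesis using no_light_triangle[OF c _ _ diag ac ab] neq abcd by auto
  next
    assume "(cmod (w b c))\<^sup>2 = 2"
    moreover from this have "b \<noteq> d" using hn[of c d] cd abcd by auto
    moreover have "(\<Sum>u\<in>{a, b, d}. (cmod (w u c))\<^sup>2) \<le> nsq V (\<lambda>u. w u c)"
      unfolding nsq_def by (rule sum_mono2) (use abcd cycD(1)[OF c] in auto)
    ultimately show ?thesis using cyc_nsq_col[OF c, of c] abcd neq ac cd hn[of c d] by simp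
  qed (use abcd in auto)
  have bd: "b \<noteq> d" using bc hn[of c d] cd abcd by auto
  have ad: "w a d = 0"
  proof (rule gauss_norm_cases[OF g[of a d] small[of a d]])
    assume "(cmod (w a d))\<^sup>2 = 1"
    then show ?thesis
      using no_light_triangle[OF c, of c d a] neq abcd diag ac cd hn[of a c] hn[of a d] by auto
  next
    assume "(cmod (w a d))\<^sup>2 = 2"
    moreover have "(\<Sum>u\<in>{c, b, d}. (cmod (w u a))\<^sup>2) \<le> nsq V (\<lambda>u. w u a)"
      unfolding nsq_def by (rule sum_mono2) (use abcd cycD(1)[OF c] in auto)
    ultimately show ?thesis using cyc_nsq_col[OF c, of a] abcd neq bd ac ab hn[of a d] hn[of a b] hn[of a c] by simp
  qed (use abcd in auto)
  have \<sigma>d: "\<sigma> d = cnj (t * w c d)" using neq bd by (auto simp: \<sigma>_def)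
  have cd': "w' c d = 1"
    using gunit_cnj_mult[OF gunit_mult[OF t(1) d1]] by (simp add: w'_def \<sigma>v \<sigma>d)
  have "(\<exists>f s. embeds V w' UNIV s8dd f s) \<or> (\<exists>f s. embeds V w' UNIV s8d f s)"
    by (rule normalized_fat_edge[OF c' cn' abcd _ diag' ab' ac' _ _ cd'])
      (use neq bd ad bc small[of b d] abcd in \<open>auto simp: n', auto simp: w'_def\<close>)
  moreover have "embeds V w UNIV g f (\<lambda>u. \<sigma> u * s u)" if "embeds V w' UNIV g f s" for g :: "s8_vertex \<Rightarrow> _" and f s
    using that unfolding w'_def[abs_def] by (rule embeds_rescale[OF _ \<sigma>])
  ultimately show ?thesis by blast
qed

section \<open>Chains\<close>

definition dlt :: "nat \<Rightarrow> complex \<Rightarrow> nat \<Rightarrow> complex" where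
  "dlt a c j = (if j = a then c else 0)"

text \<open>The vertices of \<open>C_graph k\<close> as vectors of norm 2 in the Gaussian lattice of rank \<open>k\<close>; the weights are their inner
  products.\<close>

fun coord :: "nat \<Rightarrow> c_vertex \<Rightarrow> nat \<Rightarrow> complex" where
  "coord k VP j = dlt 1 (1 - \<i>) j"
| "coord k VQ j = dlt k (1 - \<i>) j"
| "coord k (VT l) j = dlt l 1 j + dlt (Suc l) 1 j"
| "coord k (VB l) j = dlt l 1 j + dlt (Suc l) (-1) j"

lemma sum_dlt:
  "(\<Sum>j=Suc 0..k. dlt a \<alpha> j * cnj (dlt b \<beta> j)) = (if a = b \<and> Suc 0 \<le> a \<and> a \<le> k then \<alpha> * cnj \<beta> else 0)"
proof -
  have "(\<Sum>j=Suc 0..k. dlt a \<alpha> j * cnj (dlt b \<beta> j)) = (\<Sum>j=Suc 0..k. if j = a then (if a = b then \<alpha> * cnj \<beta> else 0) else 0)"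
    by (rule sum.cong) (auto simp: dlt_def)
  then show ?thesis by simp
qed

lemma ii_mult: "(1 - \<i>) * (1 + \<i>) = 2" "(1 + \<i>) * (1 - \<i>) = 2" "(1 - \<i>) * \<i> - \<i> = 1"
  by (simp_all add: algebra_simps)

definition chain_vertices :: "nat \<Rightarrow> c_vertex set" where
  "chain_vertices m = insert VP (VT ` {1..<m} \<union> VB ` {1..<m})"

lemma C_graph_vertices: "1 \<le> k \<Longrightarrow> fst (C_graph k) = insert VQ (chain_vertices k)"
  by (auto simp: C_graph_def chain_vertices_def)

text \<open>For \<open>k = 1\<close> the formula fails: \<open>VP\<close> and \<open>VQ\<close>
  would share the only coordinate and have inner product 2.\<close>

lemma C_graph_weight:
  assumes "2 \<le> k" "x \<in> insert VQ (chain_vertices k)" "y \<in> insert VQ (chain_vertices k)"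
  shows "snd (C_graph k) x y = (\<Sum>j=1..k. coord k x j * cnj (coord k y j)) - (if x = y then 2 else 0)"
  using assms(2,3)
  by (cases x; cases y)
    (use assms(1) in \<open>auto simp: chain_vertices_def C_graph_def hermitian_weight_def distrib_left distrib_right
      sum.distrib sum_dlt ii_mult\<close>)

lemma coord_norm:
  assumes "x \<in> chain_vertices m" "1 \<le> m"
  shows "(\<Sum>j=1..m. coord k x j * cnj (coord k x j)) = 2"
  using assms by (cases x) (auto simp: chain_vertices_def distrib_left distrib_right sum.distrib sum_dlt ii_mult)

text \<open>A column before the last meets four units, or for \<open>j = 1\<close> two units and the
  entry of \<open>VP\<close>, and so has norm 4, the most that 2 - w >= 0 permits. The last column
  still has room for norm 2; this drives the whole construction.\<close>

lemma coord_columns: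
  assumes "1 \<le> j" "j \<le> m" "1 \<le> l" "l \<le> m"
  shows "(\<Sum>x\<in>chain_vertices m. cnj (coord k x j) * coord k x l) = (if j = l then (if j < m then 4 else 2) else 0)"
proof -
  have "(\<Sum>x\<in>chain_vertices m. cnj (coord k x j) * coord k x l)
    = cnj (coord k VP j) * coord k VP l
      + ((\<Sum>x\<in>VT ` {1..<m}. cnj (coord k x j) * coord k x l) + (\<Sum>x\<in>VB ` {1..<m}. cnj (coord k x j) * coord k x l))"
    unfolding chain_vertices_def by (subst sum.insert; (subst sum.union_disjoint)?) auto
  also have "(\<Sum>x\<in>VT ` {1..<m}. cnj (coord k x j) * coord k x l) = (\<Sum>i=1..<m. cnj (coord k (VT i) j) * coord k (VT i) l)"
    by (subst sum.reindex) (auto simp: inj_on_def)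
  also have "(\<Sum>x\<in>VB ` {1..<m}. cnj (coord k x j) * coord k x l) = (\<Sum>i=1..<m. cnj (coord k (VB i) j) * coord k (VB i) l)"
    by (subst sum.reindex) (auto simp: inj_on_def)
  also have "(\<Sum>i=1..<m. cnj (coord k (VT i) j) * coord k (VT i) l) + (\<Sum>i=1..<m. cnj (coord k (VB i) j) * coord k (VB i) l)
    = (\<Sum>i=1..<m. (if i = j then (if j = l then 2 else 0) else 0) + (if i = j - 1 then (if j = l then 2 else 0) else 0))"
    unfolding sum.distrib[symmetric] by (rule sum.cong) (auto simp: dlt_def)
  also have "\<dots> = (if j = l then (if j < m then 2 else 0) + (if 2 \<le> j then 2 else 0) else 0)"
    using assms by (auto simp: sum.distrib)
  finally show ?thesis using assms by (auto simp: dlt_def algebra_simps)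
qed

lemma finite_chain_vertices [simp]: "finite (chain_vertices m)"
  by (simp add: chain_vertices_def)

lemma card_chain_vertices: "1 \<le> m \<Longrightarrow> m \<le> card (chain_vertices m)"
proof -
  assume "1 \<le> m"
  have "m = card (insert VP (VT ` {1..<m}))"
    using \<open>1 \<le> m\<close> by (subst card_insert_disjoint) (auto simp: card_image inj_on_def)
  also have "\<dots> \<le> card (chain_vertices m)"
    by (rule card_mono) (auto simp: chain_vertices_def)
  finally show ?thesis .
qed

lemma chain_vertices_Suc: "1 \<le> m \<Longrightarrow> chain_vertices (Suc m) = chain_vertices m \<union> {VT m, VB m}"
  by (auto simp: chain_vertices_def)

lemma chain_vertices_new: "VT m \<notin> chain_vertices m" "VB m \<notin> chain_vertices m" "VQ \<notin> chain_vertices m"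
  by (auto simp: chain_vertices_def)

lemma coord_zero: "1 \<le> m \<Longrightarrow> x \<in> chain_vertices m \<Longrightarrow> m < j \<Longrightarrow> coord k x j = 0"
  by (auto simp: chain_vertices_def dlt_def)

lemma coord_last: "1 \<le> m \<Longrightarrow> \<exists>x\<in>chain_vertices m. coord k x m \<noteq> 0"
proof (cases "m = 1")
  case True
  then show ?thesis by (intro bexI[of _ VP]) (auto simp: chain_vertices_def dlt_def)
next
  case False
  moreover assume "1 \<le> m"
  ultimately show ?thesis by (intro bexI[of _ "VT (m - 1)"]) (auto simp: chain_vertices_def dlt_def)
qed

text \<open>Bordering by an uncharged vertex keeps 2 + w and 2 - w semidefinite as soon as both
  dominate x x*/2, by the Schur complement at the new diagonal entry 2. \<open>H\<close> says this
  for 2 + w. For 2 - w it comes from the preimage \<open>y\<close> of \<open>x\<close> and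
  Cauchy-Schwarz.\<close>

lemma not_no_ext:
  assumes c: "cyc V w" and x: "\<And>u. u \<in> V \<Longrightarrow> x u \<in> gauss_ints" "u0 \<in> V" "x u0 \<noteq> 0"
    and H: "\<And>z. (cmod (ip V z x))\<^sup>2 \<le> 2 * Re (ip V z (mv V (scalar_plus 2 w) z))"
    and K: "\<And>u. u \<in> V \<Longrightarrow> mv V (scalar_minus 2 w) y u = x u" "Re (ip V y x) \<le> 2"
  shows "\<not> no_ext V w"
proof -
  have f: "finite V" by (rule cycD(1)[OF c])
  have "\<bar>Re (ip V z (mv V w z)) + 2 * Re (\<zeta> * ip V z x)\<bar> \<le> 2 * (nsq V z + (cmod \<zeta>)\<^sup>2)" for z \<zeta>
  proof -
    define q where "q = Re (ip V z (mv V w z))"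
    define b where "b = cmod (ip V z x)"
    have h: "b\<^sup>2 \<le> 2 * (2 * nsq V z + q)"
      using H[of z] by (simp add: ip_mv_scalar_plus[OF f] q_def b_def)
    have y: "ip V t (mv V (scalar_minus 2 w) y) = ip V t x" for t
      by (rule ip_cong) (simp_all add: K(1))
    have "b\<^sup>2 \<le> Re (ip V z (mv V (scalar_minus 2 w) z)) * Re (ip V y x)"
      using psd_cauchy_schwarz[OF cyc_psd(2)[OF c], of z y] by (simp add: y b_def)
    also have "\<dots> \<le> Re (ip V z (mv V (scalar_minus 2 w) z)) * 2"
      using cyc_psd(2)[OF c] K(2) by (intro mult_left_mono) (auto simp: psd_def)
    also have "\<dots> = 2 * (2 * nsq V z - q)"
      by (simp add: ip_mv_scalar_minus[OF f] q_def)
    finally have k: "b\<^sup>2 \<le> 2 * (2 * nsq V z - q)" .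
    have "\<bar>Re (\<zeta> * ip V z x)\<bar> \<le> cmod \<zeta> * b"
      using abs_Re_le_cmod[of "\<zeta> * ip V z x"] by (simp add: norm_mult b_def)
    then have r: "Re (\<zeta> * ip V z x) \<le> cmod \<zeta> * b" "- (cmod \<zeta> * b) \<le> Re (\<zeta> * ip V z x)" by auto
    \<comment> \<open>Completing the square bounds the cross term by the part in \<open>b\<close>,
      which \<open>h\<close> and \<open>k\<close> absorb, and the part in
      \<open>\<zeta>\<close>.\<close>
    have "0 \<le> (b - 2 * cmod \<zeta>)\<^sup>2" by simp
    also have "\<dots> = b\<^sup>2 - 4 * (cmod \<zeta> * b) + 4 * (cmod \<zeta>)\<^sup>2" by (simp add: power2_eq_square algebra_simps)
    finally show ?thesis using h k r unfolding q_def[symmetric] abs_le_iff by argo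
  qed
  then show ?thesis unfolding no_ext_def using x by blast
qed

definition residual :: "('v \<Rightarrow> 'v \<Rightarrow> complex) \<Rightarrow> nat \<Rightarrow> (nat \<Rightarrow> 'v \<Rightarrow> complex) \<Rightarrow> 'v \<Rightarrow> 'v \<Rightarrow> complex" where
  "residual w m E u v = scalar_plus 2 w u v - (\<Sum>j=1..m. E j u * cnj (E j v))"

text \<open>A chain writes \<open>2 + w\<close> as the Gram matrix of the vectors with coordinates \<open>E 1, \<dots>, E m\<close> plus a positive
  semidefinite residual. The listed vertices \<open>\<phi> x\<close> have, up to a unit, the coordinates of the vertices of
  \<open>C_graph\<close>, and only the last coordinate is shared with vertices that are not listed.\<close>

definition chain :: "'v set \<Rightarrow> ('v \<Rightarrow> 'v \<Rightarrow> complex) \<Rightarrow> nat \<Rightarrow> (nat \<Rightarrow> 'v \<Rightarrow> complex) \<Rightarrow> (c_vertex \<Rightarrow> 'v) \<Rightarrow> (c_vertex \<Rightarrow> complex) \<Rightarrow> bool" where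
  "chain V w m E \<phi> s \<longleftrightarrow> 1 \<le> m \<and> inj_on \<phi> (chain_vertices m) \<and> \<phi> ` chain_vertices m \<subseteq> V \<and>
     (\<forall>x\<in>chain_vertices m. gunit (s x)) \<and>
     (\<forall>j\<in>{1..m}. \<forall>u\<in>V. E j u \<in> gauss_ints) \<and>
     (\<forall>x\<in>chain_vertices m. \<forall>j\<in>{1..m}. E j (\<phi> x) = s x * coord 0 x j) \<and>
     (\<forall>u\<in>V - \<phi> ` chain_vertices m. \<forall>j\<in>{1..<m}. E j u = 0) \<and>
     psd V (residual w m E)"

lemma mv_residual:
  assumes "finite V"
  shows "mv V (residual w m E) z u = mv V (scalar_plus 2 w) z u - (\<Sum>j=1..m. E j u * ip V (E j) z)"
proof -
  have "mv V (\<lambda>u v. \<Sum>j=1..m. E j u * cnj (E j v)) z u = (\<Sum>j=1..m. E j u * ip V (E j) z)"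
    unfolding mv_def ip_def sum_distrib_right sum_distrib_left by (subst sum.swap) (simp add: mult.assoc)
  then show ?thesis
    unfolding residual_def mv_kernel_diff by simp
qed

text \<open>The first bound is semidefiniteness of the residual. The second adds w <= 2, so that 2 +
  w <= 4; it is what limits how many vertices can share a coordinate.\<close>

lemma residual_bessel:
  assumes c: "cyc V w" and p: "psd V (residual w m E)"
  shows "(\<Sum>j=1..m. (cmod (ip V (E j) z))\<^sup>2) \<le> Re (ip V z (mv V (scalar_plus 2 w) z))"
    and "(\<Sum>j=1..m. (cmod (ip V (E j) z))\<^sup>2) \<le> 4 * nsq V z"
proof -
  have f: "finite V" by (rule cycD(1)[OF c])
  have "ip V z (\<lambda>u. \<Sum>j=1..m. E j u * ip V (E j) z) = (\<Sum>j=1..m. ip V (E j) z * ip V z (E j))"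
    unfolding ip_def[of V z] sum_distrib_left by (subst sum.swap) (simp add: mult_ac)
  also have "\<dots> = of_real (\<Sum>j=1..m. (cmod (ip V (E j) z))\<^sup>2)"
    unfolding of_real_sum complex_norm_square cnj_ip ..
  finally have "ip V z (mv V (residual w m E) z)
    = ip V z (mv V (scalar_plus 2 w) z) - of_real (\<Sum>j=1..m. (cmod (ip V (E j) z))\<^sup>2)"
    unfolding mv_residual[OF f, abs_def] by (simp only: ip_diff)
  moreover have "0 \<le> Re (ip V z (mv V (residual w m E) z))" using p by (simp add: psd_def)
  ultimately show 1: "(\<Sum>j=1..m. (cmod (ip V (E j) z))\<^sup>2) \<le> Re (ip V z (mv V (scalar_plus 2 w) z))"
    by (simp del: of_real_sum of_real_power)
  have "Re (ip V z (mv V w z)) \<le> 2 * nsq V z" using c by (auto simp: cyc_def abs_le_iff)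
  then show "(\<Sum>j=1..m. (cmod (ip V (E j) z))\<^sup>2) \<le> 4 * nsq V z"
    using 1 by (simp add: ip_mv_scalar_plus[OF f])
qed

locale uncharged =
  fixes V :: "'v set" and w :: "'v \<Rightarrow> 'v \<Rightarrow> complex"
  assumes cyc: "cyc V w" and diag: "\<And>u. u \<in> V \<Longrightarrow> w u u = 0"
    and small: "\<And>u v. u \<in> V \<Longrightarrow> v \<in> V \<Longrightarrow> (cmod (w u v))\<^sup>2 < 4"
begin

lemma fin: "finite V" by (rule cycD(1)[OF cyc])

lemma mv_minus_two_plus_two:
  "u \<in> V \<Longrightarrow> mv V (scalar_minus 2 w) z u = 4 * z u - mv V (scalar_plus 2 w) z u"
  by (simp add: mv_scalar_minus[OF fin] mv_scalar_plus[OF fin])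

lemma residual_diag: "u \<in> V \<Longrightarrow> residual w m E u u = of_real (2 - (\<Sum>j=1..m. (cmod (E j u))\<^sup>2))"
  by (simp only: residual_def diag complex_norm_square of_real_diff of_real_sum) simp

end

locale chain_at = uncharged V w for V :: "'v set" and w +
  fixes m :: nat and E \<phi> s
  assumes ch: "chain V w m E \<phi> s"
begin

abbreviation "L \<equiv> \<phi> ` chain_vertices m"
abbreviation "R \<equiv> residual w m E"

lemma m1: "1 \<le> m" and inj: "inj_on \<phi> (chain_vertices m)" and LV: "L \<subseteq> V"
  and su: "x \<in> chain_vertices m \<Longrightarrow> gunit (s x)"
  and Eg: "1 \<le> j \<Longrightarrow> j \<le> m \<Longrightarrow> u \<in> V \<Longrightarrow> E j u \<in> gauss_ints"
  and Ex: "x \<in> chain_vertices m \<Longrightarrow> 1 \<le> j \<Longrightarrow> j \<le> m \<Longrightarrow> E j (\<phi> x) = s x * coord 0 x j"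
  and Eo: "u \<in> V - L \<Longrightarrow> 1 \<le> j \<Longrightarrow> j < m \<Longrightarrow> E j u = 0"
  and psdR: "psd V R"
  using ch unfolding chain_def by simp_all

lemma phi_V: "x \<in> chain_vertices m \<Longrightarrow> \<phi> x \<in> V"
  using LV by auto

lemma sum_listed:
  assumes "1 \<le> j" "j \<le> m" "1 \<le> l" "l \<le> m"
  shows "(\<Sum>u\<in>L. cnj (E j u) * E l u) = (if j = l then (if j < m then 4 else 2) else 0)"
proof -
  have "(\<Sum>u\<in>L. cnj (E j u) * E l u) = (\<Sum>x\<in>chain_vertices m. cnj (E j (\<phi> x)) * E l (\<phi> x))"
    using inj by (simp add: sum.reindex)
  also have "\<dots> = (\<Sum>x\<in>chain_vertices m. cnj (coord 0 x j) * coord 0 x l)"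
  proof (rule sum.cong)
    fix x assume x: "x \<in> chain_vertices m"
    have "cnj (E j (\<phi> x)) * E l (\<phi> x) = (cnj (s x) * s x) * (cnj (coord 0 x j) * coord 0 x l)"
      using x assms by (simp add: Ex mult_ac)
    then show "cnj (E j (\<phi> x)) * E l (\<phi> x) = cnj (coord 0 x j) * coord 0 x l"
      by (simp add: gunit_cnj_mult su x)
  qed simp
  finally show ?thesis using coord_columns[OF assms] by simp
qed

lemma ip_columns:
  assumes "1 \<le> j" "j \<le> m" "1 \<le> l" "l \<le> m"
  shows "ip V (E j) (E l) = (if j = l then (if j < m then 4 else 2) else 0) + (\<Sum>u\<in>V - L. cnj (E j u) * E l u)"
  unfolding ip_def using sum.subset_diff[OF LV fin, of "\<lambda>u. cnj (E j u) * E l u"] sum_listed[OF assms] by simp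

lemma ip_column_last:
  assumes "1 \<le> j" "j < m"
  shows "ip V (E j) (E m) = 0"
  using ip_columns[of j m] assms by (simp add: Eo)

lemma nsq_last: "nsq V (E m) = 2 + (\<Sum>u\<in>V - L. (cmod (E m u))\<^sup>2)"
proof -
  have "of_real (nsq V (E m)) = ip V (E m) (E m)" by (simp add: ip_self)
  also have "\<dots> = 2 + (\<Sum>u\<in>V - L. cnj (E m u) * E m u)" using ip_columns[of m m] m1 by simp
  also have "\<dots> = of_real (2 + (\<Sum>u\<in>V - L. (cmod (E m u))\<^sup>2))"
    by (simp add: complex_norm_square mult.commute del: of_real_power)
  finally show ?thesis using of_real_eq_iff by blast
qed

text \<open>The coordinates of a listed vertex already use up its norm 2. So its diagonal entry in
  the residual is 0, and semidefiniteness kills its row and column.\<close>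

lemma residual_listed:
  assumes "x \<in> chain_vertices m" "v \<in> V"
  shows "R v (\<phi> x) = 0" "R (\<phi> x) v = 0"
proof -
  have "(\<Sum>j=1..m. E j (\<phi> x) * cnj (E j (\<phi> x))) = (\<Sum>j=1..m. coord 0 x j * cnj (coord 0 x j))"
  proof (rule sum.cong)
    fix j assume "j \<in> {1..m}"
    then have "E j (\<phi> x) * cnj (E j (\<phi> x)) = (s x * cnj (s x)) * (coord 0 x j * cnj (coord 0 x j))"
      using assms by (simp add: Ex mult_ac)
    then show "E j (\<phi> x) * cnj (E j (\<phi> x)) = coord 0 x j * cnj (coord 0 x j)"
      by (simp add: gunit_cnj_mult su assms)
  qed simp
  then have "R (\<phi> x) (\<phi> x) = 0"
    using coord_norm[OF assms(1) m1] by (simp add: residual_def diag phi_V assms)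
  then show "R v (\<phi> x) = 0" "R (\<phi> x) v = 0"
    using psd_diag_zero[OF psdR phi_V[OF assms(1)] assms(2)] by auto
qed

lemma residual_open:
  assumes "u \<in> V - L"
  shows "R u u = of_real (2 - (cmod (E m u))\<^sup>2)"
proof -
  have "(\<Sum>j=1..m. (cmod (E j u))\<^sup>2) = (\<Sum>j=1..m. if j = m then (cmod (E m u))\<^sup>2 else 0)"
    by (rule sum.cong) (use Eo[OF assms] in auto)
  then show ?thesis using residual_diag[of u m E] assms m1 by simp
qed

lemma E_m_le_2: "u \<in> V - L \<Longrightarrow> (cmod (E m u))\<^sup>2 \<le> 2"
  using psd_diag[OF psdR, of u] residual_open[of u] by simp

text \<open>Bessel's inequality tested on the column \<open>E m\<close> itself bounds the square of
  its norm by four times its norm. The listed vertices contribute 2, so the open ones share at most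
  2: at most two units or one entry of norm 2.\<close>

lemma nsq_last_le: "nsq V (E m) \<le> 4"
proof -
  have "(cmod (ip V (E m) (E m)))\<^sup>2 \<le> (\<Sum>j=1..m. (cmod (ip V (E j) (E m)))\<^sup>2)"
    using m1 by (intro member_le_sum) auto
  also have "\<dots> \<le> 4 * nsq V (E m)" by (rule residual_bessel[OF cyc psdR])
  finally have "nsq V (E m) * nsq V (E m) \<le> 4 * nsq V (E m)"
    by (simp add: ip_self power2_eq_square)
  moreover have "nsq V (E m) > 0" unfolding nsq_last by (simp add: add_pos_nonneg sum_nonneg)
  ultimately show ?thesis by simp
qed

lemma last_open_le: "(\<Sum>u\<in>V - L. (cmod (E m u))\<^sup>2) \<le> 2"
  using nsq_last_le nsq_last by simp

lemma last_nonzero: "\<exists>x\<in>chain_vertices m. E m (\<phi> x) \<noteq> 0"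
proof -
  obtain x where "x \<in> chain_vertices m" "coord 0 x m \<noteq> 0" using coord_last[OF m1] by blast
  then show ?thesis using m1 su[of x] by (intro bexI[of _ x]) (auto simp: Ex gunit_nonzero)
qed

text \<open>If no other vertex uses the last coordinate, the vertex \<open>VQ\<close> can be added.\<close>

lemma not_no_ext_end:
  assumes z: "\<And>u. u \<in> V - L \<Longrightarrow> E m u = 0"
  shows "\<not> no_ext V w"
proof -
  have n: "nsq V (E m) = 2" using nsq_last z by simp
  \<comment> \<open>\<open>E m\<close> is supported on the listed vertices, where the residual
    vanishes. Hence \<open>E m\<close> is an eigenvector of 2 + w, and of 2 - w, with eigenvalue
    2.\<close>
  have "mv V R (E m) u = 0" if "u \<in> V" for u
    unfolding mv_def by (rule sum.neutral) (use z residual_listed(1) that in \<open>auto 4 3\<close>)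
  moreover have "(\<Sum>j=1..m. E j u * ip V (E j) (E m)) = (\<Sum>j=1..m. if j = m then 2 * E m u else 0)" for u
    by (rule sum.cong) (use ip_column_last n in \<open>auto simp: ip_self\<close>)
  ultimately have H: "mv V (scalar_plus 2 w) (E m) u = 2 * E m u" if "u \<in> V" for u
    using mv_residual[OF fin, of w m E "E m" u] m1 that by simp
  \<comment> \<open>Inner products with \<open>1 + \<i>\<close> times the last unit vector, which is
    \<open>VQ\<close> up to the unit \<open>\<i>\<close>. By the eigenvalue 2, the preimage under 2
    - w is half of \<open>x\<close>.\<close>
  define x where "x u = (1 - \<i>) * E m u" for u
  define y where "y u = (1 - \<i>) / 2 * E m u" for u
  obtain x0 where x0: "x0 \<in> chain_vertices m" "E m (\<phi> x0) \<noteq> 0" using last_nonzero by blast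
  show ?thesis
  proof (rule not_no_ext[OF cyc])
    show "x u \<in> gauss_ints" if "u \<in> V" for u
      using Eg[of m u] m1 that unfolding x_def by (intro gauss_ints_mult) (auto simp: gauss_ints_def)
    show "\<phi> x0 \<in> V" "x (\<phi> x0) \<noteq> 0" using x0 phi_V by (auto simp: x_def)
    show "(cmod (ip V z x))\<^sup>2 \<le> 2 * Re (ip V z (mv V (scalar_plus 2 w) z))" for z
    proof -
      have "cmod (ip V z (E m)) = cmod (ip V (E m) z)" by (metis cnj_ip complex_mod_cnj)
      then have "(cmod (ip V z x))\<^sup>2 = 2 * (cmod (ip V (E m) z))\<^sup>2"
        unfolding x_def ip_scale norm_mult power_mult_distrib by (simp add: cmod_power2[of "1 - \<i>"])
      also have "(cmod (ip V (E m) z))\<^sup>2 \<le> (\<Sum>j=1..m. (cmod (ip V (E j) z))\<^sup>2)"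
        using m1 by (intro member_le_sum) auto
      also have "\<dots> \<le> Re (ip V z (mv V (scalar_plus 2 w) z))" by (rule residual_bessel[OF cyc psdR])
      finally show ?thesis by simp
    qed
    show "mv V (scalar_minus 2 w) y u = x u" if "u \<in> V" for u
      using that unfolding mv_minus_two_plus_two[OF that] y_def mv_scale H[OF that] x_def by (simp add: field_simps)
    show "Re (ip V y x) \<le> 2"
      unfolding y_def x_def ip_scale ip_scale_left by (simp add: ip_self n)
  qed
qed

text \<open>The coordinate that the Schur complement of the residual splits off at an open vertex
  \<open>u\<close> with \<open>R u u = 1\<close>. The factor \<open>E m u\<close> gives
  \<open>u\<close> the same entry in coordinates m and m + 1, as \<open>VT m\<close> has up to a
  unit.\<close>

definition next_column :: "'v \<Rightarrow> 'v \<Rightarrow> complex" where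
  "next_column u v = R v u * E m u"

context
  fixes u assumes u: "u \<in> V - L" and Eu: "(cmod (E m u))\<^sup>2 = 1"
begin

abbreviation "E' \<equiv> E(Suc m := next_column u)"

lemma E_unit: "gunit (E m u)"
  using Eg[of m u] m1 u Eu by (intro gunitI) auto

lemma residual_u: "R u u = 1"
  using residual_open[OF u] Eu by simp

lemma E'_u: "next_column u u = E m u"
  by (simp add: next_column_def residual_u)

lemma E'_listed: "x \<in> chain_vertices m \<Longrightarrow> next_column u (\<phi> x) = 0"
  using residual_listed(2)[of x u] u by (simp add: next_column_def)

lemma residual_Suc: "residual w (Suc m) E' = (\<lambda>v v'. R v v' - next_column u v * cnj (next_column u v'))"
  by (simp add: residual_def fun_eq_iff)

lemma psd_residual_Suc: "psd V (residual w (Suc m) E')"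
  unfolding residual_Suc
  by (rule psd_schur_complement[OF psdR, of u 1 _ "E m u"])
    (use u residual_u Eu in \<open>auto simp: next_column_def mult.commute\<close>)

lemma E'_gauss:
  assumes "v \<in> V"
  shows "next_column u v \<in> gauss_ints"
proof -
  have "R v u \<in> gauss_ints"
    unfolding residual_def
    using assms u cycD(3)[OF cyc] Eg
    by (auto intro!: gauss_ints_diff gauss_ints_add gauss_ints_sum gauss_ints_mult gauss_ints_cnj)
  then show ?thesis using E_unit by (simp add: next_column_def gunit_def gauss_ints_mult)
qed

lemma ip_E'_last: "ip V (next_column u) (E m) = (\<Sum>v\<in>V - L. cnj (next_column u v) * E m v)"
  unfolding ip_def using sum.subset_diff[OF LV fin, of "\<lambda>v. cnj (next_column u v) * E m v"]
  by (simp add: E'_listed sum.reindex[OF inj])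

text \<open>If only \<open>u\<close> uses the last coordinate, the opposite edge, with coordinate vector \<open>E m - E (m + 1)\<close>, can be added.\<close>

lemma not_no_ext_single:
  assumes z: "\<And>v. v \<in> V - L \<Longrightarrow> v \<noteq> u \<Longrightarrow> E m v = 0"
  shows "\<not> no_ext V w"
proof -
  have at_u: "(\<Sum>v\<in>V - L. F v) = F u" if "\<And>v. v \<in> V - L \<Longrightarrow> v \<noteq> u \<Longrightarrow> F v = 0" for F :: "'v \<Rightarrow> 'c::comm_monoid_add"
  proof -
    have "(\<Sum>v\<in>V - L. F v) = (\<Sum>v\<in>{u}. F v)"
      by (rule sum.mono_neutral_right) (use u fin that in auto)
    then show ?thesis by simp
  qed
  have n: "nsq V (E m) = 3" unfolding nsq_last using at_u[of "\<lambda>v. (cmod (E m v))\<^sup>2"] z Eu by simp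
  have i: "ip V (next_column u) (E m) = 1"
    unfolding ip_E'_last using at_u[of "\<lambda>v. cnj (next_column u v) * E m v"] z gunit_cnj_mult[OF E_unit]
    by (simp add: E'_u)
  \<comment> \<open>\<open>E m\<close> lives on the listed vertices and \<open>u\<close>. The new
    residual vanishes at the former as before and at \<open>u\<close> because the Schur complement
    was taken there.\<close>
  have "mv V (residual w (Suc m) E') (E m) v = 0" if v: "v \<in> V" for v
    unfolding mv_def
  proof (rule sum.neutral, rule ballI)
    fix t assume t: "t \<in> V"
    consider x where "x \<in> chain_vertices m" "t = \<phi> x" | "t = u" | "t \<in> V - L" "t \<noteq> u" using t by blast
    then show "residual w (Suc m) E' v t * E m t = 0"
    proof cases
      case 1
      then show ?thesis using residual_listed(1)[OF 1(1) v] E'_listed[OF 1(1)] by (simp add: residual_Suc)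
    next
      case 2
      then show ?thesis using gunit_cnj_mult[OF E_unit]
        by (simp only: residual_Suc E'_u) (simp add: next_column_def mult.assoc)
    next
      case 3
      then show ?thesis using z by simp
    qed
  qed
  moreover have "(\<Sum>j=1..Suc m. E' j v * ip V (E' j) (E m)) = 3 * E m v + next_column u v" for v
  proof -
    have "(\<Sum>j=1..Suc m. E' j v * ip V (E' j) (E m))
      = (\<Sum>j=1..m. E' j v * ip V (E' j) (E m)) + next_column u v"
      using m1 by (simp add: i)
    also have "(\<Sum>j=1..m. E' j v * ip V (E' j) (E m)) = (\<Sum>j=1..m. if j = m then 3 * E m v else 0)"
      by (rule sum.cong) (use ip_column_last n in \<open>auto simp: ip_self\<close>)
    finally show ?thesis using m1 by simp
  qed
  ultimately have H: "mv V (scalar_plus 2 w) (E m) v = 3 * E m v + next_column u v" if "v \<in> V" for v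
    using mv_residual[OF fin, of w "Suc m" E' "E m" v] that by (simp del: sum.cl_ivl_Suc fun_upd_apply)
  \<comment> \<open>The row of the missing \<open>VB m\<close>. By \<open>H\<close>, 2 - w maps
    \<open>E m\<close> to 4 \<open>E m\<close> - (3 \<open>E m\<close> +
    \<open>next_column u\<close>), which is \<open>x\<close>; so the preimage required by
    \<open>not_no_ext\<close> is \<open>E m\<close>, with pairing 3 - 1 = 2.\<close>
  define x where "x v = E m v - next_column u v" for v
  obtain x0 where x0: "x0 \<in> chain_vertices m" "E m (\<phi> x0) \<noteq> 0" using last_nonzero by blast
  show ?thesis
  proof (rule not_no_ext[OF cyc])
    show "x v \<in> gauss_ints" if "v \<in> V" for v
      using Eg[of m v] m1 that E'_gauss by (simp add: x_def gauss_ints_diff)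
    show "\<phi> x0 \<in> V" "x (\<phi> x0) \<noteq> 0" using x0 phi_V E'_listed by (auto simp: x_def)
    show "(cmod (ip V z x))\<^sup>2 \<le> 2 * Re (ip V z (mv V (scalar_plus 2 w) z))" for z
    proof -
      have sw: "cmod (ip V z y) = cmod (ip V y z)" for y by (metis cnj_ip complex_mod_cnj)
      have "cmod (ip V z x) \<le> cmod (ip V (E m) z) + cmod (ip V (next_column u) z)"
        unfolding x_def ip_diff using norm_triangle_ineq4 by (metis sw)
      then have "(cmod (ip V z x))\<^sup>2 \<le> (cmod (ip V (E m) z) + cmod (ip V (next_column u) z))\<^sup>2"
        by (rule power_mono) simp
      also have "\<dots> \<le> 2 * ((cmod (ip V (E m) z))\<^sup>2 + (cmod (ip V (next_column u) z))\<^sup>2)"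
        using sum_squares_bound[of "cmod (ip V (E m) z)" "cmod (ip V (next_column u) z)"]
        by (simp add: power2_sum)
      also have "(cmod (ip V (E m) z))\<^sup>2 + (cmod (ip V (next_column u) z))\<^sup>2
        = (\<Sum>j\<in>{m, Suc m}. (cmod (ip V (E' j) z))\<^sup>2)" by simp
      also have "\<dots> \<le> (\<Sum>j=1..Suc m. (cmod (ip V (E' j) z))\<^sup>2)"
        using m1 by (intro sum_mono2) auto
      also have "\<dots> \<le> Re (ip V z (mv V (scalar_plus 2 w) z))" by (rule residual_bessel[OF cyc psd_residual_Suc])
      finally show ?thesis by simp
    qed
    show "mv V (scalar_minus 2 w) (E m) v = x v" if "v \<in> V" for v
      unfolding mv_minus_two_plus_two[OF that] H[OF that] x_def by simp
    have "ip V (E m) (next_column u) = 1" using i cnj_ip[of V "next_column u" "E m"] by simp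
    then show "Re (ip V (E m) x) \<le> 2"
      unfolding x_def ip_diff by (simp add: ip_self n)
  qed
qed

text \<open>Two open units fill the column \<open>E m\<close> up to norm 4. A saturated column is
  orthogonal to the next one, which forces the next entry of \<open>u'\<close> to be
  \<open>- E m u'\<close>. So \<open>u\<close> and \<open>u'\<close> become \<open>VT m\<close> and
  \<open>VB m\<close>, and no open vertex still uses coordinate m.\<close>

lemma chain_Suc:
  assumes u': "u' \<in> V - L" "u' \<noteq> u" "E m u' \<noteq> 0"
  shows "\<exists>E \<phi> s. chain V w (Suc m) E \<phi> s"
proof -
  have Eg': "E m u' \<in> gauss_ints" using Eg[of m u'] m1 u' by simp
  have "(\<Sum>v\<in>{u, u'}. (cmod (E m v))\<^sup>2) \<le> (\<Sum>v\<in>V - L. (cmod (E m v))\<^sup>2)"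
    by (rule sum_mono2) (use u u' fin in auto)
  then have "(cmod (E m u'))\<^sup>2 \<le> 1" using last_open_le Eu u'(2) by simp
  then have Eu': "(cmod (E m u'))\<^sup>2 = 1" using gauss_norm_ge_1[OF Eg' u'(3)] by simp
  have unit': "gunit (E m u')" by (rule gunitI[OF Eg' Eu'])
  have zero: "E m v = 0" if v: "v \<in> V - L" "v \<noteq> u" "v \<noteq> u'" for v
  proof (rule ccontr)
    assume "E m v \<noteq> 0"
    have "(\<Sum>v\<in>{u, u', v}. (cmod (E m v))\<^sup>2) \<le> (\<Sum>v\<in>V - L. (cmod (E m v))\<^sup>2)"
      by (rule sum_mono2) (use u u' v fin in auto)
    moreover have "(\<Sum>v\<in>{u, u', v}. (cmod (E m v))\<^sup>2) = 2 + (cmod (E m v))\<^sup>2" using Eu Eu' u'(2) v by simp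
    ultimately have "(cmod (E m v))\<^sup>2 \<le> 0" using last_open_le by linarith
    then show False using \<open>E m v \<noteq> 0\<close> by simp
  qed
  have two: "(\<Sum>v\<in>V - L. F v) = F u + F u'" if "\<And>v. v \<in> V - L \<Longrightarrow> v \<noteq> u \<Longrightarrow> v \<noteq> u' \<Longrightarrow> F v = 0" for F :: "'v \<Rightarrow> 'c::comm_monoid_add"
  proof -
    have "(\<Sum>v\<in>V - L. F v) = (\<Sum>v\<in>{u, u'}. F v)"
      by (rule sum.mono_neutral_right) (use u u' fin that in auto)
    then show ?thesis using u'(2) by simp
  qed
  have n: "nsq V (E m) = 4" unfolding nsq_last using two[of "\<lambda>v. (cmod (E m v))\<^sup>2"] zero Eu Eu' by simp
  \<comment> \<open>Bessel for the saturated column: its own term is 16, equal to the right side, so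
    nothing remains for the new column.\<close>
  have "(cmod (ip V (E m) (E m)))\<^sup>2 + (cmod (ip V (next_column u) (E m)))\<^sup>2
    = (\<Sum>j\<in>{m, Suc m}. (cmod (ip V (E' j) (E m)))\<^sup>2)" by simp
  also have "\<dots> \<le> (\<Sum>j=1..Suc m. (cmod (ip V (E' j) (E m)))\<^sup>2)"
    using m1 by (intro sum_mono2) auto
  also have "\<dots> \<le> 4 * nsq V (E m)" by (rule residual_bessel[OF cyc psd_residual_Suc])
  finally have "ip V (next_column u) (E m) = 0" by (simp add: ip_self n)
  then have "1 + cnj (next_column u u') * E m u' = 0"
    unfolding ip_E'_last using two[of "\<lambda>v. cnj (next_column u v) * E m v"] zero gunit_cnj_mult[OF E_unit]
    by (simp add: E'_u)
  then have "(1 + cnj (next_column u u') * E m u') * cnj (E m u') = 0" by simp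
  then have "cnj (next_column u u') = - cnj (E m u')"
    using gunit_cnj_mult[OF unit'] by (simp add: distrib_right mult.assoc add_eq_0_iff)
  then have E'u': "next_column u u' = - E m u'" by (metis complex_cnj_cnj complex_cnj_minus)
  define \<phi>' where "\<phi>' = \<phi>(VT m := u, VB m := u')"
  define s' where "s' = s(VT m := E m u, VB m := E m u')"
  have cv: "chain_vertices (Suc m) = chain_vertices m \<union> {VT m, VB m}" by (rule chain_vertices_Suc[OF m1])
  have old: "\<phi>' x = \<phi> x" "s' x = s x" if "x \<in> chain_vertices m" for x
    using that chain_vertices_new[of m] by (auto simp: \<phi>'_def s'_def)
  have new: "\<phi>' (VT m) = u" "\<phi>' (VB m) = u'" "s' (VT m) = E m u" "s' (VB m) = E m u'"
    by (simp_all add: \<phi>'_def s'_def)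
  have img: "\<phi>' ` chain_vertices (Suc m) = L \<union> {u, u'}"
    unfolding cv image_Un using old(1) new by simp
  have "chain V w (Suc m) E' \<phi>' s'"
    unfolding chain_def img
  proof (intro conjI ballI)
    have "inj_on \<phi>' (chain_vertices m)" using inj by (simp add: inj_on_def old)
    then show "inj_on \<phi>' (chain_vertices (Suc m))"
      unfolding cv using u u' by (auto simp: inj_on_def old new)
    show "L \<union> {u, u'} \<subseteq> V" using LV u u' by auto
    show "gunit (s' x)" if "x \<in> chain_vertices (Suc m)" for x
      using that su E_unit unit' unfolding cv by (auto simp: old new)
    show "E' j v \<in> gauss_ints" if "j \<in> {1..Suc m}" "v \<in> V" for j v
      using that Eg[of j v] E'_gauss by auto
    show "E' j v = 0" if v: "v \<in> V - (L \<union> {u, u'})" and j: "j \<in> {1..<Suc m}" for j v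
      using v j zero[of v] Eo[of v j] by (cases "j = m") auto
    show "E' j (\<phi>' x) = s' x * coord 0 x j" if x: "x \<in> chain_vertices (Suc m)" and j: "j \<in> {1..Suc m}" for j x
    proof -
      consider "x \<in> chain_vertices m" | "x = VT m" | "x = VB m" using x unfolding cv by auto
      then show ?thesis
      proof cases
        case 1
        then show ?thesis using j E'_listed[OF 1] coord_zero[OF m1 1, of j] by (auto simp: old Ex)
      next
        case 2
        then show ?thesis using j Eo[OF u, of j] by (auto simp: new E'_u dlt_def)
      next
        case 3
        then show ?thesis using j Eo[OF u'(1), of j] E'u' by (auto simp: new dlt_def)
      qed
    qed
  qed (use m1 psd_residual_Suc in auto)
  then show ?thesis by blast
qed

end

text \<open>An open vertex whose last entry has norm 2 uses up both its own norm and the room in the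
  last column. Its residual row vanishes, and any further vertex would have no edge to the listed
  ones or to \<open>u\<close>. Connectedness leaves just these vertices, with \<open>u\<close> as
  \<open>VQ\<close>.\<close>

lemma embeds_C_graph:
  assumes cn: "conn V w" and u: "u \<in> V - L" and Eu: "(cmod (E m u))\<^sup>2 = 2"
  shows "2 \<le> m \<and> (\<exists>f s. embeds V w (fst (C_graph m)) (snd (C_graph m)) f s \<and> f ` V = fst (C_graph m))"
proof -
  have zero: "E m v = 0" if v: "v \<in> V - L" "v \<noteq> u" for v
  proof (rule ccontr)
    assume "E m v \<noteq> 0"
    have "(\<Sum>v\<in>{u, v}. (cmod (E m v))\<^sup>2) \<le> (\<Sum>v\<in>V - L. (cmod (E m v))\<^sup>2)"
      by (rule sum_mono2) (use u v fin in auto)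
    moreover have "(\<Sum>v\<in>{u, v}. (cmod (E m v))\<^sup>2) = 2 + (cmod (E m v))\<^sup>2" using Eu v by simp
    ultimately have "(cmod (E m v))\<^sup>2 \<le> 0" using last_open_le by linarith
    then show False using \<open>E m v \<noteq> 0\<close> by simp
  qed
  have Ru: "R v u = 0" "R u v = 0" if "v \<in> V" for v
    using psd_diag_zero[OF psdR _ that, of u] residual_open[OF u] Eu u by auto
  have uV: "u \<in> V" using u by simp
  obtain t where t: "gunit t" "E m u = (1 + \<i>) * t"
    using gauss_norm_2[OF Eg[of m u] Eu] m1 uV by auto
  define X where "X = insert VQ (chain_vertices m)"
  define \<Phi> where "\<Phi> = \<phi>(VQ := u)"
  \<comment> \<open>The unit is \<open>\<i> * t\<close> because
    \<open>(1 + \<i>) * t = \<i> * t * (1 - \<i>)\<close> and \<open>VQ\<close> has last coordinate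
    \<open>1 - \<i>\<close>.\<close>
  define S where "S = s(VQ := \<i> * t)"
  have old: "\<Phi> x = \<phi> x" "S x = s x" "coord m x = coord 0 x" if "x \<in> chain_vertices m" for x
    using that by (auto simp: \<Phi>_def S_def chain_vertices_def fun_eq_iff)
  have new: "\<Phi> VQ = u" "S VQ = \<i> * t" by (simp_all add: \<Phi>_def S_def)
  have injX: "inj_on \<Phi> X"
    using inj u chain_vertices_new(3)[of m] by (auto simp: X_def inj_on_def old new)
  have SX: "gunit (S x)" if "x \<in> X" for x
    using that su t gunit_mult[of \<i> t] by (auto simp: X_def old new gunit_def)
  have EX: "E j (\<Phi> x) = S x * coord m x j" if "x \<in> X" "1 \<le> j" "j \<le> m" for x j
  proof (cases "x = VQ")
    case True
    have "\<i> * t * (1 - \<i>) = (1 + \<i>) * t" by (simp add: algebra_simps)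
    then show ?thesis using True that Eo[OF u, of j] t by (cases "j = m") (auto simp: new dlt_def)
  next
    case False
    then show ?thesis using that by (auto simp: X_def old Ex)
  qed
  have RX: "R (\<Phi> x) v = 0" if "x \<in> X" "v \<in> V" for x v
    using that residual_listed(2) Ru by (auto simp: X_def old new)
  have XV: "\<Phi> ` X \<subseteq> V" using LV uV by (auto simp: X_def old new)
  have wE: "w (\<Phi> x) v = (\<Sum>j=1..m. E j (\<Phi> x) * cnj (E j v)) - (if \<Phi> x = v then 2 else 0)"
    if "x \<in> X" "v \<in> V" for x v
    using RX[OF that] by (simp add: residual_def add_eq_0_iff2 eq_diff_eq add.commute)
  have surj: "\<Phi> ` X = V"
  proof (rule ccontr)
    assume "\<Phi> ` X \<noteq> V"
    then have "\<Phi> ` X \<subset> V \<and> \<Phi> ` X \<noteq> {}" using XV by (auto simp: X_def)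
    then have "\<exists>a\<in>\<Phi> ` X. \<exists>v\<in>V - \<Phi> ` X. w a v \<noteq> 0" using cn unfolding conn_def by blast
    then obtain x v where x: "x \<in> X" and v: "v \<in> V" "v \<notin> \<Phi> ` X" and xv: "w (\<Phi> x) v \<noteq> 0" by blast
    have "v \<in> V - L" "v \<noteq> u" using v by (auto simp: X_def old new)
    then have "E j v = 0" if "j \<in> {1..m}" for j
      using that zero[of v] Eo[of v j] by (cases "j = m") auto
    then have "w (\<Phi> x) v = 0" using wE[OF x v(1)] v x by auto
    then show False using xv by simp
  qed
  have wX: "w (\<Phi> x) (\<Phi> y) = S x * ((\<Sum>j=1..m. coord m x j * cnj (coord m y j)) - (if x = y then 2 else 0)) * cnj (S y)"
    if x: "x \<in> X" and y: "y \<in> X" for x y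
  proof -
    have "(\<Sum>j=1..m. E j (\<Phi> x) * cnj (E j (\<Phi> y))) = S x * (\<Sum>j=1..m. coord m x j * cnj (coord m y j)) * cnj (S y)"
      unfolding sum_distrib_left sum_distrib_right by (rule sum.cong) (use x y in \<open>auto simp: EX mult_ac\<close>)
    moreover have "\<Phi> x = \<Phi> y \<longleftrightarrow> x = y" using injX x y by (auto simp: inj_on_def)
    moreover have "(if x = y then 2 else 0) = S x * (if x = y then 2 else 0) * cnj (S y)"
      using gunit_cnj_mult(1)[OF SX[OF x]] by (cases "x = y") auto
    ultimately show ?thesis
      using wE[OF x, of "\<Phi> y"] XV y by (auto simp: right_diff_distrib left_diff_distrib)
  qed
  \<comment> \<open>With a single coordinate, the weight between \<open>VP\<close> and
    \<open>VQ\<close> would have modulus 2, which \<open>small\<close> excludes.\<close>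
  have m2: "2 \<le> m"
  proof (rule ccontr)
    assume "\<not> 2 \<le> m"
    then have m: "m = 1" using m1 by simp
    have "VP \<in> X" "VQ \<in> X" by (auto simp: X_def chain_vertices_def)
    then have "cmod (w (\<Phi> VP) (\<Phi> VQ)) = cmod ((1 - \<i>) * (1 + \<i>))"
      using wX[of VP VQ] SX[of VP] SX[of VQ] by (simp add: m dlt_def norm_mult gunit_def)
    also have "\<dots> = 2" unfolding ii_mult by simp
    finally show False using small[of "\<Phi> VP" "\<Phi> VQ"] \<open>VP \<in> X\<close> \<open>VQ \<in> X\<close> XV by auto
  qed
  define f where "f = inv_into X \<Phi>"
  have f: "f v \<in> X" "\<Phi> (f v) = v" if "v \<in> V" for v
    using that surj inv_into_into[of v \<Phi> X] f_inv_into_f[of v \<Phi> X] by (auto simp: f_def)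
  have XC: "fst (C_graph m) = X" using C_graph_vertices m2 by (simp add: X_def)
  have fV: "f ` V = X" using surj injX by (auto simp: f_def)
  have "embeds V w X (snd (C_graph m)) f (\<lambda>v. S (f v))"
    unfolding embeds_def
  proof (intro conjI ballI)
    show "inj_on f V" using f by (metis inj_onI)
    show "w v v' = S (f v) * snd (C_graph m) (f v) (f v') * cnj (S (f v'))" if "v \<in> V" "v' \<in> V" for v v'
      using wX[of "f v" "f v'"] f that C_graph_weight[OF m2, of "f v" "f v'"] by (simp add: X_def)
  qed (use fV f SX in auto)
  then show ?thesis using m2 fV XC by auto
qed

end

text \<open>If no \<open>C_graph\<close> appears, every chain can be prolonged: maximality supplies
  first one open vertex in the last coordinate, then a second. This contradicts finiteness, since a
  chain of length m lists at least m vertices.\<close>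

lemma (in uncharged) all_edges_fat:
  assumes cn: "conn V w" and ne: "no_ext V w" and p: "p \<in> V"
    and fat: "\<And>v. v \<in> V \<Longrightarrow> w p v = 0 \<or> (cmod (w p v))\<^sup>2 = 2"
  shows "\<exists>k\<ge>2. \<exists>f s. embeds V w (fst (C_graph k)) (snd (C_graph k)) f s \<and> f ` V = fst (C_graph k)"
proof (rule ccontr)
  assume none: "\<not> ?thesis"
  have step: "\<exists>E \<phi> s. chain V w (Suc m) E \<phi> s" if "chain V w m E \<phi> s" for m E \<phi> s
  proof -
    interpret chain_at V w m E \<phi> s by unfold_locales (rule that)
    obtain u where u: "u \<in> V - L" "E m u \<noteq> 0" using not_no_ext_end ne by blast
    have g: "E m u \<in> gauss_ints" using Eg[of m u] m1 u by simp
    have n2: "(cmod (E m u))\<^sup>2 \<noteq> 2" using embeds_C_graph[OF cn u(1)] none by blast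
    have n4: "(cmod (E m u))\<^sup>2 < 4" using E_m_le_2[OF u(1)] by simp
    have 1: "(cmod (E m u))\<^sup>2 = 1"
      by (rule gauss_norm_cases[OF g n4]) (use n2 u(2) in auto)
    then obtain u' where "u' \<in> V - L" "u' \<noteq> u" "E m u' \<noteq> 0" using not_no_ext_single[OF u(1)] ne by blast
    then show ?thesis by (rule chain_Suc[OF u(1) 1])
  qed
  \<comment> \<open>The constant is the inverse of \<open>1 + \<i>\<close>, which divides the fat
    weights and the diagonal entry 2. So the entries are Gaussian integers, and
    \<open>E1 p = 1 - \<i>\<close> is the coordinate of \<open>VP\<close>.\<close>
  define E1 where "E1 u = scalar_plus 2 w u p * ((1 - \<i>) / 2)" for u
  have E1g: "E1 u \<in> gauss_ints" if uV: "u \<in> V" for u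
  proof (cases "u = p")
    case True
    then show ?thesis using diag[OF p] by (simp add: E1_def gauss_ints_def)
  next
    case False
    have "w u p = cnj (w p u)" using hermD[OF cycD(2)[OF cyc] p uV] by simp
    then consider "w u p = 0" | "(cmod (w u p))\<^sup>2 = 2" using fat[OF uV] by auto
    then show ?thesis
    proof cases
      case 2
      obtain t where t: "gunit t" "w u p = (1 + \<i>) * t"
        using gauss_norm_2[OF cycD(3)[OF cyc uV p] 2] by auto
      have "E1 u = ((1 - \<i>) * (1 + \<i>)) / 2 * t" using False by (simp add: E1_def t)
      then show ?thesis using t by (simp add: ii_mult gunit_def)
    qed (use False in \<open>simp add: E1_def\<close>)
  qed
  have "chain V w 1 (\<lambda>_. E1) (\<lambda>_. p) (\<lambda>_. 1)"
  proof -
    have "psd V (\<lambda>u v. scalar_plus 2 w u v - E1 u * cnj (E1 v))"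
      by (rule psd_schur_complement[OF cyc_psd(1)[OF cyc] p, of 2 _ "(1 - \<i>) / 2"])
        (use diag[OF p] in \<open>auto simp: E1_def norm_divide power_divide cmod_power2\<close>)
    then have "psd V (residual w 1 (\<lambda>_. E1))" by (simp add: residual_def[abs_def])
    then show ?thesis
      using p E1g diag[OF p] by (auto simp: chain_def chain_vertices_def dlt_def E1_def)
  qed
  have all: "\<exists>E \<phi> s. chain V w (Suc m) E \<phi> s" for m
  proof (induction m)
    case 0
    then show ?case using \<open>chain V w 1 _ _ _\<close> by auto
  next
    case (Suc m)
    then show ?case using step by blast
  qed
  obtain E \<phi> s where "chain V w (Suc (card V)) E \<phi> s" using all by blast
  then have "card (chain_vertices (Suc (card V))) \<le> card V"
    using fin by (intro card_inj_on_le[of \<phi>]) (auto simp: chain_def)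
  then show False using card_chain_vertices[of "Suc (card V)"] by simp
qed

section \<open>Classification of the weights\<close>

lemma gauss_norm_4:
  assumes "z \<in> gauss_ints" "(cmod z)\<^sup>2 = 4"
  obtains t where "gunit t" "z = 2 * t"
proof -
  obtain a b where z: "z = Complex (of_int a) (of_int b)" by (rule gauss_intsE[OF assms(1)])
  have "real_of_int (a\<^sup>2 + b\<^sup>2) = of_int 4" using assms(2) unfolding z cmod_power2 by simp
  then have ab: "a\<^sup>2 + b\<^sup>2 = 4" unfolding of_int_eq_iff .
  have bound: "x \<in> {-2, -1, 0, 1, 2}" if "x\<^sup>2 + y\<^sup>2 = 4" for x y :: int
  proof (rule ccontr)
    assume "x \<notin> {-2, -1, 0, 1, 2}"
    then have "\<bar>x\<bar> \<ge> 3" by auto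
    then have "\<bar>x\<bar>\<^sup>2 \<ge> 3\<^sup>2" by (intro power_mono) auto
    then show False using that zero_le_power2[of y] by simp
  qed
  have "a \<in> {-2, -1, 0, 1, 2}" "b \<in> {-2, -1, 0, 1, 2}"
    using bound[OF ab] bound[of b a] ab by (simp_all add: add.commute)
  then have "(a, b) \<in> {(2, 0), (-2, 0), (0, 2), (0, -2)}"
    using ab by (elim insertE emptyE) simp_all
  then have "z \<in> {2 * 1, 2 * (-1), 2 * \<i>, 2 * (-\<i>)}"
    unfolding z by (auto simp: complex_eq_iff)
  moreover have "gunit 1" "gunit (- \<i>)" "gunit \<i>" "gunit (-1)"
    by (simp_all add: gunit_def gauss_ints_def)
  ultimately show ?thesis using that by blast
qed

lemma embeds_S2:
  assumes c: "cyc V w" and cn: "conn V w" and diag: "\<And>u. u \<in> V \<Longrightarrow> w u u = 0"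
    and ab: "a \<in> V" "b \<in> V" and n: "(cmod (w a b))\<^sup>2 \<ge> 4"
  shows "\<exists>f s. embeds V w (fst S2_graph) (snd S2_graph) f s \<and> f ` V = fst S2_graph"
proof -
  have f: "finite V" by (rule cycD(1)[OF c])
  have h: "cnj (w u v) = w v u" if "u \<in> V" "v \<in> V" for u v
    by (rule hermD[OF cycD(2)[OF c] that])
  have hn: "cmod (w v u) = cmod (w u v)" if "u \<in> V" "v \<in> V" for u v
    using h[OF that] by (metis complex_mod_cnj)
  have neq: "a \<noteq> b" using n diag ab by auto
  have only: "w v y = 0" if xy: "x \<in> V" "y \<in> V" "(cmod (w x y))\<^sup>2 \<ge> 4" and v: "v \<in> V" "v \<noteq> x" for x y v
  proof -
    have "(\<Sum>u\<in>{x, v}. (cmod (w u y))\<^sup>2) \<le> nsq V (\<lambda>u. w u y)"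
      unfolding nsq_def by (rule sum_mono2) (use f xy v in auto)
    moreover have "(\<Sum>u\<in>{x, v}. (cmod (w u y))\<^sup>2) = (cmod (w x y))\<^sup>2 + (cmod (w v y))\<^sup>2" using v by simp
    ultimately have "(cmod (w v y))\<^sup>2 \<le> 0" using cyc_nsq_col[OF c xy(2)] xy(3) by linarith
    then show ?thesis by simp
  qed
  have ob: "w v b = 0" if "v \<in> V" "v \<noteq> a" for v using only[OF ab n that] .
  have oa: "w v a = 0" if "v \<in> V" "v \<noteq> b" for v using only[OF ab(2,1) _ that] n hn[OF ab] by simp
  have V: "V = {a, b}"
  proof (rule ccontr)
    assume "V \<noteq> {a, b}"
    then have "{a, b} \<subset> V \<and> {a, b} \<noteq> {}" using ab by auto
    then have "\<exists>x\<in>{a, b}. \<exists>v\<in>V - {a, b}. w x v \<noteq> 0" using cn unfolding conn_def by blast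
    then obtain x v where "x \<in> {a, b}" "v \<in> V - {a, b}" "w x v \<noteq> 0" by blast
    then show False using oa[of v] ob[of v] h[of v x] ab by auto
  qed
  have "(cmod (w a b))\<^sup>2 \<le> 4"
    using cyc_nsq_col[OF c ab(2)] nsq_ge_entry[OF f ab(1), of "\<lambda>u. w u b"] by simp
  then obtain t where t: "gunit t" "w a b = 2 * t"
    using gauss_norm_4[OF cycD(3)[OF c ab]] n by auto
  define F where "F u = (if u = a then V1 else V2)" for u
  define s where "s u = (if u = a then t else 1)" for u
  have "embeds V w (fst S2_graph) (snd S2_graph) F s \<and> F ` V = fst S2_graph"
    unfolding embeds_def V using neq t h[OF ab] diag ab
    by (auto simp: F_def s_def S2_graph_def hermitian_weight_def listed_def)
  then show ?thesis by blast
qed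

lemma classification:
  assumes c: "cyc V w" and cn: "conn V w" and ne: "no_ext V w" and diag: "\<And>u. u \<in> V \<Longrightarrow> w u u = 0"
    and a: "a \<in> V" and b: "b \<in> V" and n: "(cmod (w a b))\<^sup>2 > 1"
  shows "(\<exists>k\<ge>2. \<exists>f s. embeds V w (fst (C_graph k)) (snd (C_graph k)) f s \<and> f ` V = fst (C_graph k))
    \<or> (\<exists>f s. embeds V w (fst S2_graph) (snd S2_graph) f s \<and> f ` V = fst S2_graph)
    \<or> (\<exists>f s. embeds V w UNIV s8dd f s \<and> f ` V = UNIV)
    \<or> (\<exists>f s. embeds V w UNIV s8d f s \<and> f ` V = UNIV)"
proof (cases "\<exists>u\<in>V. \<exists>v\<in>V. (cmod (w u v))\<^sup>2 \<ge> 4")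
  case True
  then obtain u v where "u \<in> V" "v \<in> V" "(cmod (w u v))\<^sup>2 \<ge> 4" by blast
  from embeds_S2[OF c cn diag this] show ?thesis by (intro disjI2[OF disjI1])
next
  case False
  then have small: "(cmod (w u v))\<^sup>2 < 4" if "u \<in> V" "v \<in> V" for u v using that by force
  interpret uncharged V w by unfold_locales (use c diag small in auto)
  have cases4: "w u v = 0 \<or> (cmod (w u v))\<^sup>2 = 1 \<or> (cmod (w u v))\<^sup>2 = 2" if "u \<in> V" "v \<in> V" for u v
    by (rule gauss_norm_cases[OF cycD(3)[OF c that] small[OF that]]) auto
  have fat: "(cmod (w a b))\<^sup>2 = 2" using cases4[OF a b] n by auto
  show ?thesis
  proof (cases "(\<exists>x\<in>V. (cmod (w a x))\<^sup>2 = 1) \<and> (\<exists>y\<in>V. (cmod (w b y))\<^sup>2 = 1)")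
    case True
    then obtain x y where "x \<in> V" "(cmod (w a x))\<^sup>2 = 1" "y \<in> V" "(cmod (w b y))\<^sup>2 = 1" by blast
    then have "(\<exists>f s. embeds V w UNIV s8dd f s) \<or> (\<exists>f s. embeds V w UNIV s8d f s)"
      using a b by (intro fat_edge_with_light_neighbours[OF c cn diag small _ fat]) auto
    moreover have "V \<noteq> {}" using a by blast
    ultimately show ?thesis
    proof (elim disjE exE)
      fix f s assume e: "embeds V w UNIV s8dd f s"
      have "f ` V = UNIV"
        by (rule embeds_no_ext_surj[OF e ne \<open>V \<noteq> {}\<close> s8_cyc(1) s8_conn(1) s8_diag(1)])
      with e show ?thesis by (intro disjI2[OF disjI2[OF disjI1]] exI conjI)
    next
      fix f s assume e: "embeds V w UNIV s8d f s"
      have "f ` V = UNIV"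
        by (rule embeds_no_ext_surj[OF e ne \<open>V \<noteq> {}\<close> s8_cyc(2) s8_conn(2) s8_diag(2)])
      with e show ?thesis by (intro disjI2[OF disjI2[OF disjI2]] exI conjI)
    qed
  next
    case False
    then obtain p where p: "p \<in> V" "\<And>x. x \<in> V \<Longrightarrow> (cmod (w p x))\<^sup>2 \<noteq> 1" using a b by blast
    have "w p x = 0 \<or> (cmod (w p x))\<^sup>2 = 2" if "x \<in> V" for x
      using cases4[OF p(1) that] p(2)[OF that] by blast
    from all_edges_fat[OF cn ne p(1) this] show ?thesis by blast
  qed
qed

section \<open>Matrices and weights\<close>

abbreviation (input) entry :: "complex mat \<Rightarrow> nat \<Rightarrow> nat \<Rightarrow> complex" where
  "entry A \<equiv> \<lambda>i j. A $$ (i, j)"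

lemma mat_adjoint_carrier: "A \<in> carrier_mat m n \<Longrightarrow> mat_adjoint A \<in> carrier_mat n m"
  by (auto simp: mat_adjoint_def)

lemma mat_adjoint_entry:
  fixes A :: "complex mat"
  assumes "i < dim_col A" "j < dim_row A"
  shows "mat_adjoint A $$ (i, j) = cnj (A $$ (j, i))"
  using assms by (simp add: mat_adjoint_def mat_of_rows_def conjugate_complex_def)

lemma hermitian_mat_iff:
  assumes "A \<in> carrier_mat n n"
  shows "hermitian_mat A \<longleftrightarrow> herm {..<n} (entry A)"
proof
  assume "hermitian_mat A"
  then have eq: "mat_adjoint A = A" by (simp add: hermitian_mat_def)
  have "cnj (A $$ (u, v)) = A $$ (v, u)" if "u < n" "v < n" for u v
    using mat_adjoint_entry[of v A u] assms that by (simp add: eq)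
  then show "herm {..<n} (entry A)" by (simp add: herm_def)
next
  assume h: "herm {..<n} (entry A)"
  have "mat_adjoint A = A"
    using hermD[OF h] mat_adjoint_carrier[OF assms] assms
    by (intro eq_matI) (auto simp: mat_adjoint_entry)
  then show "hermitian_mat A" using assms by (simp add: hermitian_mat_def)
qed

lemma gauss_mat_iff:
  assumes "A \<in> carrier_mat n n"
  shows "gauss_mat A \<longleftrightarrow> (\<forall>i<n. \<forall>j<n. A $$ (i, j) \<in> gauss_ints)"
  using assms unfolding gauss_mat_def by (fastforce simp: elements_mat_def)

lemma mult_mat_vec_entry:
  assumes "A \<in> carrier_mat n n" "v \<in> carrier_vec n" "i < n"
  shows "(A *\<^sub>v v) $ i = mv {..<n} (entry A) (($) v) i"
  using assms by (simp add: mv_def scalar_prod_def atLeast0LessThan)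

lemma ip_cauchy_schwarz:
  assumes "finite V"
  shows "(cmod (ip V y z))\<^sup>2 \<le> nsq V y * nsq V z"
proof -
  let ?I = "\<lambda>u v. if u = v then 1 else 0 :: complex"
  have "mv V ?I t v = t v" if "v \<in> V" for t v
  proof -
    have "mv V ?I t v = (\<Sum>u\<in>V. if v = u then t u else 0)"
      unfolding mv_def by (rule sum.cong) auto
    then show ?thesis using that assms by simp
  qed
  then have mv: "ip V x (mv V ?I t) = ip V x t" for x t
    by (intro ip_cong) simp_all
  have "psd V ?I" using assms by (auto simp: psd_def herm_def mv ip_self nsq_nonneg)
  from psd_cauchy_schwarz[OF this, of y z] show ?thesis unfolding mv by (simp add: ip_self)
qed

text \<open>For a Hermitian kernel the norms of the iterates of a vector are log-convex. So they cannot stay bounded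
  once the norm increases.\<close>

lemma herm_bounded_iterates:
  assumes f: "finite V" and h: "herm V h"
    and bnd: "\<And>k. nsq V ((mv V h ^^ k) z) \<le> D"
  shows "nsq V (mv V h z) \<le> nsq V z"
proof (rule ccontr)
  define a where "a k = nsq V ((mv V h ^^ k) z)" for k
  assume "\<not> ?thesis"
  then have a01: "a 0 < a 1" by (simp add: a_def)
  have a0: "0 \<le> a k" for k by (simp add: a_def nsq_nonneg)
  have convex: "(a (Suc k))\<^sup>2 \<le> a k * a (Suc (Suc k))" for k
  proof -
    have "ip V ((mv V h ^^ Suc k) z) ((mv V h ^^ Suc k) z) = cnj (ip V ((mv V h ^^ k) z) ((mv V h ^^ Suc (Suc k)) z))"
      using herm_ip_mv[OF h, of "(mv V h ^^ Suc k) z" "(mv V h ^^ k) z"] by simp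
    then have "complex_of_real (a (Suc k)) = cnj (ip V ((mv V h ^^ k) z) ((mv V h ^^ Suc (Suc k)) z))"
      by (simp only: a_def ip_self)
    then have "cmod (complex_of_real (a (Suc k))) = cmod (ip V ((mv V h ^^ k) z) ((mv V h ^^ Suc (Suc k)) z))"
      by (simp only: complex_mod_cnj)
    then have "(a (Suc k))\<^sup>2 = (cmod (ip V ((mv V h ^^ k) z) ((mv V h ^^ Suc (Suc k)) z)))\<^sup>2"
      by (metis norm_of_real power2_abs)
    then show ?thesis using ip_cauchy_schwarz[OF f] by (simp only: a_def)
  qed
  have a0pos: "0 < a 0"
  proof (rule ccontr)
    assume "\<not> 0 < a 0"
    then have "a 0 = 0" using a0[of 0] by simp
    then have "(a 1)\<^sup>2 \<le> 0" using convex[of 0] by simp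
    then show False using a01 \<open>a 0 = 0\<close> by simp
  qed
  define r where "r = a 1 / a 0"
  have r: "1 < r" using a01 a0pos by (simp add: r_def)
  have step: "0 < a k \<and> r * a k \<le> a (Suc k)" for k
  proof (induction k)
    case 0
    then show ?case using a0pos by (simp add: r_def)
  next
    case (Suc k)
    have pos: "0 < a (Suc k)" using Suc r by (smt (verit) mult_pos_pos)
    have "r * a (Suc k) * a k \<le> a (Suc k) * a (Suc k)"
      using Suc pos mult_right_mono[of "r * a k" "a (Suc k)" "a (Suc k)"] by (simp add: mult_ac)
    also have "\<dots> \<le> a (Suc (Suc k)) * a k" using convex[of k] by (simp add: power2_eq_square mult.commute)
    finally show ?case using Suc pos by simp
  qed
  have pow: "r ^ k * a 0 \<le> a k" for k
  proof (induction k)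
    case (Suc k)
    have "r * (r ^ k * a 0) \<le> r * a k" using Suc r by (intro mult_left_mono) auto
    then show ?case using step[of k] by (simp add: mult.assoc)
  qed simp
  obtain k where "D / a 0 < r ^ k" using real_arch_pow[OF r] by blast
  then have "D < r ^ k * a 0" using a0pos by (simp add: field_simps)
  then show False using pow[of k] bnd[of k] by (simp add: a_def)
qed

section \<open>From eigenvalues to the quadratic form and back\<close>

lemma pow_mat_Suc_commute:
  fixes A :: "'a :: semiring_1 mat"
  assumes A: "A \<in> carrier_mat n n"
  shows "A ^\<^sub>m k * A = A * A ^\<^sub>m k"
proof (induction k)
  case (Suc k)
  have "A ^\<^sub>m Suc k * A = A * A ^\<^sub>m k * A" using Suc by simp
  also have "\<dots> = A * (A ^\<^sub>m k * A)"
    by (rule assoc_mult_mat[OF A pow_carrier_mat[OF A] A])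
  finally show ?case by simp
qed (use A in simp)

lemma pow_mat_vec_entry:
  assumes A: "A \<in> carrier_mat n n" and v: "v \<in> carrier_vec n"
  shows "A ^\<^sub>m k *\<^sub>v v \<in> carrier_vec n \<and> (\<forall>i<n. (A ^\<^sub>m k *\<^sub>v v) $ i = (mv {..<n} (entry A) ^^ k) (($) v) i)"
proof (induction k)
  case 0
  then show ?case using A v by simp
next
  case (Suc k)
  have "A ^\<^sub>m Suc k *\<^sub>v v = A *\<^sub>v (A ^\<^sub>m k *\<^sub>v v)"
    by (simp add: pow_mat_Suc_commute[OF A] assoc_mult_mat_vec[OF A pow_carrier_mat[OF A] v])
  moreover have "mv {..<n} (entry A) (($) (A ^\<^sub>m k *\<^sub>v v)) i = mv {..<n} (entry A) ((mv {..<n} (entry A) ^^ k) (($) v)) i" for i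
    by (rule mv_cong) (use Suc in auto)
  ultimately show ?case using Suc A mult_mat_vec_entry[OF A, of "A ^\<^sub>m k *\<^sub>v v"] by simp
qed

text \<open>A spectral radius below 1 bounds the entries of all powers uniformly, hence all iterates
  of \<open>z\<close>; \<open>herm_bounded_iterates\<close> then excludes that the first step
  increases the norm.\<close>

lemma spectral_radius_nsq_mv:
  assumes A: "A \<in> carrier_mat n n" and h: "herm {..<n} (entry A)" and sr: "spectral_radius A < 1"
  shows "nsq {..<n} (mv {..<n} (entry A) z) \<le> nsq {..<n} z"
proof -
  obtain C where C: "\<And>k. norm_bound (A ^\<^sub>m k) C"
    using spectral_radius_jnf_norm_bound_less_1_upper_triangular[OF A sr] by blast
  define v where "v = vec n z"
  have v: "v \<in> carrier_vec n" by (simp add: v_def)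
  have vz: "v $ i = z i" if "i < n" for i using that by (simp add: v_def)
  define B where "B = (\<Sum>j<n. C * cmod (z j))"
  have "nsq {..<n} ((mv {..<n} (entry A) ^^ k) (($) v)) \<le> (\<Sum>i<n. B\<^sup>2)" for k
    unfolding nsq_def
  proof (rule sum_mono)
    fix i assume i: "i \<in> {..<n}"
    have P: "A ^\<^sub>m k \<in> carrier_mat n n" by (rule pow_carrier_mat[OF A])
    have "(mv {..<n} (entry A) ^^ k) (($) v) i = (\<Sum>j<n. (A ^\<^sub>m k) $$ (i, j) * z j)"
      using pow_mat_vec_entry[OF A v, of k] mult_mat_vec_entry[OF P v, of i] i by (simp add: mv_def vz)
    also have "cmod \<dots> \<le> B"
      unfolding B_def
    proof (rule sum_norm_le)
      fix j assume "j \<in> {..<n}"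
      then have "cmod ((A ^\<^sub>m k) $$ (i, j)) \<le> C" using C[of k] A i by (auto simp: norm_bound_def split: if_splits)
      then show "cmod ((A ^\<^sub>m k) $$ (i, j) * z j) \<le> C * cmod (z j)"
        by (simp add: norm_mult mult_right_mono)
    qed
    finally show "(cmod ((mv {..<n} (entry A) ^^ k) (($) v) i))\<^sup>2 \<le> B\<^sup>2" by (rule power_mono) simp
  qed
  then have "nsq {..<n} (mv {..<n} (entry A) (($) v)) \<le> nsq {..<n} (($) v)"
    by (rule herm_bounded_iterates[OF finite_lessThan h])
  moreover have "mv {..<n} (entry A) (($) v) i = mv {..<n} (entry A) z i" for i
    by (rule mv_cong) (simp add: vz)
  ultimately show ?thesis by (simp add: nsq_def vz)
qed

text \<open>If \<open>A\<close> more than doubled the length of \<open>z\<close>, then q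
  \<open>A\<close> with some q < 1/2 would still lengthen \<open>z\<close>, although its spectral
  radius is at most 2 q < 1.\<close>

lemma cyclotomic_mat_imp_cyc:
  assumes A: "A \<in> carrier_mat n n" and n: "n > 0" and c: "cyclotomic_mat A"
  shows "cyc {..<n} (entry A)"
proof (rule cyc_of_nsq_mv)
  have h: "herm {..<n} (entry A)" using c hermitian_mat_iff[OF A] by (simp add: cyclotomic_mat_def)
  show "herm {..<n} (entry A)" by (rule h)
  show "A $$ (u, v) \<in> gauss_ints" if "u \<in> {..<n}" "v \<in> {..<n}" for u v
    using c gauss_mat_iff[OF A] that by (simp add: cyclotomic_mat_def)
  fix z
  let ?V = "{..<n}"
  show "nsq ?V (mv ?V (entry A) z) \<le> 4 * nsq ?V z"
  proof (rule ccontr)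
    assume gt: "\<not> ?thesis"
    then have lt: "4 * nsq ?V z < nsq ?V (mv ?V (entry A) z)" by simp
    define N where "N = nsq ?V (mv ?V (entry A) z)"
    have N: "0 < N" using lt nsq_nonneg[of ?V z] by (simp add: N_def)
    have "nsq ?V z / N < 1 / 4" using lt N by (simp add: N_def field_simps)
    \<comment> \<open>\<open>d\<close> is the square of the scaling factor: below 1/4 for the
      spectral radius, above the quotient so that the scaled matrix still increases the
      norm.\<close>
    then obtain d where d: "nsq ?V z / N < d" "d < 1 / 4" using dense by blast
    have d0: "0 < d" using d(1) N nsq_nonneg[of ?V z] by (smt (verit) divide_nonneg_pos)
    define q where "q = sqrt d"
    have q: "0 < q" "q\<^sup>2 = d" using d0 by (simp_all add: q_def)
    have q2: "q < 1 / 2"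
      using d(2) q by (intro power2_less_imp_less[of q]) (simp_all add: power2_eq_square)
    define B where "B = complex_of_real q \<cdot>\<^sub>m A"
    have B: "B \<in> carrier_mat n n" using A by (simp add: B_def)
    have Be: "B $$ (i, j) = of_real q * A $$ (i, j)" if "i < n" "j < n" for i j
      using A that by (simp add: B_def)
    have hB: "herm ?V (entry B)"
      unfolding herm_def using hermD[OF h] by (simp add: Be)
    have "spectral_radius B < 1"
    proof -
      obtain e where e: "e \<in> spectrum B" "spectral_radius B = cmod e"
        using spectral_radius_mem_max(1)[OF B n] by auto
      then obtain v where v: "v \<in> carrier_vec n" "v \<noteq> 0\<^sub>v n" "B *\<^sub>v v = e \<cdot>\<^sub>v v"
        using B by (auto simp: spectrum_def eigenvalue_def eigenvector_def)
      have "A *\<^sub>v v = (e / of_real q) \<cdot>\<^sub>v v"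
      proof (rule eq_vecI)
        fix i assume "i < dim_vec ((e / of_real q) \<cdot>\<^sub>v v)"
        then have i: "i < n" using v by simp
        have "of_real q * (A *\<^sub>v v) $ i = (B *\<^sub>v v) $ i"
          using A B v(1) i by (simp add: scalar_prod_def Be sum_distrib_left mult.assoc)
        also have "\<dots> = e * v $ i" using v i by simp
        finally show "(A *\<^sub>v v) $ i = ((e / of_real q) \<cdot>\<^sub>v v) $ i"
          using q v(1) i by (simp add: field_simps)
      qed (use A v in simp)
      then have "eigenvalue A (e / of_real q)"
        using A v by (auto simp: eigenvalue_def eigenvector_def)
      then obtain t where "t \<in> {-2..2}" "e / of_real q = complex_of_real t"
        using c unfolding cyclotomic_mat_def by blast
      then have "cmod (e / of_real q) \<le> 2" by auto
      then have "cmod e \<le> 2 * q" using q by (simp add: norm_divide field_simps)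
      then show ?thesis using q2 e(2) by simp
    qed
    then have "nsq ?V (mv ?V (entry B) z) \<le> nsq ?V z" by (rule spectral_radius_nsq_mv[OF B hB])
    moreover have "nsq ?V (mv ?V (entry B) z) = d * N"
    proof -
      have "mv ?V (entry B) z i = of_real q * mv ?V (entry A) z i" if "i < n" for i
        using that by (simp add: mv_def Be sum_distrib_left mult.assoc)
      then have "nsq ?V (mv ?V (entry B) z) = nsq ?V (\<lambda>i. of_real q * mv ?V (entry A) z i)"
        by (simp add: nsq_def)
      then show ?thesis using q by (simp add: nsq_scale N_def)
    qed
    ultimately show False using d(1) N by (simp add: field_simps)
  qed
qed simp

lemma cyc_imp_cyclotomic_mat:
  assumes A: "A \<in> carrier_mat n n" and c: "cyc {..<n} (entry A)"
  shows "cyclotomic_mat A"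
proof -
  have h: "herm {..<n} (entry A)" by (rule cycD(2)[OF c])
  have "x \<in> complex_of_real ` {-2..2}" if ev: "eigenvalue A x" for x
  proof -
    obtain v where v: "v \<in> carrier_vec n" "v \<noteq> 0\<^sub>v n" "A *\<^sub>v v = x \<cdot>\<^sub>v v"
      using ev A by (auto simp: eigenvalue_def eigenvector_def)
    let ?z = "($) v"
    have "mv {..<n} (entry A) ?z i = x * ?z i" if "i < n" for i
      using mult_mat_vec_entry[OF A v(1) that] v that by simp
    then have "ip {..<n} ?z (mv {..<n} (entry A) ?z) = ip {..<n} ?z (\<lambda>i. x * ?z i)"
      by (intro ip_cong) auto
    then have e: "ip {..<n} ?z (mv {..<n} (entry A) ?z) = x * of_real (nsq {..<n} ?z)"
      by (simp add: ip_scale ip_self)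
    obtain i where i: "i < n" "v $ i \<noteq> 0" using v(1,2) by (metis eq_vecI carrier_vecD index_zero_vec)
    then have pos: "0 < nsq {..<n} ?z"
      using nsq_ge_entry[of "{..<n}" i ?z] by (smt (verit) finite_lessThan lessThan_iff zero_less_norm_iff zero_less_power)
    have "Im (x * of_real (nsq {..<n} ?z)) = 0"
      using herm_ip_real[OF h, of ?z] unfolding e by (metis Im_complex_of_real)
    then have im: "Im x = 0" using pos by simp
    have "\<bar>Re (ip {..<n} ?z (mv {..<n} (entry A) ?z))\<bar> \<le> 2 * nsq {..<n} ?z" using c unfolding cyc_def by blast
    then have "\<bar>Re x\<bar> * nsq {..<n} ?z \<le> 2 * nsq {..<n} ?z" unfolding e using pos by (simp add: abs_mult)
    then have "\<bar>Re x\<bar> \<le> 2" using pos by simp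
    then show ?thesis using im by (intro image_eqI[of _ _ "Re x"]) (auto simp: complex_eq_iff)
  qed
  then show ?thesis
    using gauss_mat_iff[OF A] hermitian_mat_iff[OF A] cycD[OF c] by (simp add: cyclotomic_mat_def)
qed

section \<open>Connectedness, maximality and equivalence of matrices\<close>

lemma indecomposable_imp_conn:
  assumes A: "A \<in> carrier_mat n n" and ind: "indecomposable_mat A"
  shows "conn {..<n} (entry A)"
  unfolding conn_def
proof (intro allI impI)
  fix S assume S: "S \<subset> {..<n} \<and> S \<noteq> {}"
  then obtain a b where a: "a \<in> S" and b: "b \<in> {..<n}" "b \<notin> S" by blast
  show "\<exists>u\<in>S. \<exists>v\<in>{..<n} - S. A $$ (u, v) \<noteq> 0"
  proof (rule ccontr)
    assume none: "\<not> ?thesis"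
    have "(a, b) \<in> (adjacent_in A)\<^sup>*" using ind A a b S unfolding indecomposable_mat_def by auto
    then have "b \<in> S"
      by (induction rule: rtrancl_induct) (use a none A in \<open>auto simp: adjacent_in_def\<close>)
    then show False using b by simp
  qed
qed

text \<open>A vector \<open>x\<close> violating \<open>no_ext\<close> borders \<open>A\<close> to a
  matrix \<open>B\<close> with last diagonal entry 0. The violated bound makes \<open>B\<close>
  cyclotomic, a nonzero entry of \<open>x\<close> makes it connected, and its first n rows and
  columns give back \<open>A\<close>.\<close>

lemma maximal_imp_no_ext:
  assumes A: "A \<in> carrier_mat n n" and n: "n > 0" and mx: "maximal_indecomposable_cyclotomic A"
  shows "no_ext {..<n} (entry A)"
  unfolding no_ext_def
proof (intro allI impI notI)
  fix x
  assume x: "(\<forall>u\<in>{..<n}. x u \<in> gauss_ints) \<and> (\<exists>u\<in>{..<n}. x u \<noteq> 0)"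
    and bnd: "\<forall>z \<zeta>. \<bar>Re (ip {..<n} z (mv {..<n} (entry A) z)) + 2 * Re (\<zeta> * ip {..<n} z x)\<bar>
      \<le> 2 * (nsq {..<n} z + (cmod \<zeta>)\<^sup>2)"
  have cA: "cyc {..<n} (entry A)" and iA: "indecomposable_mat A"
    using mx cyclotomic_mat_imp_cyc[OF A n] by (auto simp: maximal_indecomposable_cyclotomic_def)
  define B where "B = mat (Suc n) (Suc n) (\<lambda>(i, j). if i < n \<and> j < n then A $$ (i, j)
    else if i < n then x i else if j < n then cnj (x j) else 0)"
  have B: "B \<in> carrier_mat (Suc n) (Suc n)" by (simp add: B_def)
  have Be: "B $$ (i, j) = A $$ (i, j)" "B $$ (i, n) = x i" "B $$ (n, i) = cnj (x i)" "B $$ (n, n) = 0"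
    if "i < n" "j < n" for i j using that by (simp_all add: B_def)
  have S: "{..<Suc n} = insert n {..<n}" by auto
  have Bnn: "B $$ (n, n) = 0" by (simp add: B_def)
  have mvB: "mv {..<Suc n} (entry B) z i = x i * z n + mv {..<n} (entry A) z i" if "i < n" for z i
    unfolding mv_def S using that by (simp add: Be)
  have mvBn: "mv {..<Suc n} (entry B) z n = cnj (ip {..<n} z x)" for z
    unfolding mv_def S cnj_ip unfolding ip_def by (simp add: Be Bnn)
  have cB: "cyc {..<Suc n} (entry B)"
    unfolding cyc_def
  proof (intro conjI ballI allI)
    show "B $$ (i, j) \<in> gauss_ints" if "i \<in> {..<Suc n}" "j \<in> {..<Suc n}" for i j
      using that x cycD(3)[OF cA] unfolding S by (auto simp: Be Bnn gauss_ints_cnj)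
    show "herm {..<Suc n} (entry B)"
      unfolding herm_def S using hermD[OF cycD(2)[OF cA]] by (auto simp: Be Bnn)
    fix z
    have "ip {..<Suc n} z (mv {..<Suc n} (entry B) z)
      = cnj (z n * ip {..<n} z x) + (\<Sum>i<n. cnj (z i) * (x i * z n + mv {..<n} (entry A) z i))"
      unfolding ip_def[of "{..<Suc n}"] S[THEN arg_cong, of "sum _"] by (simp add: mvB mvBn)
    also have "(\<Sum>i<n. cnj (z i) * (x i * z n + mv {..<n} (entry A) z i))
      = z n * ip {..<n} z x + ip {..<n} z (mv {..<n} (entry A) z)"
      by (simp add: ip_def distrib_left sum.distrib sum_distrib_left mult_ac)
    finally have "Re (ip {..<Suc n} z (mv {..<Suc n} (entry B) z))
      = Re (ip {..<n} z (mv {..<n} (entry A) z)) + 2 * Re (z n * ip {..<n} z x)" by simp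
    moreover have "nsq {..<Suc n} z = nsq {..<n} z + (cmod (z n))\<^sup>2"
      by (simp add: nsq_def)
    ultimately show "\<bar>Re (ip {..<Suc n} z (mv {..<Suc n} (entry B) z))\<bar> \<le> 2 * nsq {..<Suc n} z"
      using bnd by simp
  qed simp
  obtain p where p: "p < n" "x p \<noteq> 0" using x by auto
  have mono: "adjacent_in A \<subseteq> adjacent_in B"
    using A B by (auto simp: adjacent_in_def Be)
  have old: "(i, j) \<in> (adjacent_in B)\<^sup>*" if "i < n" "j < n" for i j
    using iA A that rtrancl_mono[OF mono] by (auto simp: indecomposable_mat_def)
  have "(p, n) \<in> adjacent_in B" "(n, p) \<in> adjacent_in B"
    using p B by (auto simp: adjacent_in_def Be)
  then have new: "(i, n) \<in> (adjacent_in B)\<^sup>*" "(n, i) \<in> (adjacent_in B)\<^sup>*" if "i < n" for i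
    using old[OF that p(1)] old[OF p(1) that] by (meson rtrancl.rtrancl_into_rtrancl converse_rtrancl_into_rtrancl)+
  have iB: "indecomposable_mat B"
    unfolding indecomposable_mat_def using B old new by (auto simp: less_Suc_eq)
  have pick: "pick {..<n} i = i" if "i < n" for i
  proof -
    have "{a \<in> {..<n}. a < i} = {..<i}" using that by auto
    then show ?thesis using pick_card_in_set[of i "{..<n}"] that by simp
  qed
  have "{i. i < Suc n \<and> i \<in> {..<n}} = {..<n}" by auto
  then have "A = submatrix B {..<n} {..<n}"
    using A B by (intro eq_matI) (auto simp: submatrix_def pick Be)
  then have "proper_principal_submatrix A B"
    unfolding proper_principal_submatrix_def using B by (intro exI[of _ "{..<n}"]) auto
  then show False
    using mx cyc_imp_cyclotomic_mat[OF B cB] iB by (auto simp: maximal_indecomposable_cyclotomic_def)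
qed

text \<open>Being onto, \<open>f\<close> enumerates the vertices and so gives an adjacency matrix
  \<open>B\<close>; the diagonal matrix \<open>Q\<close> of the units conjugates it into
  \<open>A\<close>, with sign 1 and \<open>\<sigma>\<close> the identity.\<close>

lemma embeds_imp_equivalent:
  assumes A: "A \<in> carrier_mat n n" and c: "cyc {..<n} (entry A)"
    and e: "embeds {..<n} (entry A) G g f s" and surj: "f ` {..<n} = G"
  shows "equivalent_to_graph A (G, g)"
proof -
  have inj: "inj_on f {..<n}" and su: "gunit (s i)" and w: "A $$ (i, j) = s i * g (f i) (f j) * cnj (s j)"
    if "i < n" "j < n" for i j using e that by (auto simp: embeds_def)
  have bij: "bij_betw f {..<n} G" using e surj by (auto simp: embeds_def bij_betw_def)
  have card: "card G = n" using bij_betw_same_card[OF bij] by simp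
  have fin: "finite G" using surj by (metis finite_imageI finite_lessThan)
  define B where "B = mat n n (\<lambda>(i, j). g (f i) (f j))"
  define Q where "Q = mat n n (\<lambda>(i, j). if i = j then s i else 0)"
  have B: "B \<in> carrier_mat n n" and Q: "Q \<in> carrier_mat n n" by (simp_all add: B_def Q_def)
  have Q': "mat_adjoint Q \<in> carrier_mat n n" by (rule mat_adjoint_carrier[OF Q])
  have Qe: "Q $$ (i, j) = (if i = j then s i else 0)" "mat_adjoint Q $$ (i, j) = (if i = j then cnj (s i) else 0)"
    if "i < n" "j < n" for i j
    using that mat_adjoint_entry[of i Q j] Q by (auto simp: Q_def)
  have adj: "adjacency_matrix_of (G, g) B"
    using fin bij by (auto simp: adjacency_matrix_of_def card B_def)
  have mul: "(M * N) $$ (i, j) = (\<Sum>k<n. M $$ (i, k) * N $$ (k, j))"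
    if "M \<in> carrier_mat n n" "N \<in> carrier_mat n n" "i < n" "j < n" for M N :: "complex mat" and i j
    using that by (simp add: scalar_prod_def atLeast0LessThan)
  \<comment> \<open>Nothing is assumed about the values of \<open>g\<close>; the entries of
    \<open>B\<close> are recovered from those of \<open>A\<close> by undoing the units.\<close>
  have gB: "gauss_mat B"
    unfolding gauss_mat_iff[OF B]
  proof (intro allI impI)
    fix i j assume ij: "i < n" "j < n"
    have "cnj (s i) * A $$ (i, j) * s j = (cnj (s i) * s i) * g (f i) (f j) * (cnj (s j) * s j)"
      by (simp only: w[OF ij] mult_ac)
    also have "\<dots> = B $$ (i, j)" using ij by (simp add: gunit_cnj_mult[OF su[OF ij(1) ij(1)]] gunit_cnj_mult[OF su[OF ij(2) ij(2)]] B_def)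
    finally have "B $$ (i, j) = cnj (s i) * A $$ (i, j) * s j" by simp
    then show "B $$ (i, j) \<in> gauss_ints"
      using su[OF ij(1) ij(1)] su[OF ij(2) ij(2)] cycD(3)[OF c, of i j] ij
      by (auto simp: gunit_def intro!: gauss_ints_mult gauss_ints_cnj)
  qed
  have gQ: "gauss_mat Q"
    unfolding gauss_mat_iff[OF Q] using su by (simp add: Qe gunit_def)
  have "Q * mat_adjoint Q = 1\<^sub>m n"
  proof (rule eq_matI)
    fix i j assume "i < dim_row (1\<^sub>m n :: complex mat)" "j < dim_col (1\<^sub>m n :: complex mat)"
    then have ij: "i < n" "j < n" by simp_all
    have "(Q * mat_adjoint Q) $$ (i, j) = (\<Sum>k<n. if k = i then (if i = j then s i * cnj (s i) else 0) else 0)"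
      unfolding mul[OF Q Q' ij] by (rule sum.cong) (use ij in \<open>auto simp: Qe\<close>)
    then show "(Q * mat_adjoint Q) $$ (i, j) = 1\<^sub>m n $$ (i, j)"
      using ij gunit_cnj_mult[OF su[OF ij(1) ij(1)]] by (cases "i = j") simp_all
  qed (use Q Q' in auto)
  moreover have "mat_adjoint Q * Q = 1\<^sub>m n"
  proof (rule eq_matI)
    fix i j assume "i < dim_row (1\<^sub>m n :: complex mat)" "j < dim_col (1\<^sub>m n :: complex mat)"
    then have ij: "i < n" "j < n" by simp_all
    have "(mat_adjoint Q * Q) $$ (i, j) = (\<Sum>k<n. if k = i then (if i = j then cnj (s i) * s i else 0) else 0)"
      unfolding mul[OF Q' Q ij] by (rule sum.cong) (use ij in \<open>auto simp: Qe\<close>)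
    then show "(mat_adjoint Q * Q) $$ (i, j) = 1\<^sub>m n $$ (i, j)"
      using ij gunit_cnj_mult[OF su[OF ij(1) ij(1)]] by (cases "i = j") simp_all
  qed (use Q Q' in auto)
  ultimately have uQ: "gauss_unitary Q" using gQ Q by (simp add: gauss_unitary_def)
  have "A = Q * B * mat_adjoint Q"
  proof (rule eq_matI)
    fix i j assume "i < dim_row (Q * B * mat_adjoint Q)" "j < dim_col (Q * B * mat_adjoint Q)"
    then have ij: "i < n" "j < n" using Q Q' by auto
    have QB: "(Q * B) $$ (i, k) = s i * g (f i) (f k)" if "k < n" for k
    proof -
      have "(Q * B) $$ (i, k) = (\<Sum>l<n. if l = i then s i * g (f i) (f k) else 0)"
        unfolding mul[OF Q B ij(1) that] by (rule sum.cong) (use ij that in \<open>auto simp: Qe B_def\<close>)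
      then show ?thesis using ij by simp
    qed
    have "(Q * B * mat_adjoint Q) $$ (i, j) = (\<Sum>k<n. if k = j then s i * g (f i) (f j) * cnj (s j) else 0)"
      unfolding mul[OF mult_carrier_mat[OF Q B] Q' ij] by (rule sum.cong) (use ij in \<open>auto simp: QB Qe\<close>)
    then show "A $$ (i, j) = (Q * B * mat_adjoint Q) $$ (i, j)" using ij w[OF ij] by simp
  qed (use A Q Q' in auto)
  then have "A = 1 \<cdot>\<^sub>m map_mat id (Q * B * mat_adjoint Q)"
    using A by (intro eq_matI) auto
  moreover have "gauss_mat A" unfolding gauss_mat_iff[OF A] using cycD(3)[OF c] by simp
  ultimately have "equivalent_mat A B"
    unfolding equivalent_mat_def using uQ gB A B Q
    by (intro conjI exI[of _ Q] exI[of _ "1 :: complex"] exI[of _ id]) auto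
  then show ?thesis using adj unfolding equivalent_to_graph_def by blast
qed

theorem theorem3p2:
  fixes A :: "complex mat"
  assumes "maximal_indecomposable_cyclotomic A"
    and "\<forall>i < dim_row A. A $$ (i, i) = 0"
    and "\<exists>i < dim_row A. \<exists>j < dim_col A. (cmod (A $$ (i, j)))\<^sup>2 > 1"
  shows "(\<exists>k\<ge>2. equivalent_to_graph A (C_graph k))
    \<or> equivalent_to_graph A S2_graph
    \<or> equivalent_to_graph A S8_dagger_dagger_graph
    \<or> equivalent_to_graph A S8_ddagger_graph"
proof -
  define n where "n = dim_row A"
  have cyA: "cyclotomic_mat A" and iA: "indecomposable_mat A"
    using assms(1) by (auto simp: maximal_indecomposable_cyclotomic_def)
  have A: "A \<in> carrier_mat n n"
    using cyA by (auto simp: cyclotomic_mat_def gauss_mat_def n_def)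
  have n: "n > 0" using iA by (simp add: indecomposable_mat_def n_def)
  have c: "cyc {..<n} (entry A)" by (rule cyclotomic_mat_imp_cyc[OF A n cyA])
  have "dim_col A = n" using A by simp
  then obtain i j where ij: "i < n" "j < n" "(cmod (A $$ (i, j)))\<^sup>2 > 1"
    using assms(3) unfolding n_def by metis
  have G: "S8_dagger_dagger_graph = (UNIV, s8dd)" "S8_ddagger_graph = (UNIV, s8d)"
    by (simp_all add: s8dd_def s8d_def S8_dagger_dagger_graph_def S8_ddagger_graph_def)
  note eq = embeds_imp_equivalent[OF A c]
  have "(\<exists>k\<ge>2. \<exists>f s. embeds {..<n} (entry A) (fst (C_graph k)) (snd (C_graph k)) f s \<and> f ` {..<n} = fst (C_graph k))
    \<or> (\<exists>f s. embeds {..<n} (entry A) (fst S2_graph) (snd S2_graph) f s \<and> f ` {..<n} = fst S2_graph)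
    \<or> (\<exists>f s. embeds {..<n} (entry A) UNIV s8dd f s \<and> f ` {..<n} = UNIV)
    \<or> (\<exists>f s. embeds {..<n} (entry A) UNIV s8d f s \<and> f ` {..<n} = UNIV)"
  proof (rule classification[OF c indecomposable_imp_conn[OF A iA] maximal_imp_no_ext[OF A n assms(1)], of i j])
    show "A $$ (u, u) = 0" if "u \<in> {..<n}" for u using assms(2) that by (simp add: n_def)
  qed (use ij in simp_all)
  then show ?thesis
  proof (elim disjE exE conjE)
    fix k f s
    assume "2 \<le> k" "embeds {..<n} (entry A) (fst (C_graph k)) (snd (C_graph k)) f s" "f ` {..<n} = fst (C_graph k)"
    then have "equivalent_to_graph A (C_graph k)" using eq[of "fst (C_graph k)" "snd (C_graph k)"] by simp
    then show ?thesis using \<open>2 \<le> k\<close> by blast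
  next
    fix f s
    assume "embeds {..<n} (entry A) (fst S2_graph) (snd S2_graph) f s" "f ` {..<n} = fst S2_graph"
    then have "equivalent_to_graph A S2_graph" using eq[of "fst S2_graph" "snd S2_graph"] by simp
    then show ?thesis by blast
  qed (simp_all add: G eq)
qed

end
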